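(* Let $\mathfrak{s}$ be a solvable Lie algebra with nilradical of codimension one, and let $S$ be the simply connected Lie group with Lie algebra $\mathfrak{s}$. Assume that $S$ admits a solvsoliton $g$. Then $g$ is a global maximum for the functional $F=\frac{\operatorname{scal}^2}{|\operatorname{Ric}|^2}$ restricted to the set of all left-invariant metrics on $S$. Moreover, any other global maximum $g'$ is also a solvsoliton (i.e. $g'=c\,\varphi^*g$ for some $c>0$ and $\varphi\in\operatorname{Aut}(S)$).
   Context: Lie algebras are real and finite-dimensional, and left-invariant metrics are Riemannian. A left-invariant metric on a simply connected solvable Lie group $S$ with Lie algebra $\mathfrak{s}$ is called a solvsoliton if its Ricci operator satisfies $\operatorname{Ric}=cI+D$ for some $c\in\mathbb{R}$ and some derivation $D\in\operatorname{Der}(\mathfrak{s})$. The Ricci pinching functional $F$ assigns to a left-invariant metric the number $F=\operatorname{scal}^2/|\operatorname{Ric}|^2$, where $\operatorname{Ric}$ is its Ricci operator, $\operatorname{scal}=\operatorname{tr}\operatorname{Ric}$ its scalar curvature, and $|\operatorname{Ric}|^2=\operatorname{tr}(\operatorname{Ric}^2)$. The nilradical of $\mathfrak{s}$ is its maximal nilpotent ideal. $\operatorname{Aut}(S)$ is the group of Lie group automorphisms of $S$.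
   Formalization: The solvsoliton g is assumed not to be Ricci flat: if Ric(g)=0 (for example a flat metric on the simply connected cover of the Euclidean motion group of the plane), F(g)=0/0 is undefined and the claim has no meaning. *)

theory Defs
  imports "HOL-Analysis.Analysis"
begin

text \<open>
  The vector space underlying a Lie algebra is a type \<open>'a\<close> of class \<open>euclidean_space\<close>, used only as an
  arbitrary nonzero finite-dimensional real vector space: no notion below depends on the inner
  product \<open>x \<bullet> y\<close> of the class. The bracket is an explicit parameter \<open>br\<close>.

  The simply connected Lie group \<open>S\<close> of a Lie algebra enters through the usual identifications.
  Evaluation at the identity is a bijection from left-invariant metrics on \<open>S\<close> to inner products on
  the Lie algebra; the Levi-Civita connection of such a metric sends left-invariant fields to
  left-invariant fields, so its curvature is computed on the Lie algebra; and since \<open>S\<close> is simply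
  connected, taking the differential at the identity is an isomorphism from the automorphism group
  of \<open>S\<close> to that of the Lie algebra, compatible with pull-back of metrics.
\<close>

definition lie_algebra :: "('a::euclidean_space \<Rightarrow> 'a \<Rightarrow> 'a) \<Rightarrow> bool" where
  "lie_algebra br \<longleftrightarrow> bilinear br \<and> (\<forall>x. br x x = 0) \<and>
     (\<forall>x y z. br x (br y z) + br y (br z x) + br z (br x y) = 0)"

definition bracket_span ::
    "('a::euclidean_space \<Rightarrow> 'a \<Rightarrow> 'a) \<Rightarrow> 'a set \<Rightarrow> 'a set \<Rightarrow> 'a set" where
  "bracket_span br U V = span {br x y |x y. x \<in> U \<and> y \<in> V}"

primrec derived_series ::
    "('a::euclidean_space \<Rightarrow> 'a \<Rightarrow> 'a) \<Rightarrow> 'a set \<Rightarrow> nat \<Rightarrow> 'a set" where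
  "derived_series br U 0 = U"
| "derived_series br U (Suc k) =
     bracket_span br (derived_series br U k) (derived_series br U k)"

primrec lower_central_series ::
    "('a::euclidean_space \<Rightarrow> 'a \<Rightarrow> 'a) \<Rightarrow> 'a set \<Rightarrow> nat \<Rightarrow> 'a set" where
  "lower_central_series br U 0 = U"
| "lower_central_series br U (Suc k) = bracket_span br U (lower_central_series br U k)"

definition solvable_lie_algebra :: "('a::euclidean_space \<Rightarrow> 'a \<Rightarrow> 'a) \<Rightarrow> bool" where
  "solvable_lie_algebra br \<longleftrightarrow> lie_algebra br \<and> (\<exists>k. derived_series br UNIV k = {0})"

definition lie_ideal :: "('a::euclidean_space \<Rightarrow> 'a \<Rightarrow> 'a) \<Rightarrow> 'a set \<Rightarrow> bool" where
  "lie_ideal br U \<longleftrightarrow> subspace U \<and> (\<forall>x. \<forall>u\<in>U. br x u \<in> U)"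

definition nilpotent_ideal :: "('a::euclidean_space \<Rightarrow> 'a \<Rightarrow> 'a) \<Rightarrow> 'a set \<Rightarrow> bool" where
  "nilpotent_ideal br U \<longleftrightarrow> lie_ideal br U \<and> (\<exists>k. lower_central_series br U k = {0})"

definition is_nilradical :: "('a::euclidean_space \<Rightarrow> 'a \<Rightarrow> 'a) \<Rightarrow> 'a set \<Rightarrow> bool" where
  "is_nilradical br N \<longleftrightarrow> nilpotent_ideal br N \<and> (\<forall>M. nilpotent_ideal br M \<longrightarrow> M \<subseteq> N)"

definition derivation :: "('a::euclidean_space \<Rightarrow> 'a \<Rightarrow> 'a) \<Rightarrow> ('a \<Rightarrow> 'a) \<Rightarrow> bool" where
  "derivation br D \<longleftrightarrow> linear D \<and> (\<forall>x y. D (br x y) = br (D x) y + br x (D y))"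

definition lie_automorphism :: "('a::euclidean_space \<Rightarrow> 'a \<Rightarrow> 'a) \<Rightarrow> ('a \<Rightarrow> 'a) \<Rightarrow> bool" where
  "lie_automorphism br \<phi> \<longleftrightarrow> linear \<phi> \<and> bij \<phi> \<and> (\<forall>x y. \<phi> (br x y) = br (\<phi> x) (\<phi> y))"

definition left_invariant_metric :: "('a::euclidean_space \<Rightarrow> 'a \<Rightarrow> real) \<Rightarrow> bool" where
  "left_invariant_metric g \<longleftrightarrow>
     bilinear g \<and> (\<forall>x y. g x y = g y x) \<and> (\<forall>x. x \<noteq> 0 \<longrightarrow> g x x > 0)"

text \<open>The trace of a linear operator; it does not depend on the basis chosen to compute it.\<close>

definition tr :: "('a::euclidean_space \<Rightarrow> 'a) \<Rightarrow> real" where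
  "tr f = (\<Sum>b\<in>Basis. f b \<bullet> b)"

text \<open>
  For left-invariant fields the function \<open>g y z\<close> is constant on \<open>S\<close>, so compatibility with the
  metric means that \<open>levi_civita br g x\<close> is skew with respect to \<open>g\<close>.
\<close>

definition is_levi_civita ::
    "('a::euclidean_space \<Rightarrow> 'a \<Rightarrow> 'a) \<Rightarrow> ('a \<Rightarrow> 'a \<Rightarrow> real) \<Rightarrow> ('a \<Rightarrow> 'a \<Rightarrow> 'a) \<Rightarrow> bool" where
  "is_levi_civita br g nab \<longleftrightarrow> bilinear nab \<and>
     (\<forall>x y. nab x y - nab y x = br x y) \<and>
     (\<forall>x y z. g (nab x y) z + g y (nab x z) = 0)"

definition levi_civita ::
    "('a::euclidean_space \<Rightarrow> 'a \<Rightarrow> 'a) \<Rightarrow> ('a \<Rightarrow> 'a \<Rightarrow> real) \<Rightarrow> 'a \<Rightarrow> 'a \<Rightarrow> 'a" where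
  "levi_civita br g = (THE nab. is_levi_civita br g nab)"

definition curvature ::
    "('a::euclidean_space \<Rightarrow> 'a \<Rightarrow> 'a) \<Rightarrow> ('a \<Rightarrow> 'a \<Rightarrow> real) \<Rightarrow> 'a \<Rightarrow> 'a \<Rightarrow> 'a \<Rightarrow> 'a" where
  "curvature br g x y z =
     levi_civita br g x (levi_civita br g y z) - levi_civita br g y (levi_civita br g x z)
     - levi_civita br g (br x y) z"

definition ricci_tensor ::
    "('a::euclidean_space \<Rightarrow> 'a \<Rightarrow> 'a) \<Rightarrow> ('a \<Rightarrow> 'a \<Rightarrow> real) \<Rightarrow> 'a \<Rightarrow> 'a \<Rightarrow> real" where
  "ricci_tensor br g y z = tr (\<lambda>x. curvature br g x y z)"

definition ricci_operator ::
    "('a::euclidean_space \<Rightarrow> 'a \<Rightarrow> 'a) \<Rightarrow> ('a \<Rightarrow> 'a \<Rightarrow> real) \<Rightarrow> 'a \<Rightarrow> 'a" where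
  "ricci_operator br g y = (THE v. \<forall>z. g v z = ricci_tensor br g y z)"

definition scalar_curvature ::
    "('a::euclidean_space \<Rightarrow> 'a \<Rightarrow> 'a) \<Rightarrow> ('a \<Rightarrow> 'a \<Rightarrow> real) \<Rightarrow> real" where
  "scalar_curvature br g = tr (ricci_operator br g)"

text \<open>The quotient is meaningful only if the Ricci operator is nonzero; elsewhere it is \<open>0 / 0 = 0\<close>.\<close>

definition ricci_pinching ::
    "('a::euclidean_space \<Rightarrow> 'a \<Rightarrow> 'a) \<Rightarrow> ('a \<Rightarrow> 'a \<Rightarrow> real) \<Rightarrow> real" where
  "ricci_pinching br g =
     (scalar_curvature br g)\<^sup>2 / tr (ricci_operator br g \<circ> ricci_operator br g)"

definition solvsoliton ::
    "('a::euclidean_space \<Rightarrow> 'a \<Rightarrow> 'a) \<Rightarrow> ('a \<Rightarrow> 'a \<Rightarrow> real) \<Rightarrow> bool" where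
  "solvsoliton br g \<longleftrightarrow> solvable_lie_algebra br \<and> left_invariant_metric g \<and>
     (\<exists>c D. derivation br D \<and> (\<forall>x. ricci_operator br g x = c *\<^sub>R x + D x))"

text \<open>The definite descriptions above denote: existence and uniqueness.\<close>

lemma metric_nondegenerate:
  assumes g: "left_invariant_metric g" and eq: "\<And>w. g u w = g v w"
  shows "u = v"
proof -
  have "g (u - v) (u - v) = 0"
    using g bilinear_lsub[of g u v "u - v"] eq[of "u - v"]
    by (simp only: left_invariant_metric_def)
  then show ?thesis
    using g unfolding left_invariant_metric_def by (metis eq_iff_diff_eq_0 less_irrefl)
qed

lemma metric_riesz:
  fixes g :: "'a::euclidean_space \<Rightarrow> 'a \<Rightarrow> real"
  assumes g: "left_invariant_metric g" and f: "linear f"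
  shows "\<exists>!v. \<forall>w. g v w = f w"
proof -
  define T where "T v = (\<Sum>b\<in>Basis. g v b *\<^sub>R b)" for v :: 'a
  have bil: "bilinear g" using g by (simp add: left_invariant_metric_def)
  have linT: "linear T"
    unfolding T_def
    by (rule linearI)
      (simp_all add: bilinear_ladd[OF bil] bilinear_lmul[OF bil] scaleR_add_left sum.distrib
        scaleR_sum_right)
  have comp: "T v \<bullet> b = g v b" if "b \<in> Basis" for v b
    using that by (simp add: T_def inner_sum_left inner_Basis if_distrib cong: if_cong)
  have ext: "(\<forall>w. g v w = h w)" if h: "linear h" and e: "\<And>b. b \<in> Basis \<Longrightarrow> g v b = h b" for v h
  proof -
    have l: "linear (g v)" using bil by (simp add: bilinear_def)
    show ?thesis using linear_eq_stdbasis[OF l h] e by auto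
  qed
  have inj: "inj T"
  proof (rule injI)
    fix u v assume "T u = T v"
    then have "\<And>b. b \<in> Basis \<Longrightarrow> g u b = g v b" using comp by metis
    moreover have "linear (g v)" using bil by (simp add: bilinear_def)
    ultimately show "u = v" using ext metric_nondegenerate[OF g] by blast
  qed
  obtain v where v: "T v = (\<Sum>b\<in>Basis. f b *\<^sub>R b)"
    using linear_injective_imp_surjective[OF linT inj] by (metis surj_def)
  have "g v b = f b" if "b \<in> Basis" for b
    using comp[OF that, of v] that
    by (simp add: v inner_sum_left inner_Basis if_distrib cong: if_cong)
  then have "\<forall>w. g v w = f w" using ext f by blast
  then show ?thesis using metric_nondegenerate[OF g] by metis
qed

lemma ex1_levi_civita:
  fixes g :: "'a::euclidean_space \<Rightarrow> 'a \<Rightarrow> real"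
  assumes br: "lie_algebra br" and g: "left_invariant_metric g"
  shows "\<exists>!nab. is_levi_civita br g nab"
proof -
  have bil: "bilinear g" and sym: "\<And>x y. g x y = g y x"
    using g by (auto simp: left_invariant_metric_def)
  have bilbr: "bilinear br" and alt: "\<And>x. br x x = 0"
    using br by (auto simp: lie_algebra_def)
  have skew: "br x y = - br y x" for x y
    using alt[of "x + y"] alt[of x] alt[of y]
    by (simp add: bilinear_ladd[OF bilbr] bilinear_radd[OF bilbr] eq_neg_iff_add_eq_0 add.commute)
  note lin = bilinear_ladd[OF bil] bilinear_radd[OF bil] bilinear_lmul[OF bil]
    bilinear_rmul[OF bil] bilinear_ladd[OF bilbr] bilinear_radd[OF bilbr]
    bilinear_lmul[OF bilbr] bilinear_rmul[OF bilbr]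
    bilinear_lneg[OF bil] bilinear_rneg[OF bil] bilinear_lsub[OF bil] bilinear_rsub[OF bil]
  define K where "K x y w = (g (br x y) w - g (br y w) x + g (br w x) y) / 2" for x y w
  have linK: "linear (K x y)" for x y
    by (rule linearI) (simp_all add: K_def lin field_simps)
  define nab where "nab x y = (THE v. \<forall>w. g v w = K x y w)" for x y
  have nab: "g (nab x y) w = K x y w" for x y w
    using theI'[OF metric_riesz[OF g linK[of x y]]] unfolding nab_def by blast
  have "is_levi_civita br g nab"
    unfolding is_levi_civita_def bilinear_def
  proof (intro conjI allI)
    fix x show "linear (nab x)"
      by (rule linearI; rule metric_nondegenerate[OF g])
        (simp_all add: nab lin K_def field_simps)
  next
    fix y show "linear (\<lambda>x. nab x y)"
      by (rule linearI; rule metric_nondegenerate[OF g])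
        (simp_all add: nab lin K_def field_simps)
  next
    fix x y
    show "nab x y - nab y x = br x y"
    proof (rule metric_nondegenerate[OF g])
      fix w
      show "g (nab x y - nab y x) w = g (br x y) w"
        using skew[of y x] skew[of w x] skew[of w y]
        by (simp add: nab lin K_def field_simps)
    qed
  next
    fix x y z
    show "g (nab x y) z + g y (nab x z) = 0"
      using skew[of y x] skew[of z x] skew[of z y]
      by (simp add: nab sym[of y] lin K_def field_simps)
  qed
  moreover have "nab1 = nab2" if 1: "is_levi_civita br g nab1" and 2: "is_levi_civita br g nab2"
    for nab1 nab2
  proof (intro ext)
    have koszul: "2 * g (n x y) w = g (br x y) w - g (br y w) x + g (br w x) y"
      if n: "is_levi_civita br g n" for n x y w
    proof -
      have t: "br a b = n a b - n b a" and m: "g (n a b) c = - g (n a c) b" for a b c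
        using n sym[of b "n a c"] unfolding is_levi_civita_def by (simp, smt (verit))
      show ?thesis
        using m[of x y w] m[of y w x] m[of w x y]
        by (simp add: t lin)
    qed
    fix x y show "nab1 x y = nab2 x y"
      by (rule metric_nondegenerate[OF g]) (use koszul[OF 1] koszul[OF 2] in \<open>smt (verit)\<close>)
  qed
  ultimately show ?thesis by blast
qed

lemma is_levi_civita_levi_civita:
  assumes "lie_algebra br" "left_invariant_metric g"
  shows "is_levi_civita br g (levi_civita br g)"
  unfolding levi_civita_def by (rule theI'[OF ex1_levi_civita[OF assms]])

lemma ricci_operator_ricci_tensor:
  assumes br: "lie_algebra br" and g: "left_invariant_metric g"
  shows "g (ricci_operator br g y) z = ricci_tensor br g y z"
proof -
  have b: "bilinear (levi_civita br g)"
    using is_levi_civita_levi_civita[OF br g] by (simp add: is_levi_civita_def)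
  have "linear (ricci_tensor br g y)"
    by (rule linearI)
      (simp_all add: ricci_tensor_def tr_def curvature_def bilinear_radd[OF b] bilinear_rmul[OF b]
        inner_diff_left inner_add_left sum.distrib sum_subtractf sum_distrib_left
        right_diff_distrib)
  from theI'[OF metric_riesz[OF g this]] show ?thesis
    unfolding ricci_operator_def by blast
qed

end

theory Submission
  imports Defs
begin

text \<open>
  Let \<open>A\<close> be a unit normal of the nilradical \<open>N\<close> for the solvsoliton \<open>g\<close>, with Ricci operator \<open>c + D\<close>.
  Then \<open>D A = 0\<close>, \<open>ad A\<close> is normal, \<open>tr (ad A \<circ> D) = 0\<close> and hence \<open>|Ric|\<^sup>2 = c scal\<close>.

  Up to an inner automorphism, the normal of \<open>N\<close> for another metric \<open>h\<close> is a multiple of \<open>A + X\<close> with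
  \<open>[A, X] = 0\<close>, and \<open>D\<close> is positive on the kernel of \<open>ad A\<close> in \<open>N\<close>. Orthonormalize a \<open>D\<close>-eigenbasis
  of \<open>N\<close>, ordered by decreasing eigenvalue \<open>l i\<close>, with respect to \<open>h\<close>, and let \<open>E\<close> be the operator with
  these eigenvectors and the eigenvalues of \<open>D\<close>. Since \<open>E\<close> and \<open>D\<close> define the same filtration, the
  moment map description of the Ricci tensor gives \<open>tr (Ric h \<circ> E) \<ge> 0\<close>, and Cauchy--Schwarz for
  \<open>Ric h\<close> and \<open>c + E\<close>, whose norm is that of \<open>c + D\<close>, bounds the pinching of \<open>h\<close>.

  In the case of equality \<open>E\<close> is a derivation and \<open>Ric h\<close> is a multiple of \<open>c + E\<close>. The two gradings of
  the same filtration are conjugate by an automorphism, so one may assume that \<open>g\<close> and \<open>h\<close> have the same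
  Ricci operator; a Kempf--Ness convexity argument along the geodesic joining them then shows that they
  differ by an automorphism.
\<close>


section \<open>Orthonormal bases and simultaneous diagonalization\<close>

text \<open>The obstacle is that another metric \<open>h\<close> sees neither the normal
  \<open>A\<close> nor the eigenspaces of \<open>D\<close>; what it can share with \<open>g\<close>
  is the filtration by sums of eigenspaces for eigenvalues \<open>\<ge> r\<close>. This is enough,
  because the filtration is compatible with the bracket: in the basis adapted to \<open>h\<close> a
  nonzero structure constant forces \<open>l i + l j \<le> l m\<close>, so the moment pairing with
  \<open>E\<close> is a sum of nonnegative terms. Besides the moment map, the Ricci tensor contains
  a Killing and a mean curvature term. The first is concentrated on the normal, where
  \<open>E\<close> has eigenvalue 0. The second contributes a multiple of the trace of
  \<open>ad (A + X) \<circ> E\<close>, which has no sign and must vanish exactly. This is why the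
  normal is moved to \<open>A + X\<close>: positivity of \<open>D\<close> on the kernel makes
  \<open>ad X\<close> raise eigenvalues strictly, and the trace collapses to that of
  \<open>ad A \<circ> D\<close>. The sign of \<open>c\<close> matters as well: \<open>c < 0\<close>,
  together with \<open>scal \<le> 0\<close> for every metric, gives \<open>c scal \<ge> 0\<close>,
  so that adding the pairing with \<open>E\<close> can only increase the square in Cauchy--Schwarz.
  It is for \<open>c < 0\<close> that the Ricci operator of \<open>g\<close> has to be
  nonzero.\<close>

lemma metric_bilinear: "left_invariant_metric g \<Longrightarrow> bilinear g"
  by (simp add: left_invariant_metric_def)

lemma metric_sym: "left_invariant_metric g \<Longrightarrow> g x y = g y x"
  by (simp add: left_invariant_metric_def)

lemma metric_pos: "left_invariant_metric g \<Longrightarrow> x \<noteq> 0 \<Longrightarrow> g x x > 0"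
  by (simp add: left_invariant_metric_def)

lemma bilinear_suml: "bilinear h \<Longrightarrow> h (sum f S) y = (\<Sum>i\<in>S. h (f i) y)"
  using linear_sum[of "\<lambda>x. h x y" f S] by (simp add: bilinear_def)

lemma bilinear_sumr: "bilinear h \<Longrightarrow> h y (sum f S) = (\<Sum>i\<in>S. h y (f i))"
  using linear_sum[of "h y" f S] by (simp add: bilinear_def)

lemmas bilin = bilinear_ladd bilinear_radd bilinear_lmul bilinear_rmul bilinear_lneg bilinear_rneg
  bilinear_lsub bilinear_rsub bilinear_lzero bilinear_rzero bilinear_suml bilinear_sumr

lemma metric_nonneg:
  assumes "left_invariant_metric g" shows "g x x \<ge> 0"
  using metric_pos[OF assms, of x] bilin(9)[OF metric_bilinear[OF assms]] by (cases "x = 0") auto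

lemma metric_eq_0_iff:
  assumes "left_invariant_metric g" shows "g x x = 0 \<longleftrightarrow> x = 0"
  using metric_pos[OF assms, of x] bilin(9)[OF metric_bilinear[OF assms]] by (cases "x = 0") auto

lemma linear_family_sum: "linear f \<Longrightarrow> f (\<Sum>i\<in>S. a i *\<^sub>R v i) = (\<Sum>i\<in>S. a i *\<^sub>R f (v i))"
  by (simp add: linear_sum linear_scale)

text \<open>Rayleigh quotients: a maximiser of \<open>q x x / g x x\<close> on \<open>U\<close> is an eigenvector of \<open>q\<close>.\<close>

lemma exists_max_eigenvector:
  fixes g q :: "'a::euclidean_space \<Rightarrow> 'a \<Rightarrow> real"
  assumes g: "left_invariant_metric g" and q: "bilinear q" "\<And>x y. q x y = q y x"
    and U: "subspace U" "U \<noteq> {0}"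
  obtains x m where "x \<in> U" "g x x = 1" "\<And>y. y \<in> U \<Longrightarrow> q x y = m * g x y"
    "\<And>y. y \<in> U \<Longrightarrow> q y y \<le> m * g y y"
proof -
  note bg = bilin[OF metric_bilinear[OF g]]
  note bq = bilin[OF q(1)]
  have z: "0 \<in> U" using U(1) by (simp add: subspace_0)
  obtain u where u: "u \<in> U" "u \<noteq> 0" using U z by blast
  define S where "S = U \<inter> sphere 0 1"
  have "u /\<^sub>R norm u \<in> S" using u U(1) by (simp add: S_def subspace_scale)
  then have ne: "S \<noteq> {}" by blast
  have cpt: "compact S"
    unfolding S_def by (intro closed_Int_compact closed_subspace U(1)) simp
  have bb: "bounded_bilinear h" if "bilinear h" for h :: "'a \<Rightarrow> 'a \<Rightarrow> real"
    using that bilinear_conv_bounded_bilinear by blast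
  have ch: "continuous_on S (\<lambda>x. h x x)" if "bilinear h" for h :: "'a \<Rightarrow> 'a \<Rightarrow> real"
    by (intro bounded_bilinear.continuous_on[OF bb[OF that]] continuous_intros)
  have pos: "g x x > 0" if "x \<in> S" for x
    using that by (intro metric_pos[OF g]) (auto simp: S_def)
  have "continuous_on S (\<lambda>x. q x x / g x x)"
    using pos by (intro continuous_intros ch q(1) metric_bilinear[OF g]) force
  then obtain x0 where x0: "x0 \<in> S" "\<And>y. y \<in> S \<Longrightarrow> q y y / g y y \<le> q x0 x0 / g x0 x0"
    using continuous_attains_sup[OF cpt ne] by blast
  define m where "m = q x0 x0 / g x0 x0"
  have le: "q y y \<le> m * g y y" if "y \<in> U" for y
  proof (cases "y = 0")
    case False
    have "y /\<^sub>R norm y \<in> S" using False that U(1) by (simp add: S_def subspace_scale)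
    from x0(2)[OF this] pos[OF this] have "q (y /\<^sub>R norm y) (y /\<^sub>R norm y) \<le> m * g (y /\<^sub>R norm y) (y /\<^sub>R norm y)"
      by (simp add: m_def pos_divide_le_eq)
    then have "inverse (norm y) * (inverse (norm y) * q y y) \<le> inverse (norm y) * (inverse (norm y) * (m * g y y))"
      by (simp add: bq bg mult.left_commute)
    then show ?thesis using False by simp
  qed (simp add: bq bg)
  have x0U: "x0 \<in> U" using x0 by (simp add: S_def)
  have eq0: "q x0 x0 = m * g x0 x0" using pos[OF x0(1)] by (simp add: m_def)
  have eig: "q x0 y = m * g x0 y" if y: "y \<in> U" for y
  proof (rule ccontr)
    define d where "d = m * g x0 y - q x0 y"
    define E where "E = m * g y y - q y y"
    assume "q x0 y \<noteq> m * g x0 y"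
    then have d: "d \<noteq> 0" by (simp add: d_def)
    have quad: "0 \<le> 2 * t * d + t\<^sup>2 * E" for t
    proof -
      have "x0 + t *\<^sub>R y \<in> U" using x0U y U(1) by (simp add: subspace_add subspace_scale)
      from le[OF this] show ?thesis
        using eq0 q(2)[of y x0] metric_sym[OF g, of y x0]
        by (simp add: d_def E_def bq bg algebra_simps power2_eq_square)
    qed
    have E0: "E \<ge> 0" using le[OF y] by (simp add: E_def)
    \<comment> \<open>The minimiser of the quadratic is \<open>- d / E\<close>; the shift by 1
      avoids a division by zero and still leaves a negative value.\<close>
    define t where "t = - d / (E + 1)"
    have td: "d = - t * (E + 1)" using E0 by (simp add: t_def)
    then have "t \<noteq> 0" using d by auto
    have "2 * t * d + t\<^sup>2 * E = t\<^sup>2 * (- E - 2)"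
      by (simp add: td power2_eq_square algebra_simps)
    also have "\<dots> < 0" using \<open>t \<noteq> 0\<close> E0 by (intro mult_pos_neg) auto
    finally show False using quad[of t] by simp
  qed
  define x where "x = x0 /\<^sub>R sqrt (g x0 x0)"
  show thesis
  proof (rule that[of x m])
    show "x \<in> U" using x0U U(1) by (simp add: x_def subspace_scale)
    show "g x x = 1" using pos[OF x0(1)]
      by (simp add: x_def bg field_simps)
    show "q x y = m * g x y" if "y \<in> U" for y using eig[OF that] by (simp add: x_def bg bq)
  qed (use le in auto)
qed

text \<open>An eigenvector for the largest Rayleigh quotient is split off, and its orthogonal
  complement in \<open>U\<close> is treated next; the quotients decrease because each maximum is
  taken over a smaller space. The eigenvector equation is tested only against \<open>U\<close>, so
  \<open>q\<close> may couple \<open>U\<close> with the rest of the space.\<close>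

lemma simultaneous_diagonalization:
  fixes g q :: "'a::euclidean_space \<Rightarrow> 'a \<Rightarrow> real"
  assumes g: "left_invariant_metric g" and q: "bilinear q" "\<And>x y. q x y = q y x"
    and U: "subspace U"
  shows "\<exists>v::nat \<Rightarrow> 'a. (\<forall>i<dim U. v i \<in> U) \<and>
    (\<forall>i<dim U. \<forall>j<dim U. g (v i) (v j) = (if i = j then 1 else 0)) \<and>
    (\<forall>i<dim U. \<forall>y\<in>U. q (v i) y = q (v i) (v i) * g (v i) y) \<and>
    (\<forall>j<dim U. \<forall>i\<le>j. q (v j) (v j) \<le> q (v i) (v i)) \<and>
    (\<forall>x\<in>U. x = (\<Sum>i<dim U. g x (v i) *\<^sub>R v i))"
  using U
proof (induction "dim U" arbitrary: U)
  case 0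
  then have "U = {0}" by (metis dim_eq_0 subset_singletonD subspace_0 empty_iff)
  then show ?case by simp
next
  case (Suc n U)
  note bg = bilin[OF metric_bilinear[OF g]]
  note bq = bilin[OF q(1)]
  have "U \<noteq> {0}" using Suc.hyps(2) by (metis dim_singleton nat.simps(3) dim_eq_0 order_refl)
  then obtain x m where x: "x \<in> U" "g x x = 1" "\<And>y. y \<in> U \<Longrightarrow> q x y = m * g x y"
    "\<And>y. y \<in> U \<Longrightarrow> q y y \<le> m * g y y"
    using exists_max_eigenvector[OF g q Suc.prems] by blast
  define W where "W = {y \<in> U. g x y = 0}"
  have W: "subspace W"
    using Suc.prems by (auto simp: W_def subspace_def bg)
  have dec: "y - g x y *\<^sub>R x \<in> W" if "y \<in> U" for y
    using that x Suc.prems by (simp add: W_def bg subspace_diff subspace_scale)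
  have xW: "x \<notin> W" using x by (simp add: W_def)
  have "U = span (insert x W)"
  proof
    show "span (insert x W) \<subseteq> U"
      using x Suc.prems by (intro span_minimal) (auto simp: W_def)
    show "U \<subseteq> span (insert x W)"
      using dec span_base by (auto simp: span_insert)
  qed
  then have "dim U = dim (insert x W)" by (simp add: dim_span)
  moreover have "x \<notin> span W" using xW W by (simp add: span_eq_iff[THEN iffD2])
  ultimately have dW: "n = dim W" using Suc.hyps(2) by (simp add: dim_insert)
  obtain v where v': "\<forall>i<n. v i \<in> W"
    "\<forall>i<n. \<forall>j<n. g (v i) (v j) = (if i = j then 1 else 0)"
    "\<forall>i<n. \<forall>y\<in>W. q (v i) y = q (v i) (v i) * g (v i) y"
    "\<forall>j<n. \<forall>i\<le>j. q (v j) (v j) \<le> q (v i) (v i)"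
    "\<forall>x\<in>W. x = (\<Sum>i<n. g x (v i) *\<^sub>R v i)"
    using Suc.hyps(1)[OF dW W, folded dW] by (elim exE conjE)
  note v = v'[rule_format]
  define w where "w i = (case i of 0 \<Rightarrow> x | Suc j \<Rightarrow> v j)" for i
  have w0: "w 0 = x" and wS: "w (Suc j) = v j" for j by (simp_all add: w_def)
  have vU: "v i \<in> U" "g x (v i) = 0" "g (v i) x = 0" "q x (v i) = 0" "q (v i) x = 0"  if "i < n" for i
    using v(1)[OF that] x(3)[of "v i"] q(2)[of x] metric_sym[OF g, of x] by (auto simp: W_def)
  have qx: "q x x = m" using x by simp
  show ?case
    unfolding Suc.hyps(2)[symmetric]
  proof (intro exI[of _ w] conjI allI impI ballI)
    fix i assume i: "i < Suc n"
    show "w i \<in> U" using i x vU by (cases i) (auto simp: w0 wS)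
    fix j assume j: "j < Suc n"
    show "g (w i) (w j) = (if i = j then 1 else 0)"
      using i j x vU v(2) by (cases i; cases j) (auto simp: w0 wS)
  next
    fix i y assume i: "i < Suc n" and y: "y \<in> U"
    show "q (w i) y = q (w i) (w i) * g (w i) y"
    proof (cases i)
      case 0 then show ?thesis using x(3)[OF y] qx by (simp add: w0)
    next
      case (Suc j)
      then have j: "j < n" using i by simp
      show ?thesis using v(3)[OF j dec[OF y]] vU[OF j] by (simp add: Suc wS bq bg)
    qed
  next
    fix j i assume j: "j < Suc n" and ij: "i \<le> j"
    show "q (w j) (w j) \<le> q (w i) (w i)"
    proof (cases j)
      case 0 then show ?thesis using ij by simp
    next
      case (Suc j')
      then have j': "j' < n" using j by simp
      show ?thesis
      proof (cases i)
        case 0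
        show ?thesis using x(4)[OF vU(1)[OF j']] v(2)[OF j' j'] by (simp add: Suc 0 w0 wS qx)
      next
        case (Suc i')
        then show ?thesis using v(4)[OF j', of i'] ij \<open>j = Suc j'\<close> by (simp add: wS)
      qed
    qed
  next
    fix y assume y: "y \<in> U"
    have "y = g x y *\<^sub>R x + (y - g x y *\<^sub>R x)" by simp
    also have "y - g x y *\<^sub>R x = (\<Sum>i<n. g (y - g x y *\<^sub>R x) (v i) *\<^sub>R v i)"
      using v(5)[OF dec[OF y]] .
    also have "\<dots> = (\<Sum>i<n. g y (v i) *\<^sub>R v i)"
      by (rule sum.cong) (auto simp: bg vU)
    finally show "y = (\<Sum>i<Suc n. g y (w i) *\<^sub>R w i)"
      unfolding sum.lessThan_Suc_shift by (simp add: w0 wS metric_sym[OF g, of x y])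
  qed
qed

text \<open>Both inclusions are kept because each yields one half of the later comparison of
  filtrations: the first restricts the coordinates of \<open>f\<close> in \<open>e\<close>, the
  second those of \<open>e\<close> in \<open>f\<close>.\<close>

lemma gram_schmidt_flag:
  fixes g :: "'a::euclidean_space \<Rightarrow> 'a \<Rightarrow> real" and e :: "nat \<Rightarrow> 'a"
  assumes g: "left_invariant_metric g" and ind: "\<And>i. i < k \<Longrightarrow> e i \<notin> span (e ` {..<i})"
  shows "\<exists>f. (\<forall>i<k. f i \<in> span (e ` {..i}) \<and> e i \<in> span (f ` {..i})) \<and>
    (\<forall>i<k. \<forall>j<k. g (f i) (f j) = (if i = j then 1 else 0))"
  using ind
proof (induction k)
  case 0 show ?case by simp
next
  case (Suc k)
  note bg = bilin[OF metric_bilinear[OF g]]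
  obtain f where f: "\<And>i. i < k \<Longrightarrow> f i \<in> span (e ` {..i})" "\<And>i. i < k \<Longrightarrow> e i \<in> span (f ` {..i})"
    "\<And>i j. i < k \<Longrightarrow> j < k \<Longrightarrow> g (f i) (f j) = (if i = j then 1 else 0)"
    using Suc by (metis less_SucI)
  define w where "w = e k - (\<Sum>i<k. g (e k) (f i) *\<^sub>R f i)"
  have fs: "f i \<in> span (e ` {..<k})" if "i < k" for i
    using f(1)[OF that] span_mono[of "e ` {..i}" "e ` {..<k}"] that by force
  then have s: "(\<Sum>i<k. g (e k) (f i) *\<^sub>R f i) \<in> span (e ` {..<k})"
    by (intro span_sum span_scale) auto
  have "w \<noteq> 0" using s Suc.prems[of k] by (auto simp: w_def)
  then have pos: "g w w > 0" by (rule metric_pos[OF g])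
  have orth: "g w (f j) = 0" if "j < k" for j
    using that by (simp add: w_def bg f(3) if_distrib cong: if_cong)
  define x where "x = w /\<^sub>R sqrt (g w w)"
  have xx: "g x x = 1" using pos by (simp add: x_def bg field_simps)
  have xo: "g x (f j) = 0" "g (f j) x = 0" if "j < k" for j
    using orth[OF that] metric_sym[OF g, of "f j"] by (simp_all add: x_def bg)
  have "{..k} = insert k {..<k}" by auto
  then have sub: "span (e ` {..<k}) \<subseteq> span (e ` {..k})" by (intro span_mono) auto
  have wk: "w \<in> span (e ` {..k})"
    unfolding w_def using s sub by (intro span_diff) (auto intro: span_base)
  define h where "h = f(k := x)"
  have hf: "h i = f i" if "i < k" for i using that by (simp add: h_def)
  have hk: "h k = x" by (simp add: h_def)
  have him: "h ` {..i} = f ` {..i}" if "i < k" for i using that by (auto simp: h_def)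
  have "e k = sqrt (g w w) *\<^sub>R h k + (\<Sum>i<k. g (e k) (f i) *\<^sub>R h i)"
    using pos by (simp add: w_def[symmetric] hk x_def hf w_def[symmetric]) (simp add: w_def)
  also have "\<dots> \<in> span (h ` {..k})"
    by (intro span_add span_scale span_sum span_base) auto
  finally have ek: "e k \<in> span (h ` {..k})" .
  show ?case
  proof (intro exI[of _ h] conjI allI impI)
    fix i assume i: "i < Suc k"
    show "h i \<in> span (e ` {..i})"
      using i f(1) wk by (cases "i = k") (auto simp: hk hf x_def intro: span_scale)
    show "e i \<in> span (h ` {..i})"
      using i f(2) ek him by (cases "i = k") auto
    fix j assume j: "j < Suc k"
    show "g (h i) (h j) = (if i = j then 1 else 0)"
      using i j xx xo f(3) by (cases "i = k"; cases "j = k") (auto simp: hk hf)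
  qed
qed

text \<open>Completeness is assumed as an expansion, which is the form in which it is always
  applied. The index set is a parameter because both \<open>{..<DIM('a)}\<close> and
  \<open>{..k}\<close>, with the normal direction at the last index, occur.\<close>

locale orthonormal_basis =
  fixes g :: "'a::euclidean_space \<Rightarrow> 'a \<Rightarrow> real" and I :: "nat set" and e :: "nat \<Rightarrow> 'a"
  assumes metric: "left_invariant_metric g" and finite_index: "finite I"
    and orthonormal: "\<And>i j. i \<in> I \<Longrightarrow> j \<in> I \<Longrightarrow> g (e i) (e j) = (if i = j then 1 else 0)"
    and expansion: "\<And>x. x = (\<Sum>i\<in>I. g x (e i) *\<^sub>R e i)"
begin

lemmas gbil = bilin[OF metric_bilinear[OF metric]]

lemmas gsym = metric_sym[OF metric]

lemma parseval: "g x y = (\<Sum>i\<in>I. g x (e i) * g y (e i))"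
proof -
  have "g x y = g x (\<Sum>i\<in>I. g y (e i) *\<^sub>R e i)" by (simp add: expansion[symmetric])
  then show ?thesis by (simp add: gbil mult.commute)
qed

lemma coordinates_eqI: "(\<And>i. i \<in> I \<Longrightarrow> g x (e i) = g y (e i)) \<Longrightarrow> x = y"
  by (subst (1) expansion, subst (2) expansion) simp

lemma linear_eq_onb:
  assumes "linear f" "linear h" "\<And>i. i \<in> I \<Longrightarrow> f (e i) = h (e i)"
  shows "f x = h x"
proof -
  have "f (\<Sum>i\<in>I. g x (e i) *\<^sub>R e i) = h (\<Sum>i\<in>I. g x (e i) *\<^sub>R e i)"
    by (simp add: linear_family_sum[OF assms(1)] linear_family_sum[OF assms(2)] assms(3))
  then show ?thesis by (simp only: expansion[symmetric])
qed

lemma bilinear_eq_onb: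
  assumes "bilinear f" "bilinear h" "\<And>i j. i \<in> I \<Longrightarrow> j \<in> I \<Longrightarrow> f (e i) (e j) = h (e i) (e j)"
  shows "f x y = h x y"
proof (rule linear_eq_onb[of "\<lambda>x. f x y" "\<lambda>x. h x y"])
  fix i assume i: "i \<in> I"
  show "f (e i) y = h (e i) y"
    by (rule linear_eq_onb[of "f (e i)" "h (e i)"]) (use assms i in \<open>auto simp: bilinear_def\<close>)
qed (use assms in \<open>auto simp: bilinear_def\<close>)

lemma tr_onb:
  assumes f: "linear f"
  shows "tr f = (\<Sum>i\<in>I. g (f (e i)) (e i))"
proof -
  have "tr f = (\<Sum>b\<in>Basis. f (\<Sum>i\<in>I. g b (e i) *\<^sub>R e i) \<bullet> b)"
    by (simp add: tr_def expansion[symmetric])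
  also have "\<dots> = (\<Sum>b\<in>Basis. \<Sum>i\<in>I. g b (e i) * (f (e i) \<bullet> b))"
    by (simp add: linear_family_sum[OF f] inner_sum_left)
  also have "\<dots> = (\<Sum>i\<in>I. \<Sum>b\<in>Basis. g b (e i) * (f (e i) \<bullet> b))" by (rule sum.swap)
  also have "\<dots> = (\<Sum>i\<in>I. g (\<Sum>b\<in>Basis. (f (e i) \<bullet> b) *\<^sub>R b) (e i))"
    by (simp add: gbil mult.commute)
  finally show ?thesis by (simp add: euclidean_representation)
qed

end

section \<open>Brackets and the Ricci tensor in an orthonormal basis\<close>

lemma lie_bilinear: "lie_algebra br \<Longrightarrow> bilinear br"
  by (simp add: lie_algebra_def)

lemma lie_skew:
  assumes "lie_algebra br" shows "br x y = - br y x"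
proof -
  have "br (x + y) (x + y) = 0" "br x x = 0" "br y y = 0"
    using assms by (simp_all only: lie_algebra_def)
  then show ?thesis
    by (simp add: bilin[OF lie_bilinear[OF assms]] eq_neg_iff_add_eq_0 add.commute)
qed

lemma lie_self: "lie_algebra br \<Longrightarrow> br x x = 0"
  by (simp add: lie_algebra_def)

lemma lie_ad_derivation:
  assumes "lie_algebra br" shows "br x (br y z) = br (br x y) z + br y (br x z)"
proof -
  have "br x (br y z) + br y (br z x) + br z (br x y) = 0"
    using assms by (simp add: lie_algebra_def)
  moreover have "br y (br z x) = - br y (br x z)"
    using lie_skew[OF assms, of z x] by (simp add: bilin[OF lie_bilinear[OF assms]])
  ultimately show ?thesis using lie_skew[OF assms, of z "br x y"] by (simp add: algebra_simps)
qed

lemma linear_ad: "lie_algebra br \<Longrightarrow> linear (br x)"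
  using lie_bilinear[of br] by (simp add: bilinear_def)

lemma derivation_ad: "lie_algebra br \<Longrightarrow> derivation br (br x)"
  by (simp add: derivation_def linear_ad lie_ad_derivation[of br x])

section \<open>Traces and the Killing form\<close>

lemma tr_add: "tr (\<lambda>x. f x + h x) = tr f + tr h"
  by (simp add: tr_def inner_add_left sum.distrib)

lemma tr_diff: "tr (\<lambda>x. f x - h x) = tr f - tr h"
  by (simp add: tr_def inner_diff_left sum_subtractf)

lemma tr_scale: "tr (\<lambda>x. a *\<^sub>R f x) = a * tr f"
  by (simp add: tr_def sum_distrib_left)

lemma tr_zero: "tr (\<lambda>x. 0) = 0"
  by (simp add: tr_def)

lemma tr_commute:
  fixes f h :: "'a::euclidean_space \<Rightarrow> 'a"
  assumes f: "linear f" and h: "linear h"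
  shows "tr (\<lambda>x. f (h x)) = tr (\<lambda>x. h (f x))"
proof -
  have *: "tr (\<lambda>x. f (h x)) = (\<Sum>b\<in>Basis. \<Sum>c\<in>Basis. (h b \<bullet> c) * (f c \<bullet> b))"
    if f: "linear f" for f h :: "'a \<Rightarrow> 'a"
  proof -
    have "f (h b) = (\<Sum>c\<in>Basis. (h b \<bullet> c) *\<^sub>R f c)" for b
      using linear_family_sum[OF f, of "\<lambda>c. h b \<bullet> c" id Basis] by (simp add: euclidean_representation)
    then show ?thesis by (simp add: tr_def inner_sum_left)
  qed
  show ?thesis unfolding *[OF f] *[OF h]
    by (subst sum.swap) (simp add: mult.commute)
qed

definition killing :: "('a::euclidean_space \<Rightarrow> 'a \<Rightarrow> 'a) \<Rightarrow> 'a \<Rightarrow> 'a \<Rightarrow> real" where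
  "killing br x y = tr (\<lambda>w. br x (br y w))"

lemma killing_sym: "lie_algebra br \<Longrightarrow> killing br x y = killing br y x"
  unfolding killing_def by (intro tr_commute linear_ad)

lemma tr_ad_bracket:
  assumes br: "lie_algebra br" shows "tr (br (br y z)) = 0"
proof -
  have "br (br y z) = (\<lambda>w. br y (br z w) - br z (br y w))"
    using lie_ad_derivation[OF br, of y z] by auto
  then show ?thesis
    using tr_commute[OF linear_ad[OF br, of y] linear_ad[OF br, of z]] by (simp add: tr_diff)
qed

lemma levi_civita_koszul:
  assumes br: "lie_algebra br" and g: "left_invariant_metric g"
  shows "2 * g (levi_civita br g x y) w = g (br x y) w - g (br y w) x + g (br w x) y"
proof -
  let ?n = "levi_civita br g"
  note n = is_levi_civita_levi_civita[OF br g, unfolded is_levi_civita_def]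
  have t: "br a b = ?n a b - ?n b a" and m: "g (?n a b) c = - g (?n a c) b" for a b c
    using n metric_sym[OF g, of b "?n a c"] by (simp, smt (verit))
  show ?thesis
    using m[of x y w] m[of y w x] m[of w x y] by (simp add: t bilin[OF metric_bilinear[OF g]])
qed

text \<open>The derivative at the identity of the change-of-basis action of the general linear group
  on brackets; the operators \<open>E\<close> annihilating a bracket in this sense are its
  derivations.\<close>

definition bracket_action :: "('a::euclidean_space \<Rightarrow> 'a) \<Rightarrow> ('a \<Rightarrow> 'a \<Rightarrow> 'a) \<Rightarrow> 'a \<Rightarrow> 'a \<Rightarrow> 'a" where
  "bracket_action E \<nu> x y = E (\<nu> x y) - \<nu> (E x) y - \<nu> x (E y)"

lemma derivation_iff_bracket_action:
  "derivation br D \<longleftrightarrow> linear D \<and> (\<forall>x y. bracket_action D br x y = 0)"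
  unfolding derivation_def bracket_action_def by (auto simp: algebra_simps)

lemma bilinear_bracket_action:
  assumes "linear E" "bilinear \<nu>" shows "bilinear (bracket_action E \<nu>)"
  unfolding bilinear_def bracket_action_def
  by (auto intro!: linearI simp: bilin[OF assms(2)] linear_add[OF assms(1)] linear_scale[OF assms(1)]
      algebra_simps)

lemma bracket_action_commutator:
  assumes "linear E" "linear F" "bilinear \<nu>"
  shows "bracket_action (\<lambda>x. E (F x) - F (E x)) \<nu> x y =
    bracket_action E (bracket_action F \<nu>) x y - bracket_action F (bracket_action E \<nu>) x y"
  by (simp add: bracket_action_def bilin[OF assms(3)] linear_diff[OF assms(1)]
      linear_diff[OF assms(2)])

context orthonormal_basis
begin

definition adj :: "('a \<Rightarrow> 'a) \<Rightarrow> 'a \<Rightarrow> 'a" where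
  "adj T x = (\<Sum>i\<in>I. g x (T (e i)) *\<^sub>R e i)"

lemma linear_adj: "linear (adj T)"
  by (rule linearI) (simp_all add: adj_def gbil scaleR_add_left sum.distrib scaleR_sum_right)

lemma adj_right: "linear T \<Longrightarrow> g x (adj T y) = g (T x) y"
proof -
  assume T: "linear T"
  have "g (T x) y = g (\<Sum>i\<in>I. g x (e i) *\<^sub>R T (e i)) y"
    by (simp add: linear_family_sum[OF T, symmetric] expansion[symmetric])
  then show ?thesis by (simp add: adj_def gbil gsym[of y] mult.commute)
qed

lemma adj_left: "linear T \<Longrightarrow> g (adj T x) y = g x (T y)"
  using adj_right[of T y x] gsym by simp

lemma sum_form_adj:
  assumes E: "linear E" and b: "bilinear \<beta>"
  shows "(\<Sum>i\<in>I. \<beta> (E (e i)) (e i)) = (\<Sum>i\<in>I. (\<beta> (e i) (adj E (e i)) :: real))"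
proof -
  have "(\<Sum>i\<in>I. \<beta> (E (e i)) (e i)) = (\<Sum>i\<in>I. \<beta> (\<Sum>k\<in>I. g (E (e i)) (e k) *\<^sub>R e k) (e i))"
    by (simp add: expansion[symmetric])
  also have "\<dots> = (\<Sum>i\<in>I. \<Sum>k\<in>I. g (E (e i)) (e k) * \<beta> (e k) (e i))"
    by (simp add: bilin[OF b])
  also have "\<dots> = (\<Sum>k\<in>I. \<Sum>i\<in>I. g (E (e i)) (e k) * \<beta> (e k) (e i))" by (rule sum.swap)
  also have "\<dots> = (\<Sum>k\<in>I. \<beta> (e k) (adj E (e k)))"
    by (simp add: adj_def bilin[OF b] gsym)
  finally show ?thesis .
qed

definition bracket_ip :: "('a \<Rightarrow> 'a \<Rightarrow> 'a) \<Rightarrow> ('a \<Rightarrow> 'a \<Rightarrow> 'a) \<Rightarrow> real" where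
  "bracket_ip \<nu> \<mu> = (\<Sum>i\<in>I. \<Sum>j\<in>I. g (\<nu> (e i) (e j)) (\<mu> (e i) (e j)))"

text \<open>Each of the three terms is transposed separately, by moving \<open>E\<close> across the
  trace of a bilinear form. The representation on brackets is thus compatible with transposition, on
  which all moment map arguments rest.\<close>

lemma bracket_ip_action_adj:
  assumes E: "linear E" and n: "bilinear \<nu>" and m: "bilinear \<mu>"
  shows "bracket_ip (bracket_action E \<nu>) \<mu> = bracket_ip \<nu> (bracket_action (adj E) \<mu>)"
proof -
  have bl: "bilinear (\<lambda>x y. g (\<nu> x z) (\<mu> y z))" "bilinear (\<lambda>x y. g (\<nu> z x) (\<mu> z y))" for z
    unfolding bilinear_def by (auto intro!: linearI simp: gbil bilin[OF n] bilin[OF m])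
  have "(\<Sum>i\<in>I. \<Sum>j\<in>I. g (\<nu> (E (e i)) (e j)) (\<mu> (e i) (e j)))
      = (\<Sum>j\<in>I. \<Sum>i\<in>I. g (\<nu> (E (e i)) (e j)) (\<mu> (e i) (e j)))" by (rule sum.swap)
  also have "\<dots> = (\<Sum>j\<in>I. \<Sum>i\<in>I. g (\<nu> (e i) (e j)) (\<mu> (adj E (e i)) (e j)))"
    by (simp add: sum_form_adj[OF E bl(1)])
  also have "\<dots> = (\<Sum>i\<in>I. \<Sum>j\<in>I. g (\<nu> (e i) (e j)) (\<mu> (adj E (e i)) (e j)))" by (rule sum.swap)
  finally show ?thesis
    by (simp add: bracket_ip_def bracket_action_def gbil sum_subtractf sum_form_adj[OF E bl(2)]
        adj_right[OF E])
qed

lemma bracket_ip_self_nonneg: "bracket_ip \<nu> \<nu> \<ge> 0"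
  by (simp add: bracket_ip_def sum_nonneg metric_nonneg[OF metric])

lemma bracket_ip_self_eq_0:
  assumes "bilinear \<nu>" "bracket_ip \<nu> \<nu> = 0" shows "\<nu> x y = 0"
proof -
  have z: "\<nu> (e i) (e j) = 0" if "i \<in> I" "j \<in> I" for i j
    using assms(2) that
    by (simp add: bracket_ip_def sum_nonneg_eq_0_iff finite_index sum_nonneg metric_nonneg[OF metric]
        metric_eq_0_iff[OF metric])
  show ?thesis
    by (rule bilinear_eq_onb[OF assms(1), of "\<lambda>x y. 0"])
      (auto simp: z bilinear_def intro!: linearI)
qed

end

section \<open>The Ricci tensor as a sum of moment map, Killing and mean curvature terms\<close>

locale lie_orthonormal_basis = orthonormal_basis g I e
  for g :: "'a::euclidean_space \<Rightarrow> 'a \<Rightarrow> real" and I e +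
  fixes br :: "'a \<Rightarrow> 'a \<Rightarrow> 'a"
  assumes lie: "lie_algebra br"
begin

lemmas bbil = bilin[OF lie_bilinear[OF lie]]

text \<open>Up to scaling, the value at \<open>br\<close> of the moment map for the change-of-basis action on brackets.\<close>

definition moment :: "'a \<Rightarrow> 'a \<Rightarrow> real" where
  "moment x y = (\<Sum>i\<in>I. \<Sum>j\<in>I. g (br (e i) (e j)) x * g (br (e i) (e j)) y) / 4
     - (\<Sum>i\<in>I. g (br x (e i)) (br y (e i))) / 2"

definition mean_curvature :: 'a where
  "mean_curvature = (\<Sum>i\<in>I. tr (br (e i)) *\<^sub>R e i)"

lemma linear_tr_ad: "linear (\<lambda>x. tr (br x))"
  by (rule linearI) (simp_all add: bbil tr_def inner_add_left sum.distrib sum_distrib_left)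

lemma mean_curvature: "g mean_curvature x = tr (br x)"
proof -
  have "tr (br x) = (\<Sum>i\<in>I. g x (e i) *\<^sub>R tr (br (e i)))"
    using linear_family_sum[OF linear_tr_ad, of "\<lambda>i. g x (e i)" e I]
    by (simp add: expansion[symmetric])
  then show ?thesis by (simp add: mean_curvature_def gbil mult.commute gsym)
qed

lemma ricci_tensor_formula:
  "ricci_tensor br g y z = moment y z - killing br y z / 2
     - (g (br mean_curvature y) z + g (br mean_curvature z) y) / 2"
proof -
  let ?n = "levi_civita br g" and ?H = mean_curvature
  note lc = is_levi_civita_levi_civita[OF lie metric, unfolded is_levi_civita_def]
  note bn = bilin[OF conjunct1[OF lc]]
  note K = levi_civita_koszul[OF lie metric]
  have m: "g (?n a b) c = - g b (?n a c)" for a b c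
    using lc by (simp add: eq_neg_iff_add_eq_0)
  define a where "a i j = g (br y (e i)) (e j)" for i j
  define b where "b i j = g (br z (e i)) (e j)" for i j
  define p where "p i j = g (br (e i) (e j)) y" for i j
  define q where "q i j = g (br (e i) (e j)) z" for i j
  have pq: "p j i = - p i j" "q j i = - q i j" for i j
    using lie_skew[OF lie, of "e j" "e i"] by (simp_all add: p_def q_def gbil)
  have sk: "br (e i) x = - br x (e i)" for i x by (rule lie_skew[OF lie])
  have lin: "linear (\<lambda>x. curvature br g x y z)"
    by (rule linearI) (simp_all add: curvature_def bbil bn algebra_simps)
  \<comment> \<open>The mean curvature vector was defined through traces of \<open>ad\<close>; here
    it appears as the trace of the connection, which is how it enters the curvature.\<close>
  have H: "(\<Sum>i\<in>I. ?n (e i) (e i)) = ?H"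
  proof (rule metric_nondegenerate[OF metric])
    fix w
    have "2 * g (?n (e i) (e i)) w = 2 * g (br w (e i)) (e i)" for i
      by (simp add: K lie_self[OF lie] sk[of i w] gbil)
    then have "g (?n (e i) (e i)) w = g (br w (e i)) (e i)" for i by simp
    then show "g (\<Sum>i\<in>I. ?n (e i) (e i)) w = g ?H w"
      by (simp add: gbil mean_curvature tr_onb linear_ad[OF lie])
  qed
  have s1: "(\<Sum>i\<in>I. g (?n (e i) (?n y z)) (e i)) = - (g (br ?H y) z + g (br ?H z) y) / 2"
  proof -
    have "(\<Sum>i\<in>I. g (?n (e i) (?n y z)) (e i)) = - g (?n y z) ?H"
      by (simp add: m[of "e _" "?n y z"] H[symmetric] gbil sum_negf)
    moreover have "2 * g (?n y z) ?H = g (br ?H y) z + g (br ?H z) y"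
      using tr_ad_bracket[OF lie, of y z] mean_curvature[of "br y z"]
      by (simp add: K gsym[of "br y z"] lie_skew[OF lie, of z ?H] gbil)
    ultimately show ?thesis by simp
  qed
  have c1: "g (?n (e i) z) (e j) = (- b i j - b j i - q i j) / 2" for i j
    using K[of "e i" z "e j"] sk[of i z] lie_skew[OF lie, of "e j" "e i"]
    by (simp add: b_def q_def gbil)
  have c2: "g (?n y (e i)) (e j) = (a i j - p i j - a j i) / 2" for i j
    using K[of y "e i" "e j"] sk[of j y] by (simp add: a_def p_def gbil)
  have s2: "(\<Sum>i\<in>I. g (?n y (?n (e i) z)) (e i)) =
    - (\<Sum>i\<in>I. \<Sum>j\<in>I. (- b i j - b j i - q i j) / 2 * ((a i j - p i j - a j i) / 2))"
  proof -
    have "(\<Sum>i\<in>I. g (?n y (?n (e i) z)) (e i)) = (\<Sum>i\<in>I. - g (?n (e i) z) (?n y (e i)))"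
      by (simp add: m[of y])
    also have "\<dots> = - (\<Sum>i\<in>I. g (?n (e i) z) (?n y (e i)))" by (simp add: sum_negf)
    finally show ?thesis by (simp add: parseval[of "?n _ z" "?n y _"] c1 c2)
  qed
  have s3: "(\<Sum>i\<in>I. g (?n (br (e i) y) z) (e i)) =
    - (\<Sum>i\<in>I. \<Sum>j\<in>I. a i j * ((- b j i - b i j - q j i) / 2))"
  proof -
    have "g (?n (br (e i) y) z) (e i) = - (\<Sum>j\<in>I. a i j * ((- b j i - b i j - q j i) / 2))" for i
    proof -
      have "br (e i) y = - (\<Sum>j\<in>I. a i j *\<^sub>R e j)"
        unfolding a_def expansion[symmetric] by (rule sk)
      then show ?thesis by (simp add: bn gbil c1)
    qed
    then show ?thesis by (simp add: sum_negf)
  qed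
  have kil: "killing br y z = (\<Sum>i\<in>I. \<Sum>j\<in>I. a i j * b j i)"
  proof -
    have "killing br y z = (\<Sum>i\<in>I. g (br z (br y (e i))) (e i))"
      unfolding killing_sym[OF lie, of y z] unfolding killing_def
      by (rule tr_onb) (intro linear_compose[OF linear_ad[OF lie] linear_ad[OF lie], unfolded o_def])
    also have "\<dots> = (\<Sum>i\<in>I. g (br z (\<Sum>j\<in>I. a i j *\<^sub>R e j)) (e i))"
      by (simp add: a_def expansion[symmetric])
    finally show ?thesis by (simp add: bbil gbil b_def)
  qed
  have mom: "moment y z = (\<Sum>i\<in>I. \<Sum>j\<in>I. p i j * q i j / 4 - a i j * b i j / 2)"
    by (simp add: moment_def parseval[of "br y _" "br z _"] p_def q_def a_def b_def sum_subtractf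
        sum_divide_distrib)
  \<comment> \<open>The two sides do not agree term by term: their difference is antisymmetric in
    \<open>i\<close> and \<open>j\<close>, so it is shown to cancel against its transpose.\<close>
  define F where "F i j = (- b i j - b j i - q i j) / 2 * ((a i j - p i j - a j i) / 2)
    + a i j * ((- b j i - b i j - q j i) / 2) - (p i j * q i j / 4 - a i j * b i j / 2)
    + a i j * b j i / 2" for i j
  have "(\<Sum>i\<in>I. \<Sum>j\<in>I. F i j) + (\<Sum>i\<in>I. \<Sum>j\<in>I. F j i) = (\<Sum>i\<in>I. \<Sum>j\<in>I. F i j + F j i)"
    by (simp add: sum.distrib)
  also have "\<dots> = 0"
  proof -
    have "F i j + F j i = 0" for i j
      unfolding F_def pq(1)[of i j] pq(2)[of i j] by (simp add: field_simps)
    then show ?thesis by simp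
  qed
  finally have "(\<Sum>i\<in>I. \<Sum>j\<in>I. F i j) = 0" using sum.swap[of F I I] by simp
  then have *: "(\<Sum>i\<in>I. \<Sum>j\<in>I. (- b i j - b j i - q i j) / 2 * ((a i j - p i j - a j i) / 2))
    + (\<Sum>i\<in>I. \<Sum>j\<in>I. a i j * ((- b j i - b i j - q j i) / 2)) = moment y z - killing br y z / 2"
    unfolding F_def mom kil by (simp only: sum.distrib sum_subtractf sum_divide_distrib)
  have "ricci_tensor br g y z = (\<Sum>i\<in>I. g (curvature br g (e i) y z) (e i))"
    unfolding ricci_tensor_def by (rule tr_onb[OF lin])
  also have "\<dots> = (\<Sum>i\<in>I. g (?n (e i) (?n y z)) (e i)) - (\<Sum>i\<in>I. g (?n y (?n (e i) z)) (e i))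
      - (\<Sum>i\<in>I. g (?n (br (e i) y) z) (e i))"
    by (simp add: curvature_def gbil sum_subtractf)
  finally show ?thesis unfolding s1 s2 s3 using * by argo
qed

text \<open>The defining property of a moment map: the pairing with \<open>E\<close> is an eighth of
  the derivative of the squared norm of the bracket in the direction \<open>E\<close>. The first sum
  in \<open>moment\<close> accounts for \<open>E\<close> applied to the value of the bracket, the
  second for \<open>E\<close> applied to the two arguments, which contribute equally.\<close>

lemma sum_moment_eq_action:
  assumes E: "linear E"
  shows "(\<Sum>k\<in>I. moment (E (e k)) (e k)) = bracket_ip (bracket_action E br) br / 4"
proof -
  have bl: "bilinear (\<lambda>x y. g (br x z) (br y z))" for z
    unfolding bilinear_def by (auto intro!: linearI simp: gbil bbil)
  have "(\<Sum>k\<in>I. \<Sum>i\<in>I. \<Sum>j\<in>I. g (br (e i) (e j)) (E (e k)) * g (br (e i) (e j)) (e k))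
      = (\<Sum>i\<in>I. \<Sum>k\<in>I. \<Sum>j\<in>I. g (br (e i) (e j)) (E (e k)) * g (br (e i) (e j)) (e k))"
    by (rule sum.swap)
  also have "\<dots> = (\<Sum>i\<in>I. \<Sum>j\<in>I. \<Sum>k\<in>I. g (br (e i) (e j)) (E (e k)) * g (br (e i) (e j)) (e k))"
    by (intro sum.cong refl sum.swap)
  also have "\<dots> = (\<Sum>i\<in>I. \<Sum>j\<in>I. g (E (br (e i) (e j))) (br (e i) (e j)))"
    unfolding adj_right[OF E, symmetric]
    by (subst parseval[of _ "adj E _"]) (simp add: adj_left[OF E] mult.commute)
  finally have 1: "(\<Sum>k\<in>I. \<Sum>i\<in>I. \<Sum>j\<in>I. g (br (e i) (e j)) (E (e k)) * g (br (e i) (e j)) (e k))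
      = (\<Sum>i\<in>I. \<Sum>j\<in>I. g (E (br (e i) (e j))) (br (e i) (e j)))" .
  have "(\<Sum>i\<in>I. \<Sum>j\<in>I. g (br (e i) (E (e j))) (br (e i) (e j)))
      = (\<Sum>j\<in>I. \<Sum>i\<in>I. g (br (e i) (E (e j))) (br (e i) (e j)))" by (rule sum.swap)
  also have "\<dots> = (\<Sum>j\<in>I. \<Sum>i\<in>I. g (br (E (e j)) (e i)) (br (e j) (e i)))"
    by (intro sum.cong refl) (metis lie_skew[OF lie] gbil(5,6) minus_minus)
  finally have 2: "(\<Sum>i\<in>I. \<Sum>j\<in>I. g (br (e i) (E (e j))) (br (e i) (e j)))
      = (\<Sum>j\<in>I. \<Sum>i\<in>I. g (br (E (e j)) (e i)) (br (e j) (e i)))" .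
  show ?thesis
    by (simp add: moment_def bracket_ip_def bracket_action_def gbil sum_subtractf 1 2
        sum_divide_distrib[symmetric])
qed

lemma sum_moment_derivation:
  assumes "derivation br D"
  shows "(\<Sum>k\<in>I. moment (D (e k)) (e k)) = 0"
proof -
  have "bracket_action D br x y = 0" for x y
    using assms by (simp add: derivation_iff_bracket_action)
  then show ?thesis
    using assms by (simp add: sum_moment_eq_action derivation_def bracket_ip_def gbil)
qed

text \<open>Since \<open>N\<close> annihilates the bracket, the commutator acts as \<open>N\<close>
  after \<open>adj N\<close>; moving \<open>N\<close> to the other side of the inner product
  produces a square. Hence the pairing is nonnegative, and it is zero only if \<open>adj N\<close>
  is a derivation too.\<close>

lemma sum_moment_commutator:
  assumes N: "derivation br N"
  shows "(\<Sum>k\<in>I. moment (N (adj N (e k)) - adj N (N (e k))) (e k)) =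
    bracket_ip (bracket_action (adj N) br) (bracket_action (adj N) br) / 4"
proof -
  have l: "linear N" using N by (simp add: derivation_def)
  note la = linear_adj[of N]
  note b = lie_bilinear[OF lie]
  have z: "bracket_action N br = (\<lambda>x y. 0)"
    using N by (auto simp: derivation_iff_bracket_action fun_eq_iff)
  have l2: "linear (\<lambda>x. N (adj N x) - adj N (N x))"
    by (rule linear_compose_sub[OF linear_compose[OF la l, unfolded o_def]
          linear_compose[OF l la, unfolded o_def]])
  have "bracket_action (adj N) (bracket_action N br) x y = 0" for x y
    unfolding z by (simp add: bracket_action_def linear_0[OF la])
  then have "bracket_ip (bracket_action (\<lambda>x. N (adj N x) - adj N (N x)) br) br
      = bracket_ip (bracket_action N (bracket_action (adj N) br)) br"
    unfolding bracket_ip_def by (simp add: bracket_action_commutator[OF l la b])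
  also have "\<dots> = bracket_ip (bracket_action (adj N) br) (bracket_action (adj N) br)"
    by (intro bracket_ip_action_adj l bilinear_bracket_action la b)
  finally show ?thesis by (simp add: sum_moment_eq_action[OF l2])
qed

lemma sum_moment_diagonal:
  "(\<Sum>k\<in>I. l k * moment (e k) (e k)) =
    (\<Sum>i\<in>I. \<Sum>j\<in>I. \<Sum>k\<in>I. (l k - l i - l j) * (g (br (e i) (e j)) (e k))\<^sup>2) / 4"
proof -
  define E where "E x = (\<Sum>i\<in>I. (g x (e i) * l i) *\<^sub>R e i)" for x
  have E: "linear E"
    by (rule linearI) (simp_all add: E_def gbil algebra_simps sum.distrib scaleR_sum_right)
  have Ee: "E (e k) = l k *\<^sub>R e k" if "k \<in> I" for k
  proof -
    have "E (e k) = (\<Sum>i\<in>I. if i = k then l k *\<^sub>R e k else 0)"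
      unfolding E_def using that by (intro sum.cong) (auto simp: orthonormal)
    then show ?thesis using that finite_index by simp
  qed
  have mE: "moment (l k *\<^sub>R x) y = l k * moment x y" for k x y
    by (simp add: moment_def gbil bbil sum_distrib_left right_diff_distrib sum_divide_distrib
        mult.left_commute mult.assoc)
  have gE: "g (E x) (e k) = l k * g x (e k)" if "k \<in> I" for x k
    using that finite_index
    by (simp add: E_def gbil orthonormal if_distrib cong: if_cong)
  have "(\<Sum>k\<in>I. l k * moment (e k) (e k)) = (\<Sum>k\<in>I. moment (E (e k)) (e k))"
    by (simp add: Ee mE)
  also have "\<dots> = bracket_ip (bracket_action E br) br / 4" by (rule sum_moment_eq_action[OF E])
  also have "bracket_ip (bracket_action E br) br =
    (\<Sum>i\<in>I. \<Sum>j\<in>I. \<Sum>k\<in>I. (l k - l i - l j) * (g (br (e i) (e j)) (e k))\<^sup>2)"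
    unfolding bracket_ip_def
    by (subst parseval)
      (simp add: bracket_action_def Ee gbil bbil gE power2_eq_square algebra_simps)
  finally show ?thesis .
qed

lemma moment_sym: "moment x y = moment y x"
  by (simp add: moment_def mult.commute gsym)

lemma ricci_tensor_sym: "ricci_tensor br g y z = ricci_tensor br g z y"
  by (simp add: ricci_tensor_formula moment_sym[of y z] killing_sym[OF lie, of y z])

end

section \<open>Equivariance and nilpotent ideals\<close>

lemma exists_orthonormal_basis:
  fixes g :: "'a::euclidean_space \<Rightarrow> 'a \<Rightarrow> real"
  assumes "left_invariant_metric g" "subspace U"
  shows "\<exists>v::nat \<Rightarrow> 'a. (\<forall>i<dim U. v i \<in> U) \<and>
    (\<forall>i<dim U. \<forall>j<dim U. g (v i) (v j) = (if i = j then 1 else 0)) \<and>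
    (\<forall>x\<in>U. x = (\<Sum>i<dim U. g x (v i) *\<^sub>R v i))"
proof -
  have "bilinear (\<lambda>x y::'a. 0::real)" by (simp add: bilinear_def linear_zero)
  from simultaneous_diagonalization[OF assms(1) this _ assms(2)]
  show ?thesis by auto
qed

text \<open>Linearity of the Ricci tensor in its second argument is built into the definition of the
  operator. Symmetry, read off from the formula in an orthonormal basis, transfers it to the
  first.\<close>

lemma linear_ricci_operator:
  assumes "lie_algebra br" "left_invariant_metric g"
  shows "linear (ricci_operator br g)"
proof -
  obtain v :: "nat \<Rightarrow> 'a" where
    "\<forall>i<DIM('a). \<forall>j<DIM('a). g (v i) (v j) = (if i = j then 1 else 0)"
    "\<forall>x\<in>UNIV. x = (\<Sum>i<DIM('a). g x (v i) *\<^sub>R v i)"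
    using exists_orthonormal_basis[OF assms(2) subspace_UNIV, unfolded dim_UNIV] by (elim exE conjE)
  note v = this[rule_format]
  interpret lie_orthonormal_basis g "{..<DIM('a)}" v br
    by unfold_locales (use assms in \<open>simp_all add: v(1) v(2)[OF UNIV_I, symmetric]\<close>)
  have r: "g (ricci_operator br g y) z = g (ricci_operator br g z) y" for y z
    by (simp add: ricci_operator_ricci_tensor[OF assms] ricci_tensor_sym[of y z])
  show ?thesis
    by (rule linearI; rule metric_nondegenerate[OF assms(2)])
      (simp_all add: gbil r[of "_ + _"] r[of "_ *\<^sub>R _"] r[of _ "_ + _"], simp_all add: r)
qed

context lie_orthonormal_basis
begin

lemmas ricci = ricci_operator_ricci_tensor[OF lie metric]
  and linear_ricci = linear_ricci_operator[OF lie metric]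

lemma scalar_curvature_onb: "scalar_curvature br g = (\<Sum>i\<in>I. ricci_tensor br g (e i) (e i))"
  by (simp add: scalar_curvature_def tr_onb linear_ricci ricci)

lemma tr_ricci_sq:
  "tr (ricci_operator br g \<circ> ricci_operator br g) = (\<Sum>i\<in>I. \<Sum>j\<in>I. (ricci_tensor br g (e i) (e j))\<^sup>2)"
proof -
  have "g (ricci_operator br g (ricci_operator br g x)) x =
      (\<Sum>j\<in>I. (ricci_tensor br g x (e j))\<^sup>2)" for x
  proof -
    have "g (ricci_operator br g (ricci_operator br g x)) x =
      g (ricci_operator br g x) (ricci_operator br g x)"
      by (simp add: ricci ricci_tensor_sym[of _ x])
    then show ?thesis by (subst (asm) parseval) (simp add: ricci power2_eq_square)
  qed
  then show ?thesis
    by (simp add: tr_onb[OF linear_compose[OF linear_ricci linear_ricci]])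
qed

end

section \<open>Automorphisms, scaling and pull-back of metrics\<close>

lemma lie_automorphism_inv:
  assumes "lie_automorphism br \<phi>"
  shows "lie_automorphism br (inv \<phi>)"
proof -
  have l: "linear \<phi>" and b: "bij \<phi>" and h: "\<And>x y. \<phi> (br x y) = br (\<phi> x) (\<phi> y)"
    using assms by (auto simp: lie_automorphism_def)
  have s: "\<phi> (inv \<phi> x) = x" and i: "inv \<phi> (\<phi> x) = x" for x
    using b by (simp_all add: bij_def surj_f_inv_f)
  have "linear (inv \<phi>)"
    using i[of "inv \<phi> _ + inv \<phi> _"] i[of "_ *\<^sub>R inv \<phi> _"]
    by (intro linearI) (simp_all only: linear_add[OF l] linear_scale[OF l] s)
  moreover have "inv \<phi> (br x y) = br (inv \<phi> x) (inv \<phi> y)" for x y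
    using i[of "br (inv \<phi> x) (inv \<phi> y)"] by (simp add: h s)
  ultimately show ?thesis using b by (simp add: lie_automorphism_def bij_imp_bij_inv)
qed

lemma lie_automorphism_compose:
  "lie_automorphism br \<phi> \<Longrightarrow> lie_automorphism br \<psi> \<Longrightarrow> lie_automorphism br (\<lambda>x. \<phi> (\<psi> x))"
  unfolding lie_automorphism_def
  using linear_compose[of \<psi> \<phi>] bij_comp[of \<psi> \<phi>] by (simp add: o_def)

text \<open>Scaling and pull-back are treated together: the same facts serve the conjugation of the
  normal (with factor 1), the rescaled regrading in the case of equality, and the final passage from
  \<open>g\<close> to another maximum.\<close>

locale equivalent_metrics =
  fixes br :: "'a::euclidean_space \<Rightarrow> 'a \<Rightarrow> 'a" and g g2 :: "'a \<Rightarrow> 'a \<Rightarrow> real" and c \<phi>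
  assumes lie: "lie_algebra br" and metric: "left_invariant_metric g"
    and pos: "c > 0" and aut: "lie_automorphism br \<phi>"
    and eq: "\<And>x y. g2 x y = c * g (\<phi> x) (\<phi> y)"
begin

lemma lin: "linear \<phi>" and hom: "\<phi> (br x y) = br (\<phi> x) (\<phi> y)"
  and right_inv: "\<phi> (inv \<phi> x) = x" and left_inv: "inv \<phi> (\<phi> x) = x"
  using aut by (auto simp: lie_automorphism_def bij_def surj_f_inv_f)

lemma lin_inv: "linear (inv \<phi>)"
  using lie_automorphism_inv[OF aut] by (simp add: lie_automorphism_def)

lemma metric2: "left_invariant_metric g2"
proof -
  have "\<phi> x \<noteq> 0" if "x \<noteq> 0" for x using that left_inv linear_0[OF lin_inv] by metis
  then show ?thesis
    unfolding left_invariant_metric_def bilinear_def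
    using metric_pos[OF metric] pos metric_sym[OF metric]
    by (auto intro!: linearI simp: eq bilin[OF metric_bilinear[OF metric]] linear_add[OF lin]
        linear_scale[OF lin] algebra_simps)
qed

lemma levi_civita_equivariant: "\<phi> (levi_civita br g2 x y) = levi_civita br g (\<phi> x) (\<phi> y)"
proof (rule metric_nondegenerate[OF metric])
  fix w
  have "2 * g2 (levi_civita br g2 x y) (inv \<phi> w) =
     c * (2 * g (levi_civita br g (\<phi> x) (\<phi> y)) w)"
    unfolding levi_civita_koszul[OF lie metric2] levi_civita_koszul[OF lie metric]
    by (simp add: eq hom right_inv algebra_simps)
  then show "g (\<phi> (levi_civita br g2 x y)) w = g (levi_civita br g (\<phi> x) (\<phi> y)) w"
    using pos by (simp add: eq right_inv)
qed

lemma ricci_tensor_equivariant: "ricci_tensor br g2 y z = ricci_tensor br g (\<phi> y) (\<phi> z)"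
proof -
  note bn = bilin[OF conjunct1[OF is_levi_civita_levi_civita[OF lie metric, unfolded is_levi_civita_def]]]
  have cv: "\<phi> (curvature br g2 x y z) = curvature br g (\<phi> x) (\<phi> y) (\<phi> z)" for x
    by (simp add: curvature_def linear_diff[OF lin] levi_civita_equivariant hom)
  have "linear (\<lambda>x. curvature br g x (\<phi> y) (\<phi> z))"
    by (rule linearI) (simp_all add: curvature_def bilin[OF lie_bilinear[OF lie]] bn algebra_simps)
  from linear_compose[OF lin this] have l: "linear (\<lambda>x. curvature br g (\<phi> x) (\<phi> y) (\<phi> z))"
    by (simp add: o_def)
  have "ricci_tensor br g2 y z = tr (\<lambda>x. inv \<phi> (curvature br g (\<phi> x) (\<phi> y) (\<phi> z)))"
    unfolding ricci_tensor_def cv[symmetric] left_inv ..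
  also have "\<dots> = tr (\<lambda>x. curvature br g (\<phi> (inv \<phi> x)) (\<phi> y) (\<phi> z))"
    by (rule tr_commute[OF lin_inv l])
  finally show ?thesis by (simp add: right_inv ricci_tensor_def)
qed

lemma ricci_operator_equivariant: "\<phi> (ricci_operator br g2 x) = (1/c) *\<^sub>R ricci_operator br g (\<phi> x)"
proof (rule metric_nondegenerate[OF metric])
  fix w
  have "c * g (\<phi> (ricci_operator br g2 x)) w = g2 (ricci_operator br g2 x) (inv \<phi> w)"
    by (simp add: eq right_inv)
  also have "\<dots> = g (ricci_operator br g (\<phi> x)) w"
    by (simp add: ricci_operator_ricci_tensor[OF lie metric2] ricci_tensor_equivariant right_inv
        ricci_operator_ricci_tensor[OF lie metric])
  finally show "g (\<phi> (ricci_operator br g2 x)) w = g ((1/c) *\<^sub>R ricci_operator br g (\<phi> x)) w"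
    using pos by (simp add: bilin[OF metric_bilinear[OF metric]] field_simps)
qed

lemma ricci_operator_conjugate: "ricci_operator br g2 x = (1/c) *\<^sub>R inv \<phi> (ricci_operator br g (\<phi> x))"
  using arg_cong[OF ricci_operator_equivariant, of "inv \<phi>" x]
  by (simp add: left_inv linear_scale[OF lin_inv])

lemma ricci_pinching_equivariant: "ricci_pinching br g2 = ricci_pinching br g"
proof -
  let ?R = "ricci_operator br g" and ?R2 = "ricci_operator br g2"
  note lr = linear_ricci_operator[OF lie metric]
  have cj: "tr (\<lambda>x. inv \<phi> (f (\<phi> x))) = tr f" if "linear f" for f
    using tr_commute[OF lin_inv linear_compose[OF lin that, unfolded o_def]] by (simp add: right_inv)
  have 1: "scalar_curvature br g2 = (1/c) * scalar_curvature br g"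
  proof -
    have "?R2 = (\<lambda>x. (1/c) *\<^sub>R inv \<phi> (?R (\<phi> x)))" using ricci_operator_conjugate by blast
    then show ?thesis unfolding scalar_curvature_def using cj[OF lr] by (simp only: tr_scale)
  qed
  have "?R2 \<circ> ?R2 = (\<lambda>x. (1/c)\<^sup>2 *\<^sub>R inv \<phi> ((?R \<circ> ?R) (\<phi> x)))"
    by (auto simp: ricci_operator_conjugate linear_scale[OF lin] linear_scale[OF lr]
        linear_scale[OF lin_inv] right_inv power2_eq_square)
  then have 2: "tr (?R2 \<circ> ?R2) = (1/c)\<^sup>2 * tr (?R \<circ> ?R)"
    using cj[OF linear_compose[OF lr lr]] by (simp only: tr_scale)
  show ?thesis using pos unfolding ricci_pinching_def 1 2 by (simp add: power_mult_distrib power_divide)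
qed

lemma solvsoliton_equivariant:
  assumes "solvsoliton br g" shows "solvsoliton br g2"
proof -
  obtain k D where D: "derivation br D" "\<And>x. ricci_operator br g x = k *\<^sub>R x + D x"
    using assms unfolding solvsoliton_def by blast
  have hom_inv: "inv \<phi> (br x y) = br (inv \<phi> x) (inv \<phi> y)" for x y
    using lie_automorphism_inv[OF aut] by (simp add: lie_automorphism_def)
  have lD: "linear D" and dD: "\<And>x y. D (br x y) = br (D x) y + br x (D y)"
    using D(1) by (auto simp: derivation_def)
  define D' where "D' x = (1/c) *\<^sub>R inv \<phi> (D (\<phi> x))" for x
  have "linear D'"
    by (rule linearI) (simp_all add: D'_def linear_add[OF lin] linear_add[OF lD] linear_add[OF lin_inv]
        linear_scale[OF lin] linear_scale[OF lD] linear_scale[OF lin_inv] scaleR_add_right)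
  then have "derivation br D'"
    by (simp add: derivation_def D'_def hom dD linear_add[OF lin_inv] hom_inv left_inv
        scaleR_add_right bilin[OF lie_bilinear[OF lie]])
  moreover have "ricci_operator br g2 x = (k / c) *\<^sub>R x + D' x" for x
    by (simp add: ricci_operator_conjugate D(2) D'_def linear_add[OF lin_inv]
        linear_scale[OF lin_inv] left_inv scaleR_add_right)
  ultimately show ?thesis using assms metric2 unfolding solvsoliton_def by blast
qed

end

section \<open>Strict flags and nilpotent ideals\<close>

lemma exists_projection:
  fixes U :: "'a::euclidean_space set"
  assumes U: "subspace U"
  shows "\<exists>P. linear P \<and> (\<forall>x. P x \<in> U) \<and> (\<forall>x\<in>U. P x = x)"
proof -
  have i: "left_invariant_metric (\<lambda>x y::'a. x \<bullet> y)"
    unfolding left_invariant_metric_def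
    using bilinear_conv_bounded_bilinear bounded_bilinear_inner by (auto simp: inner_commute)
  obtain v :: "nat \<Rightarrow> 'a" where v: "\<forall>i<dim U. v i \<in> U"
    "\<forall>x\<in>U. x = (\<Sum>i<dim U. (x \<bullet> v i) *\<^sub>R v i)"
    using exists_orthonormal_basis[OF i U] by (elim exE conjE)
  have "linear (\<lambda>x. \<Sum>i<dim U. (x \<bullet> v i) *\<^sub>R v i)"
    by (rule linearI) (simp_all add: inner_add_left scaleR_add_left sum.distrib scaleR_sum_right)
  then show ?thesis
    using v U by (intro exI[of _ "\<lambda>x. \<Sum>i<dim U. (x \<bullet> v i) *\<^sub>R v i"])
      (auto intro!: subspace_sum subspace_scale)
qed

text \<open>Instead of a basis adapted to the flag, projections onto the subspaces are inserted:
  cycling the trace replaces the projection to one member of the flag by that to the next, until it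
  reaches zero.\<close>

lemma tr_strict_flag:
  fixes f :: "'a::euclidean_space \<Rightarrow> 'a" and U :: "nat \<Rightarrow> 'a set"
  assumes f: "linear f" and U: "\<And>j. subspace (U j)" "\<And>j. U (Suc j) \<subseteq> U j" "U K = {0}"
    and f0: "\<And>x. f x \<in> U 0" and fS: "\<And>j x. x \<in> U j \<Longrightarrow> f x \<in> U (Suc j)"
  shows "tr f = 0"
proof -
  obtain P where "\<And>j. linear (P j) \<and> (\<forall>x. P j x \<in> U j) \<and> (\<forall>x\<in>U j. P j x = x)"
    using exists_projection[OF U(1)] by metis
  then have P: "\<And>j. linear (P j)" "\<And>j x. P j x \<in> U j" "\<And>j x. x \<in> U j \<Longrightarrow> P j x = x" by auto
  have "tr f = tr (\<lambda>x. f (P j x))" for j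
  proof (induction j)
    case 0
    have "tr f = tr (\<lambda>x. P 0 (f x))" using P(3) f0 by simp
    then show ?case by (simp add: tr_commute[OF P(1) f])
  next
    case (Suc j)
    have "tr (\<lambda>x. f (P j x)) = tr (\<lambda>x. P (Suc j) (f (P j x)))" using P fS by simp
    also have "\<dots> = tr (\<lambda>x. f (P j (P (Suc j) x)))"
      by (rule tr_commute[OF P(1) linear_compose[OF P(1) f, unfolded o_def]])
    also have "\<dots> = tr (\<lambda>x. f (P (Suc j) x))" using P U(2) by (simp add: subset_iff)
    finally show ?case using Suc by simp
  qed
  from this[of K] have "tr f = tr (\<lambda>x. f (P K x))" .
  moreover have "P K x = 0" for x using P(2)[of K x] U(3) by simp
  ultimately show ?thesis by (simp add: linear_0[OF f] tr_zero)
qed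

lemma subspace_lower_central_series:
  "subspace U \<Longrightarrow> subspace (lower_central_series br U j)"
  by (cases j) (simp_all add: bracket_span_def)

lemma bracket_lower_central_series:
  "x \<in> U \<Longrightarrow> y \<in> lower_central_series br U j \<Longrightarrow> br x y \<in> lower_central_series br U (Suc j)"
  unfolding lower_central_series.simps bracket_span_def by (rule span_base) blast

lemma derivation_lower_central_series:
  assumes D: "derivation br D" and DU: "\<And>x. x \<in> U \<Longrightarrow> D x \<in> U"
  shows "x \<in> lower_central_series br U j \<Longrightarrow> D x \<in> lower_central_series br U j"
proof (induction j arbitrary: x)
  case 0 then show ?case using DU by simp
next
  case (Suc j)
  have l: "linear D" using D by (simp add: derivation_def)
  have "D ` {br x y |x y. x \<in> U \<and> y \<in> lower_central_series br U j}
      \<subseteq> lower_central_series br U (Suc j)"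
  proof safe
    fix u v assume u: "u \<in> U" and v: "v \<in> lower_central_series br U j"
    have "br (D u) v + br u (D v) \<in> lower_central_series br U (Suc j)"
      using bracket_lower_central_series[OF DU[OF u] v] bracket_lower_central_series[OF u Suc.IH[OF v]]
      unfolding lower_central_series.simps bracket_span_def by (rule span_add)
    then show "D (br u v) \<in> lower_central_series br U (Suc j)" using D by (simp add: derivation_def)
  qed
  then have "D ` lower_central_series br U (Suc j) \<subseteq> lower_central_series br U (Suc j)"
    unfolding lower_central_series.simps bracket_span_def
    by (subst linear_span_image[OF l, symmetric]) (rule span_minimal[OF _ subspace_span])
  then show ?case using Suc.prems by blast
qed

locale lie_nilpotent_ideal =
  fixes br :: "'a::euclidean_space \<Rightarrow> 'a \<Rightarrow> 'a" and N :: "'a set"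
  assumes lie_alg: "lie_algebra br" and nilpotent: "nilpotent_ideal br N"
begin

lemma subspace_N: "subspace N" and ideal_N: "u \<in> N \<Longrightarrow> br x u \<in> N"
  using nilpotent by (auto simp: nilpotent_ideal_def lie_ideal_def)

abbreviation "C \<equiv> lower_central_series br N"

lemmas subspace_C = subspace_lower_central_series[OF subspace_N, of br]

lemma ad_C: "y \<in> C j \<Longrightarrow> br x y \<in> C j"
  by (rule derivation_lower_central_series[OF derivation_ad[OF lie_alg] ideal_N])

lemma C_Suc_subset: "C (Suc j) \<subseteq> C j"
proof -
  have "{br x y |x y. x \<in> N \<and> y \<in> C j} \<subseteq> C j" using ad_C by blast
  then show ?thesis
    unfolding lower_central_series.simps(2) bracket_span_def
    by (intro span_minimal subspace_C)
qed

lemma ideal_N': "u \<in> N \<Longrightarrow> br u x \<in> N"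
  using ideal_N[of u x] lie_skew[OF lie_alg, of u x] subspace_neg[OF subspace_N] by simp

text \<open>Every term of the lower central series of \<open>N\<close> is an ideal of the whole
  algebra. So \<open>ad y\<close> preserves this flag for arbitrary \<open>y\<close>, while
  \<open>ad x\<close> lowers it strictly.\<close>

lemma tr_N:
  assumes x: "x \<in> N" shows "tr (br x) = 0" and "killing br x y = 0"
proof -
  obtain K where K: "C K = {0}" using nilpotent by (auto simp: nilpotent_ideal_def)
  show "tr (br x) = 0"
    by (rule tr_strict_flag[of "br x" C K])
      (use x K C_Suc_subset in \<open>auto intro: linear_ad lie_alg subspace_C ideal_N'
        bracket_lower_central_series simp del: lower_central_series.simps(2)\<close>)
  show "killing br x y = 0" unfolding killing_def
    by (rule tr_strict_flag[of _ C K])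
      (use x K C_Suc_subset in \<open>auto intro: linear_compose[unfolded o_def] linear_ad lie_alg subspace_C ideal_N'
        bracket_lower_central_series ad_C simp del: lower_central_series.simps(2)\<close>)
qed

text \<open>An Engel type argument: elements of \<open>N\<close> move \<open>C j\<close> into
  \<open>C (Suc j)\<close>, so modulo \<open>C (Suc j)\<close> brackets act on \<open>C j\<close>
  only through multiples of \<open>ad v\<close>. After \<open>K\<close> of them the next term is
  reached.\<close>

lemma nilpotent_ad_imp_nilpotent:
  assumes v: "\<And>x. \<exists>a n. n \<in> N \<and> x = a *\<^sub>R v + n" and nil: "\<And>x. (br v ^^ K) x = 0"
  shows "nilpotent_ideal br UNIV"
proof -
  note bb = bilin[OF lie_bilinear[OF lie_alg]]
  let ?L = "lower_central_series br UNIV"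
  have linp: "linear (br v ^^ m)" for m
    by (induction m) (auto simp: linear_id id_def[symmetric] intro: linear_compose[unfolded o_def] linear_ad lie_alg)
  have step: "?L (a + m) \<subseteq> {(br v ^^ m) x + y |x y. x \<in> C j \<and> y \<in> C (Suc j)}"
    if a: "?L a \<subseteq> C j" for a j m
  proof (induction m)
    case 0
    have "0 \<in> C (Suc j)" by (intro subspace_0 subspace_C)
    then show ?case using a by force
  next
    case (Suc m)
    let ?S = "{(br v ^^ Suc m) x + y |x y. x \<in> C j \<and> y \<in> C (Suc j)}"
    have "?S = (\<lambda>(x, y). x + y) ` (((br v ^^ Suc m) ` C j) \<times> C (Suc j))" by fastforce
    then have sub: "subspace ?S"
      using subspace_sums[OF linear_subspace_image[OF linp subspace_C] subspace_C, of "Suc m" j "Suc j"]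
      by (smt (verit) Collect_cong imageE image_eqI)
    have "{br s w |s w. s \<in> UNIV \<and> w \<in> ?L (a + m)} \<subseteq> ?S"
    proof safe
      fix s w assume "w \<in> ?L (a + m)"
      then obtain x y where w: "w = (br v ^^ m) x + y" "x \<in> C j" "y \<in> C (Suc j)" using Suc by blast
      obtain b n where s: "n \<in> N" "s = b *\<^sub>R v + n" using v by blast
      have Cm: "(br v ^^ m) x \<in> C j" using w(2) by (induction m) (auto intro: ad_C)
      then have "w \<in> C j" using w C_Suc_subset subspace_C by (auto intro: subspace_add)
      then have "br n w \<in> C (Suc j)" using s bracket_lower_central_series by blast
      moreover have "b *\<^sub>R br v y \<in> C (Suc j)" by (rule subspace_scale[OF subspace_C ad_C[OF w(3)]])
      ultimately have "b *\<^sub>R br v y + br n w \<in> C (Suc j)" by (intro subspace_add[OF subspace_C])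
      moreover have "b *\<^sub>R x \<in> C j" using w subspace_C by (auto intro: subspace_scale)
      moreover have "br s w = (br v ^^ Suc m) (b *\<^sub>R x) + (b *\<^sub>R br v y + br n w)"
        by (simp add: s w bb linear_scale[OF linp] scaleR_add_right)
      ultimately show "\<exists>x y. br s w = (br v ^^ Suc m) x + y \<and> x \<in> C j \<and> y \<in> C (Suc j)" by blast
    qed
    then show ?case
      using span_minimal[OF _ sub] by (simp only: add_Suc_right lower_central_series.simps bracket_span_def)
  qed
  \<comment> \<open>The extra 1 is the first bracket, which takes the whole algebra into
    \<open>N = C 0\<close>; every block of \<open>K\<close> further brackets descends one
    level.\<close>
  have "?L (1 + j * K) \<subseteq> C j" for j
  proof (induction j)
    case 0
    have "{br s w |s w. s \<in> UNIV \<and> w \<in> UNIV} \<subseteq> N"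
    proof safe
      fix s w
      obtain b n b' n' where "n \<in> N" "s = b *\<^sub>R v + n" "n' \<in> N" "w = b' *\<^sub>R v + n'" using v by metis
      moreover from this have "br s w = b *\<^sub>R br v n' + br n w"
        by (simp add: bb lie_self[OF lie_alg])
      ultimately show "br s w \<in> N"
        by (simp only:) (intro subspace_add[OF subspace_N] subspace_scale[OF subspace_N]
            ideal_N[of n'] ideal_N'[of n])
    qed
    then show ?case by (simp add: bracket_span_def span_minimal subspace_N)
  next
    case (Suc j)
    show ?case using step[OF Suc, of K] by (auto simp: nil add.assoc add.commute[of K])
  qed
  moreover obtain J where "C J = {0}" using nilpotent by (auto simp: nilpotent_ideal_def)
  moreover have "0 \<in> ?L j" for j by (intro subspace_0 subspace_lower_central_series subspace_UNIV)
  ultimately have "?L (1 + J * K) = {0}" by blast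
  then show ?thesis unfolding nilpotent_ideal_def lie_ideal_def using subspace_UNIV by blast
qed

end

section \<open>Metrics with a nilradical of codimension one\<close>

lemmas lincomp = linear_compose[unfolded o_def]

locale codim_one_metric = lie_orthonormal_basis g "{..k}" e br + lie_nilpotent_ideal br N
  for g :: "'a::euclidean_space \<Rightarrow> 'a \<Rightarrow> real" and k e br N +
  assumes e_N: "\<And>i. i < k \<Longrightarrow> e i \<in> N" and A_perp: "\<And>x. x \<in> N \<Longrightarrow> g x (e k) = 0"

text \<open>The form \<open>q\<close> decides which orthonormal basis of \<open>N\<close> is
  produced: taking \<open>g\<close> itself gives just some adapted basis, the form of
  \<open>D\<close> gives eigenvectors, and a second metric gives a basis orthogonal for
  both.\<close>

lemma exists_codim_one_metric:
  fixes g q :: "'a::euclidean_space \<Rightarrow> 'a \<Rightarrow> real"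
  assumes lie: "lie_algebra br" and N: "nilpotent_ideal br N" and d: "dim N + 1 = DIM('a)"
    and g: "left_invariant_metric g" and q: "bilinear q" "\<And>x y. q x y = q y x"
  shows "\<exists>e. codim_one_metric g (dim N) e br N \<and>
    (\<forall>i<dim N. \<forall>y\<in>N. q (e i) y = q (e i) (e i) * g (e i) y) \<and>
    (\<forall>j<dim N. \<forall>i\<le>j. q (e j) (e j) \<le> q (e i) (e i))"
proof -
  note bg = bilin[OF metric_bilinear[OF g]]
  have sN: "subspace N" using N by (simp add: nilpotent_ideal_def lie_ideal_def)
  let ?k = "dim N"
  obtain v :: "nat \<Rightarrow> 'a" where v': "\<forall>i<?k. v i \<in> N"
    "\<forall>i<?k. \<forall>j<?k. g (v i) (v j) = (if i = j then 1 else 0)"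
    "\<forall>i<?k. \<forall>y\<in>N. q (v i) y = q (v i) (v i) * g (v i) y"
    "\<forall>j<?k. \<forall>i\<le>j. q (v j) (v j) \<le> q (v i) (v i)"
    "\<forall>x\<in>N. x = (\<Sum>i<?k. g x (v i) *\<^sub>R v i)"
    using simultaneous_diagonalization[OF g q sN] by (elim exE conjE)
  note v = v'[rule_format]
  have "N \<noteq> UNIV" using d by (metis dim_UNIV n_not_Suc_n Suc_eq_plus1)
  then obtain z where z: "z \<notin> N" by blast
  define A0 where "A0 = z - (\<Sum>i<?k. g z (v i) *\<^sub>R v i)"
  have "(\<Sum>i<?k. g z (v i) *\<^sub>R v i) \<in> N"
    using v(1) by (intro subspace_sum[OF sN] subspace_scale[OF sN]) auto
  from subspace_add[OF sN _ this, of A0] have A0N: "A0 \<notin> N" using z by (auto simp: A0_def)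
  then have pos: "g A0 A0 > 0" using subspace_0[OF sN] by (intro metric_pos[OF g]) auto
  have A0v: "g (v j) A0 = 0" if "j < ?k" for j
    using that metric_sym[OF g, of "v j" z] by (simp add: A0_def bg v(2) if_distrib cong: if_cong)
  have A0perp: "g x A0 = 0" if "x \<in> N" for x
    by (subst v(5)[OF that]) (simp add: bg A0v)
  define A where "A = A0 /\<^sub>R sqrt (g A0 A0)"
  have AA: "g A A = 1" using pos by (simp add: A_def bg field_simps)
  have Aperp: "g x A = 0" "g A x = 0" if "x \<in> N" for x
    using A0perp[OF that] metric_sym[OF g, of A x] by (simp_all add: A_def bg)
  have AN: "A \<notin> N" using AA Aperp by force
  then have "dim (insert A N) = DIM('a)"
    using sN d by (simp add: dim_insert span_eq_iff[THEN iffD2])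
  then have sp: "span (insert A N) = UNIV" by (simp add: dim_eq_full)
  define e where "e = v(?k := A)"
  have ek: "e ?k = A" and ei: "\<And>i. i < ?k \<Longrightarrow> e i = v i" by (simp_all add: e_def)
  have exp: "x = (\<Sum>i\<le>?k. g x (e i) *\<^sub>R e i)" for x
  proof -
    obtain a where a: "x - a *\<^sub>R A \<in> N" using sp sN by (auto simp: span_insert span_eq_iff[THEN iffD2])
    then have gx: "g x A = a" using Aperp(1)[OF a] AA by (simp add: bg)
    have "g (x - a *\<^sub>R A) (v i) = g x (v i)" if "i < ?k" for i
      using Aperp(2)[OF v(1)[OF that]] by (simp add: bg)
    then have "x - a *\<^sub>R A = (\<Sum>i<?k. g x (v i) *\<^sub>R v i)"
      by (subst v(5)[OF a]) (auto intro!: sum.cong)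
    then have "x = (\<Sum>i<?k. g x (v i) *\<^sub>R v i) + g x A *\<^sub>R A" by (simp add: gx algebra_simps)
    also have "\<dots> = (\<Sum>i\<le>?k. g x (e i) *\<^sub>R e i)"
      by (simp add: lessThan_Suc_atMost[symmetric] ek ei)
    finally show ?thesis .
  qed
  have "codim_one_metric g ?k e br N"
  proof unfold_locales
    fix i j assume "i \<in> {..?k}" "j \<in> {..?k}"
    then show "g (e i) (e j) = (if i = j then 1 else 0)"
      using AA Aperp v(1,2) by (cases "i = ?k"; cases "j = ?k") (auto simp: ek ei)
  next
    show "x = (\<Sum>i\<in>{..?k}. g x (e i) *\<^sub>R e i)" for x by (rule exp)
  qed (use lie g N v(1) Aperp in \<open>auto simp: ek ei\<close>)
  then show ?thesis using v(3,4) by (intro exI[of _ e]) (auto simp: ei)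
qed

context codim_one_metric
begin

abbreviation "A \<equiv> e k"

abbreviation "T \<equiv> br A"

lemmas linear_T = linear_ad[OF lie, of A] and linear_T' = linear_adj[of T]

lemma A_unit: "g A A = 1" by (simp add: orthonormal)

lemma g_e_A: "i \<le> k \<Longrightarrow> g (e i) A = (if i = k then 1 else 0)" by (simp add: orthonormal)

lemma N_iff: "x \<in> N \<longleftrightarrow> g x A = 0"
proof
  assume "g x A = 0"
  then have "x = (\<Sum>i<k. g x (e i) *\<^sub>R e i)"
    by (subst expansion) (simp add: lessThan_Suc_atMost[symmetric])
  then show "x \<in> N"
    using subspace_sum[OF subspace_N, of "{..<k}" "\<lambda>i. g x (e i) *\<^sub>R e i"] e_N
      subspace_scale[OF subspace_N] by simp
qed (rule A_perp)

lemma A_notin: "A \<notin> N" by (simp add: N_iff A_unit)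

lemma decomp: "x - g x A *\<^sub>R A \<in> N" by (simp add: N_iff gbil A_unit)

lemma split_N: obtains n where "n \<in> N" "x = g x A *\<^sub>R A + n"
  using decomp[of x] by (metis add.commute diff_add_cancel)

lemma bracket_N: "br x y \<in> N"
proof -
  obtain n m where "n \<in> N" "x = g x A *\<^sub>R A + n" "m \<in> N" "y = g y A *\<^sub>R A + m"
    by (metis split_N)
  then have "br x y = g x A *\<^sub>R br A m + g y A *\<^sub>R br n A + br n m"
    using lie_self[OF lie, of A] by (metis (no_types, lifting) bbil(1-4) add.assoc add_0 scaleR_zero_right)
  then show ?thesis
    by (simp only:) (intro subspace_add[OF subspace_N] subspace_scale[OF subspace_N]
        ideal_N[OF \<open>m \<in> N\<close>] ideal_N'[OF \<open>n \<in> N\<close>])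
qed

lemma bracket_perp: "g (br x y) A = 0" by (rule A_perp[OF bracket_N])

lemma tr_ad: "tr (br x) = g x A * tr T"
proof -
  obtain n where n: "n \<in> N" "x = g x A *\<^sub>R A + n" by (rule split_N)
  have "tr (br x) = tr (br (g x A *\<^sub>R A + n))" using n by simp
  also have "\<dots> = g x A * tr T + tr (br n)"
    by (simp add: linear_add[OF linear_tr_ad] linear_scale[OF linear_tr_ad])
  finally show ?thesis using tr_N(1)[OF n(1)] by simp
qed

lemma killing_codim: "killing br x y = g x A * g y A * killing br A A"
proof -
  obtain n m where n: "n \<in> N" "x = g x A *\<^sub>R A + n" and m: "m \<in> N" "y = g y A *\<^sub>R A + m"
    by (metis split_N)
  have add: "killing br (x + y) z = killing br x z + killing br y z"
    "killing br (a *\<^sub>R x) z = a * killing br x z" for a x y z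
    by (simp_all add: killing_def bbil tr_add tr_scale)
  have "killing br x y = killing br (g x A *\<^sub>R A + n) y" using n by simp
  also have "\<dots> = g x A * killing br (g y A *\<^sub>R A + m) A"
    using m by (simp add: add tr_N(2)[OF n(1)] killing_sym[OF lie, of A y])
  also have "\<dots> = g x A * (g y A * killing br A A)"
    unfolding add by (simp add: tr_N(2)[OF m(1)])
  finally show ?thesis by simp
qed

lemma mean_curvature_codim: "mean_curvature = tr T *\<^sub>R A"
proof (rule metric_nondegenerate[OF metric])
  fix w show "g mean_curvature w = g (tr T *\<^sub>R A) w"
    using tr_ad[of w] gsym[of A w] by (simp add: mean_curvature gbil mult.commute)
qed

lemma ricci_tensor_codim:
  "ricci_tensor br g y z = moment y z - g y A * g z A * killing br A A / 2
    - tr T / 2 * (g (T y) z + g (T z) y)"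
  unfolding ricci_tensor_formula killing_codim[of y z] mean_curvature_codim
  by (simp add: bbil gbil algebra_simps add_divide_distrib)

lemma tr_T_T: "tr (\<lambda>x. T (T x)) = (\<Sum>i\<le>k. \<Sum>j\<le>k. g (T (e i)) (e j) * g (T (e j)) (e i))"
proof -
  have "tr (\<lambda>x. T (T x)) = (\<Sum>i\<le>k. g (T (e i)) (adj T (e i)))"
    using tr_onb[OF lincomp[OF linear_T linear_T]] by (simp add: adj_right[OF linear_T])
  then show ?thesis by (simp add: parseval[of "T _" "adj T _"] adj_left[OF linear_T] gsym[of "e _" "T _"])
qed

lemma tr_T'_T: "tr (\<lambda>x. adj T (T x)) = (\<Sum>i\<le>k. \<Sum>j\<le>k. (g (T (e i)) (e j))\<^sup>2)"
proof -
  have "tr (\<lambda>x. adj T (T x)) = (\<Sum>i\<le>k. g (T (e i)) (T (e i)))"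
    using tr_onb[OF lincomp[OF linear_T linear_T']] by (simp add: adj_left[OF linear_T])
  then show ?thesis by (simp add: parseval[of "T _" "T _"] power2_eq_square)
qed

text \<open>The squared norm of the symmetric part \<open>(T + adj T) / 2\<close> of
  \<open>ad A\<close>. Its negative is the Ricci curvature of the unit normal, whence it determines
  the soliton constant.\<close>

definition sym_norm :: real where
  "sym_norm = (\<Sum>i\<le>k. \<Sum>j\<le>k. (g (T (e i)) (e j) + g (T (e j)) (e i))\<^sup>2) / 4"

lemma sym_norm_nonneg: "sym_norm \<ge> 0" by (simp add: sym_norm_def sum_nonneg)

lemma sym_norm_eq: "2 * sym_norm = tr (\<lambda>x. T (T x)) + tr (\<lambda>x. adj T (T x))"
proof -
  have "(\<Sum>i\<le>k. \<Sum>j\<le>k. (g (T (e i)) (e j) + g (T (e j)) (e i))\<^sup>2) =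
    (\<Sum>i\<le>k. \<Sum>j\<le>k. (g (T (e i)) (e j))\<^sup>2) + (\<Sum>i\<le>k. \<Sum>j\<le>k. (g (T (e j)) (e i))\<^sup>2)
    + 2 * (\<Sum>i\<le>k. \<Sum>j\<le>k. g (T (e i)) (e j) * g (T (e j)) (e i))"
    by (simp add: power2_sum sum.distrib sum_distrib_left mult.assoc)
  also have "(\<Sum>i\<le>k. \<Sum>j\<le>k. (g (T (e j)) (e i))\<^sup>2) = (\<Sum>i\<le>k. \<Sum>j\<le>k. (g (T (e i)) (e j))\<^sup>2)"
    by (rule sum.swap)
  finally show ?thesis by (simp add: sym_norm_def tr_T_T tr_T'_T)
qed

lemma T_A: "T A = 0" by (rule lie_self[OF lie])

lemma T'_A: "adj T A = 0"
  by (rule metric_nondegenerate[OF metric])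
    (simp add: adj_left[OF linear_T] gsym[of A] bracket_perp gbil)

lemma ricci_A_A: "ricci_tensor br g A A = - sym_norm"
proof -
  have "moment A A = - (\<Sum>i\<le>k. g (T (e i)) (T (e i))) / 2"
    by (simp add: moment_def bracket_perp)
  also have "(\<Sum>i\<le>k. g (T (e i)) (T (e i))) = tr (\<lambda>x. adj T (T x))"
    using tr_onb[OF lincomp[OF linear_T linear_T']] by (simp add: adj_left[OF linear_T])
  finally show ?thesis
    using sym_norm_eq
    by (simp add: ricci_tensor_codim A_unit T_A gbil killing_def)
qed

text \<open>The pairs with \<open>A\<close> in the first and those with \<open>A\<close> in the
  second place both contribute the entries of \<open>T\<close> to the norm of the bracket. With the
  coefficient 1/4 this is half the squared norm of \<open>T\<close>, exactly what completes the
  Killing term to \<open>sym_norm\<close>.\<close>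

lemma scalar_curvature_nonpos: "scalar_curvature br g \<le> 0"
proof -
  let ?c = "\<lambda>i j l. (g (br (e i) (e j)) (e l))\<^sup>2"
  let ?t = "\<lambda>i l. (g (T (e i)) (e l))\<^sup>2"
  have mom: "(\<Sum>i\<le>k. moment (e i) (e i)) = - (\<Sum>i\<le>k. \<Sum>j\<le>k. \<Sum>l\<le>k. ?c i j l) / 4"
    using sum_moment_diagonal[of "\<lambda>_. 1"] by (simp add: sum_negf)
  have "(\<Sum>i\<le>k. \<Sum>j\<le>k. \<Sum>l\<le>k. ?c i j l)
    = (\<Sum>i<k. \<Sum>j\<le>k. \<Sum>l\<le>k. ?c i j l) + (\<Sum>j\<le>k. \<Sum>l\<le>k. ?t j l)"
    by (simp add: lessThan_Suc_atMost[symmetric])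
  moreover have "(\<Sum>i<k. \<Sum>j\<le>k. \<Sum>l\<le>k. ?c i j l) \<ge> (\<Sum>i<k. \<Sum>l\<le>k. ?t i l)"
  proof (rule sum_mono)
    fix i
    have "(\<Sum>l\<le>k. ?t i l) = (\<Sum>l\<le>k. ?c i k l)"
      using lie_skew[OF lie, of "e i" A] by (simp add: gbil)
    also have "\<dots> \<le> (\<Sum>j\<le>k. \<Sum>l\<le>k. ?c i j l)"
      by (rule member_le_sum[of k "{..k}" "\<lambda>j. \<Sum>l\<le>k. ?c i j l"]) (auto intro: sum_nonneg)
    finally show "(\<Sum>l\<le>k. ?t i l) \<le> (\<Sum>j\<le>k. \<Sum>l\<le>k. ?c i j l)" .
  qed
  moreover have "(\<Sum>i<k. \<Sum>l\<le>k. ?t i l) = (\<Sum>i\<le>k. \<Sum>l\<le>k. ?t i l)"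
    by (simp add: lessThan_Suc_atMost[symmetric] T_A gbil)
  ultimately have m: "(\<Sum>i\<le>k. moment (e i) (e i)) \<le> - tr (\<lambda>x. adj T (T x)) / 2"
    unfolding mom tr_T'_T by linarith
  have "scalar_curvature br g = (\<Sum>i\<le>k. moment (e i) (e i))
      - (\<Sum>i\<le>k. (if i = k then killing br A A / 2 else 0)) - (\<Sum>i\<le>k. tr T * g (T (e i)) (e i))"
    unfolding scalar_curvature_onb ricci_tensor_codim sum_subtractf[symmetric]
    by (intro sum.cong) (auto simp: g_e_A)
  also have "\<dots> = (\<Sum>i\<le>k. moment (e i) (e i)) - tr (\<lambda>x. T (T x)) / 2 - (tr T)\<^sup>2"
    using tr_onb[OF linear_T]
    by (simp add: killing_def sum_distrib_left[symmetric] power2_eq_square)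
  finally show ?thesis
    using m sym_norm_eq sym_norm_nonneg zero_le_power2[of "tr T"] by linarith
qed

end

section \<open>Structural consequences of the soliton equation\<close>

locale codim_one_soliton = codim_one_metric g k e br N
  for g :: "'a::euclidean_space \<Rightarrow> 'a \<Rightarrow> real" and k e br N +
  fixes c :: real and D :: "'a \<Rightarrow> 'a"
  assumes D: "derivation br D" and ricci_D: "\<And>x. ricci_operator br g x = c *\<^sub>R x + D x"
    and not_nilpotent: "\<not> nilpotent_ideal br UNIV"
begin

lemma linear_D: "linear D" and D_bracket: "D (br x y) = br (D x) y + br x (D y)"
  using D by (auto simp: derivation_def)

lemma ricci_tensor_D: "ricci_tensor br g x y = c * g x y + g (D x) y"
  using ricci[of x y] by (simp add: ricci_D gbil)

lemma D_sym: "g (D x) y = g x (D y)"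
  using ricci_tensor_sym[of x y] ricci_tensor_D[of x y] ricci_tensor_D[of y x] gsym[of x y]
    gsym[of "D y" x] by simp

lemma bilinear_D: "bilinear (\<lambda>x y. g (D x) y)"
  by (auto simp: bilinear_def gbil linear_add[OF linear_D] linear_scale[OF linear_D] intro!: linearI)

text \<open>The operator \<open>ad v\<close> shifts eigenvalues of \<open>D\<close> by
  \<open>l\<close>, hence is nilpotent because the spectrum is finite. If \<open>v\<close> were
  outside \<open>N\<close>, it would span the algebra together with \<open>N\<close>, which would
  then be nilpotent.\<close>

lemma eigenvector_in_N:
  assumes v: "D v = l *\<^sub>R v" "l \<noteq> 0" shows "v \<in> N"
proof (rule ccontr)
  assume vN: "v \<notin> N"
  have q: "g (D x) y = g (D y) x" for x y using D_sym[of x y] gsym[of x "D y"] by simp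
  let ?n = "DIM('a)"
  obtain w :: "nat \<Rightarrow> 'a" where w':
    "\<forall>i<?n. \<forall>y\<in>UNIV. g (D (w i)) y = g (D (w i)) (w i) * g (w i) y"
    "\<forall>x\<in>UNIV. x = (\<Sum>i<?n. g x (w i) *\<^sub>R w i)"
    using simultaneous_diagonalization[OF metric bilinear_D q subspace_UNIV, unfolded dim_UNIV]
    by (elim exE conjE)
  define m where "m i = g (D (w i)) (w i)" for i
  have Dw: "D (w i) = m i *\<^sub>R w i" if "i < ?n" for i
  proof (rule metric_nondegenerate[OF metric])
    fix y show "g (D (w i)) y = g (m i *\<^sub>R w i) y"
      using w'(1)[rule_format, OF that, of y] by (simp add: m_def gbil)
  qed
  define S where "S = (\<Sum>i<?n. \<bar>m i\<bar>)"
  have mS: "\<bar>m i\<bar> \<le> S" if "i < ?n" for i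
    unfolding S_def using that by (intro member_le_sum) auto
  \<comment> \<open>All eigenvalues lie in \<open>[-S, S]\<close>, an interval of length
    \<open>2 * S\<close>, so a shift by \<open>K * l\<close> leaves it from any starting
    point.\<close>
  obtain K :: nat where K: "of_nat K * \<bar>l\<bar> > 2 * S"
    using ex_less_of_nat_mult[of "\<bar>l\<bar>" "2 * S"] v(2) by auto
  have eig0: "x = 0" if "D x = r *\<^sub>R x" "\<bar>r\<bar> > S" for r x
  proof -
    have "g x (w i) = 0" if i: "i < ?n" for i
    proof -
      have "r * g x (w i) = m i * g x (w i)"
        using D_sym[of x "w i"] by (simp add: \<open>D x = _\<close> Dw[OF i] gbil)
      then show ?thesis using mS[OF i] \<open>\<bar>r\<bar> > S\<close> by auto
    qed
    then show "x = 0" using w'(2)[rule_format, of x] by simp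
  qed
  have linp: "linear (br v ^^ j)" for j
    by (induction j) (auto simp: linear_id id_def[symmetric] intro: linear_compose[unfolded o_def] linear_ad lie_alg)
  have Dp: "D ((br v ^^ j) x) = (r + of_nat j * l) *\<^sub>R (br v ^^ j) x" if "D x = r *\<^sub>R x" for j r x
    by (induction j) (simp_all add: that D_bracket v(1) bbil algebra_simps)
  have "(br v ^^ K) (w i) = 0" if i: "i < ?n" for i
  proof (rule eig0[OF Dp[OF Dw[OF i]]])
    have "of_nat K * \<bar>l\<bar> = \<bar>of_nat K * l\<bar>" by (simp add: abs_mult)
    then show "S < \<bar>m i + of_nat K * l\<bar>" using K mS[OF i] by linarith
  qed
  then have "(\<Sum>i<?n. g x (w i) *\<^sub>R (br v ^^ K) (w i)) = 0" for x
    by (intro sum.neutral) simp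
  then have "(br v ^^ K) (\<Sum>i<?n. g x (w i) *\<^sub>R w i) = 0" for x
    by (simp only: linear_family_sum[OF linp])
  then have nil: "(br v ^^ K) x = 0" for x
    by (subst w'(2)[rule_format, OF UNIV_I, of x])
  have "\<exists>a n. n \<in> N \<and> x = a *\<^sub>R v + n" for x
  proof (intro exI conjI)
    show "x - (g x A / g v A) *\<^sub>R v \<in> N" using vN by (simp add: N_iff gbil)
    show "x = (g x A / g v A) *\<^sub>R v + (x - (g x A / g v A) *\<^sub>R v)" by simp
  qed
  from nilpotent_ad_imp_nilpotent[OF this nil] show False using not_nilpotent by simp
qed

text \<open>In an orthonormal eigenbasis of \<open>D\<close> the vectors with nonzero eigenvalue lie
  in \<open>N\<close> and are orthogonal to \<open>A\<close>, so \<open>A\<close> only has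
  components in the kernel.\<close>

lemma D_A: "D A = 0"
proof -
  have q: "g (D x) y = g (D y) x" for x y using D_sym[of x y] gsym[of x "D y"] by simp
  let ?n = "DIM('a)"
  obtain w :: "nat \<Rightarrow> 'a" where w':
    "\<forall>i<?n. \<forall>y\<in>UNIV. g (D (w i)) y = g (D (w i)) (w i) * g (w i) y"
    "\<forall>x\<in>UNIV. x = (\<Sum>i<?n. g x (w i) *\<^sub>R w i)"
    using simultaneous_diagonalization[OF metric bilinear_D q subspace_UNIV, unfolded dim_UNIV]
    by (elim exE conjE)
  define m where "m i = g (D (w i)) (w i)" for i
  have Dw: "D (w i) = m i *\<^sub>R w i" if "i < ?n" for i
  proof (rule metric_nondegenerate[OF metric])
    fix y show "g (D (w i)) y = g (m i *\<^sub>R w i) y"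
      using w'(1)[rule_format, OF that, of y] by (simp add: m_def gbil)
  qed
  have "g A (w i) *\<^sub>R D (w i) = 0" if i: "i < ?n" for i
    using eigenvector_in_N[OF Dw[OF i]] Dw[OF i] by (cases "m i = 0") (auto simp: N_iff gsym)
  then have "(\<Sum>i<?n. g A (w i) *\<^sub>R D (w i)) = 0" by (intro sum.neutral) simp
  then show ?thesis
    using w'(2) linear_family_sum[OF linear_D, of "\<lambda>i. g A (w i)" w "{..<?n}"] by auto
qed

lemma D_N: "D x \<in> N" by (simp add: N_iff D_sym D_A gbil)

lemma D_T: "D (T x) = T (D x)" by (simp add: D_bracket D_A bbil)

lemma c_eq: "c = - sym_norm"
  using ricci_A_A by (simp add: ricci_tensor_D A_unit D_A gbil)

text \<open>For operators killing \<open>A\<close> the Killing term drops out, and the soliton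
  equation expresses the moment pairing by traces. It is compared with the pairings computed from
  the bracket, for \<open>M\<close> equal to \<open>T\<close> or to a commutator of some
  \<open>ad x\<close> with its adjoint.\<close>

lemma sum_moment_eq_traces:
  assumes M: "linear M" and MA: "M A = 0"
  shows "(\<Sum>i\<le>k. moment (M (e i)) (e i)) = c * tr M + tr (\<lambda>x. D (M x))
    + tr T / 2 * (tr (\<lambda>x. T (M x)) + tr (\<lambda>x. adj T (M x)))"
proof -
  have "g (M (e i)) A * g (e i) A = 0" if "i \<le> k" for i
    using that by (simp add: g_e_A MA gbil)
  then have "moment (M (e i)) (e i) = c * g (M (e i)) (e i) + g (D (M (e i))) (e i)
      + tr T / 2 * (g (T (M (e i))) (e i) + g (adj T (M (e i))) (e i))" if "i \<le> k" for i
    using that ricci_tensor_codim[of "M (e i)" "e i"]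
    by (simp add: ricci_tensor_D adj_left[OF linear_T] gsym[of "T (e i)"])
  then have "(\<Sum>i\<le>k. moment (M (e i)) (e i)) = (\<Sum>i\<le>k. c * g (M (e i)) (e i) + g (D (M (e i))) (e i)
      + tr T / 2 * (g (T (M (e i))) (e i) + g (adj T (M (e i))) (e i)))"
    by (intro sum.cong) auto
  also have "\<dots> = c * tr M + tr (\<lambda>x. D (M x))
    + tr T / 2 * (tr (\<lambda>x. T (M x)) + tr (\<lambda>x. adj T (M x)))"
    using tr_onb[OF M] tr_onb[OF lincomp[OF M linear_D]]
      tr_onb[OF lincomp[OF M linear_T]] tr_onb[OF lincomp[OF M linear_T']]
    by (simp add: sum.distrib sum_distrib_left[symmetric] sum_divide_distrib[symmetric])
  finally show ?thesis .
qed

lemma tr_commutator: "linear f \<Longrightarrow> linear h \<Longrightarrow> tr (\<lambda>x. f (h x) - h (f x)) = 0"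
  by (simp add: tr_diff tr_commute[of f h])

text \<open>The moment map is paired with \<open>[T, T\<^sup>t]\<close>: one side is the squared norm of the action of \<open>T\<^sup>t\<close> on
  the bracket, and on the other side every trace vanishes.\<close>

lemma derivation_T': "derivation br (adj T)"
proof -
  let ?M = "\<lambda>x. T (adj T x) - adj T (T x)"
  have MA: "?M A = 0" using linear_0[OF linear_T] linear_0[OF linear_T'] by (simp add: T_A T'_A)
  have lM: "linear ?M"
    by (rule linear_compose_sub[OF lincomp[OF linear_T' linear_T] lincomp[OF linear_T linear_T']])
  have "tr (\<lambda>x. D (T (adj T x))) = tr (\<lambda>x. D (adj T (T x)))"
    using tr_commute[OF linear_T lincomp[OF linear_T' linear_D]] by (simp add: D_T)
  then have 1: "tr (\<lambda>x. D (?M x)) = 0" by (simp add: linear_diff[OF linear_D] tr_diff)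
  have "tr (\<lambda>x. T (T (adj T x))) = tr (\<lambda>x. T (adj T (T x)))"
    using tr_commute[OF linear_T lincomp[OF linear_T' linear_T]] .
  then have 2: "tr (\<lambda>x. T (?M x)) = 0" by (simp add: linear_diff[OF linear_T] tr_diff)
  have "tr (\<lambda>x. adj T (T (adj T x))) = tr (\<lambda>x. adj T (adj T (T x)))"
    using tr_commute[OF lincomp[OF linear_T linear_T'] linear_T'] .
  then have 3: "tr (\<lambda>x. adj T (?M x)) = 0" by (simp add: linear_diff[OF linear_T'] tr_diff)
  have "bracket_ip (bracket_action (adj T) br) (bracket_action (adj T) br) = 0"
    using sum_moment_commutator[OF derivation_ad[OF lie, of A]] sum_moment_eq_traces[OF lM MA]
      tr_commutator[OF linear_T linear_T'] 1 2 3 by simp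
  then show ?thesis
    using bracket_ip_self_eq_0[OF bilinear_bracket_action[OF linear_T' lie_bilinear[OF lie]]]
    by (simp add: derivation_iff_bracket_action linear_T')
qed

text \<open>The adjoint of \<open>T\<close> is a derivation that annihilates \<open>A\<close>, and
  such a derivation commutes with \<open>ad A\<close>.\<close>

lemma T_normal: "adj T (T x) = T (adj T x)"
  using derivation_T' by (simp add: derivation_def T'_A bbil)

text \<open>The moment pairing with the derivation \<open>T\<close> is zero. In its trace expression
  the terms \<open>c * tr T\<close> and \<open>tr T * sym_norm\<close> cancel because
  \<open>c = - sym_norm\<close>, which leaves the trace of \<open>T \<circ> D\<close>.\<close>

lemma tr_T_D: "tr (\<lambda>x. T (D x)) = 0"
proof -
  have "tr T * c = - tr T / 2 * (tr (\<lambda>x. T (T x)) + tr (\<lambda>x. adj T (T x)))"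
    using sym_norm_eq by (simp add: c_eq)
  then show ?thesis
    using sum_moment_eq_traces[OF linear_T T_A] sum_moment_derivation[OF derivation_ad[OF lie]]
    by (simp add: D_T mult.commute)
qed

text \<open>By the soliton equation the left side is \<open>c scal\<close> plus the trace of
  \<open>Ric \<circ> D\<close>. In the latter the moment pairing with the derivation
  \<open>D\<close>, the Killing term and the trace of \<open>T \<circ> D\<close> all vanish.\<close>

lemma ricci_norm: "tr (ricci_operator br g \<circ> ricci_operator br g) = c * scalar_curvature br g"
proof -
  have R: "ricci_operator br g \<circ> ricci_operator br g =
      (\<lambda>x. c *\<^sub>R ricci_operator br g x + ricci_operator br g (D x))"
    by (auto simp: fun_eq_iff) (simp add: ricci_D[of x for x] linear_add[OF linear_D]
        linear_scale[OF linear_D] algebra_simps)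
  have "g (D (e i)) A * g (e i) A = 0" if "i \<le> k" for i
    using that by (simp add: g_e_A D_A gbil)
  then have "ricci_tensor br g (D (e i)) (e i) = moment (D (e i)) (e i)
      - tr T / 2 * (g (T (D (e i))) (e i) + g (T (D (e i))) (e i))" if "i \<le> k" for i
    using that ricci_tensor_codim[of "D (e i)" "e i"] D_T[of "e i"] D_sym[of "T (e i)" "e i"] by simp
  then have "tr (\<lambda>x. ricci_operator br g (D x)) = (\<Sum>i\<le>k. moment (D (e i)) (e i)
      - tr T / 2 * (g (T (D (e i))) (e i) + g (T (D (e i))) (e i)))"
    using tr_onb[OF lincomp[OF linear_D linear_ricci]] by (simp add: ricci)
  also have "\<dots> = 0"
    using sum_moment_derivation[OF D] tr_T_D tr_onb[OF lincomp[OF linear_D linear_T]]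
    by (simp add: sum_subtractf sum_distrib_left[symmetric] o_def)
  finally show ?thesis unfolding R by (simp add: tr_add tr_scale scalar_curvature_def)
qed

lemma c_neg:
  assumes "ricci_operator br g \<noteq> (\<lambda>x. 0)" shows "c < 0"
proof (rule ccontr)
  assume "\<not> c < 0"
  then have "c = 0" using c_eq sym_norm_nonneg by linarith
  then have "(\<Sum>i\<le>k. \<Sum>j\<le>k. (ricci_tensor br g (e i) (e j))\<^sup>2) = 0"
    using ricci_norm tr_ricci_sq by simp
  then have z: "ricci_tensor br g (e i) (e j) = 0" if "i \<le> k" "j \<le> k" for i j
    using that by (simp add: sum_nonneg_eq_0_iff sum_nonneg)
  have "ricci_operator br g (e i) = 0" if "i \<le> k" for i
    by (rule coordinates_eqI) (use z that in \<open>simp add: ricci gbil\<close>)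
  then have "ricci_operator br g x = 0" for x
    using linear_eq_onb[OF linear_ricci linear_zero] by simp
  then show False using assms by auto
qed

end

section \<open>Kernel of the transverse derivation\<close>

definition divided_power :: "('a::euclidean_space \<Rightarrow> 'a) \<Rightarrow> nat \<Rightarrow> 'a \<Rightarrow> 'a" where
  "divided_power d m x = (1 / fact m) *\<^sub>R (d ^^ m) x"

definition truncated_exp :: "nat \<Rightarrow> ('a::euclidean_space \<Rightarrow> 'a) \<Rightarrow> 'a \<Rightarrow> 'a" where
  "truncated_exp K d x = (\<Sum>m<K. divided_power d m x)"

lemma linear_funpow:
  fixes d :: "'a::real_vector \<Rightarrow> 'a"
  shows "linear d \<Longrightarrow> linear (d ^^ m)"
  by (induction m) (auto simp: linear_id id_def[symmetric] intro: linear_compose)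

lemma divided_power_Suc:
  "linear d \<Longrightarrow> d (divided_power d m x) = of_nat (Suc m) *\<^sub>R divided_power d (Suc m) x"
  by (simp add: divided_power_def linear_scale divide_simps del: of_nat_Suc)

text \<open>The factorials absorb the binomial coefficients. After reindexing, the term
  \<open>i\<close> of order \<open>Suc m\<close> arises with coefficients \<open>i\<close> and
  \<open>Suc m - i\<close>, whose sum does not depend on \<open>i\<close>.\<close>

lemma divided_power_leibniz:
  assumes d: "derivation br d" and br: "bilinear br"
  shows "divided_power d m (br x y) =
    (\<Sum>i\<le>m. br (divided_power d i x) (divided_power d (m - i) y))"
proof (induction m)
  case 0 show ?case by (simp add: divided_power_def)
next
  case (Suc m)
  note bb = bilin[OF br]
  have l: "linear d" and dd: "\<And>x y. d (br x y) = br (d x) y + br x (d y)"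
    using d by (auto simp: derivation_def)
  let ?p = "\<lambda>i x. divided_power d i x"
  have "of_nat (Suc m) *\<^sub>R ?p (Suc m) (br x y) = d (\<Sum>i\<le>m. br (?p i x) (?p (m - i) y))"
    using divided_power_Suc[OF l, of m "br x y"] Suc by simp
  also have "\<dots> = (\<Sum>i\<le>m. of_nat (Suc i) *\<^sub>R br (?p (Suc i) x) (?p (Suc m - Suc i) y))
      + (\<Sum>i\<le>m. of_nat (Suc m - i) *\<^sub>R br (?p i x) (?p (Suc m - i) y))"
    by (simp add: linear_sum[OF l] dd divided_power_Suc[OF l] bb sum.distrib Suc_diff_le
        del: of_nat_Suc)
  also have "(\<Sum>i\<le>m. of_nat (Suc i) *\<^sub>R br (?p (Suc i) x) (?p (Suc m - Suc i) y)) =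
      (\<Sum>i\<le>Suc m. of_nat i *\<^sub>R br (?p i x) (?p (Suc m - i) y))"
    unfolding sum.atMost_Suc_shift[of _ m] by simp
  also have "(\<Sum>i\<le>m. of_nat (Suc m - i) *\<^sub>R br (?p i x) (?p (Suc m - i) y)) =
      (\<Sum>i\<le>Suc m. of_nat (Suc m - i) *\<^sub>R br (?p i x) (?p (Suc m - i) y))" by simp
  also have "(\<Sum>i\<le>Suc m. of_nat i *\<^sub>R br (?p i x) (?p (Suc m - i) y)) + \<dots> =
      (\<Sum>i\<le>Suc m. of_nat (Suc m) *\<^sub>R br (?p i x) (?p (Suc m - i) y))"
    unfolding sum.distrib[symmetric] scaleR_add_left[symmetric] of_nat_add[symmetric]
    by (intro sum.cong) auto
  also have "\<dots> = of_nat (Suc m) *\<^sub>R (\<Sum>i\<le>Suc m. br (?p i x) (?p (Suc m - i) y))"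
    by (rule scaleR_sum_right[symmetric])
  finally show ?case by (simp del: of_nat_Suc sum.atMost_Suc)
qed

lemma lie_automorphism_truncated_exp:
  fixes d :: "'a::euclidean_space \<Rightarrow> 'a"
  assumes d: "derivation br d" and br: "bilinear br" and nil: "\<And>x. (d ^^ K) x = 0" and K: "K > 0"
  shows "lie_automorphism br (truncated_exp K d)"
proof -
  have l: "linear d" using d by (simp add: derivation_def)
  note bb = bilin[OF br]
  have lp: "linear (divided_power d m)" for m
    using linear_funpow[OF l, of m]
    by (auto intro!: linearI simp: divided_power_def linear_add linear_scale scaleR_add_right)
  have dz: "(d ^^ m) x = 0" if "m \<ge> K" for m x
  proof -
    have "(d ^^ m) x = (d ^^ (m - K)) ((d ^^ K) x)"
      using that by (metis comp_apply funpow_add le_add_diff_inverse2)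
    then show ?thesis using nil linear_0[OF linear_funpow[OF l]] by simp
  qed
  then have pz: "divided_power d m x = 0" if "m \<ge> K" for m x
    using that by (simp add: divided_power_def)
  have lin: "linear (truncated_exp K d)"
    unfolding truncated_exp_def by (intro linear_compose_sum) (use lp in blast)
  have hom: "truncated_exp K d (br x y) = br (truncated_exp K d x) (truncated_exp K d y)" for x y
  proof -
    let ?f = "\<lambda>i j. br (divided_power d i x) (divided_power d j y)"
    have f0: "?f i j = 0" if "\<not> (i < K \<and> j < K)" for i j
      using that by (cases "i < K") (simp_all add: pz bb not_less)
    \<comment> \<open>Padding by zero terms up to \<open>2*K\<close> makes the triangle
      \<open>i + j < 2*K\<close> contain the square of index pairs that occurs in the
      product.\<close>
    have "truncated_exp K d (br x y) = (\<Sum>m<2*K. divided_power d m (br x y))"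
      unfolding truncated_exp_def by (rule sum.mono_neutral_left) (auto simp: pz)
    also have "\<dots> = (\<Sum>m<2*K. \<Sum>i\<le>m. ?f i (m - i))"
      by (simp add: divided_power_leibniz[OF d br])
    also have "\<dots> = (\<Sum>(i,j)\<in>{(i,j). i + j < 2*K}. ?f i j)"
      by (rule sum.triangle_reindex[symmetric])
    also have "\<dots> = (\<Sum>(i,j)\<in>{..<K} \<times> {..<K}. ?f i j)"
    proof (rule sum.mono_neutral_right)
      show "finite {(i,j). i + j < 2*K}"
        by (rule finite_subset[of _ "{..<2*K} \<times> {..<2*K}"]) auto
    qed (use f0 in fastforce)+
    also have "\<dots> = br (truncated_exp K d x) (truncated_exp K d y)"
      unfolding truncated_exp_def by (simp add: bb sum.cartesian_product[symmetric]) (rule sum.swap)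
    finally show ?thesis .
  qed
  have "x = 0" if x: "truncated_exp K d x = 0" for x
  proof (rule ccontr)
    assume "x \<noteq> 0"
    \<comment> \<open>For injectivity, the highest power of \<open>d\<close> that does not kill
      \<open>x\<close> is applied: it sees only the leading term of the exponential.\<close>
    define n where "n = (LEAST n. (d ^^ n) x = 0)"
    have n: "(d ^^ n) x = 0" unfolding n_def by (rule LeastI[of "\<lambda>n. (d ^^ n) x = 0" K]) (rule nil)
    then obtain m where m: "n = Suc m" using \<open>x \<noteq> 0\<close> by (cases n) auto
    then have dm: "(d ^^ m) x \<noteq> 0" using not_less_Least[of m "\<lambda>n. (d ^^ n) x = 0"] n_def by simp
    have z: "(d ^^ m) (divided_power d j x) = 0" if pos: "j > 0" for j
    proof -
      obtain i where j: "j = Suc i" using pos by (cases j) auto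
      have "(d ^^ m) ((d ^^ j) x) = (d ^^ i) ((d ^^ n) x)"
        by (simp add: m j funpow_add[symmetric, THEN fun_cong, unfolded o_def] add.commute
            del: funpow.simps)
      then show ?thesis
        using n linear_0[OF linear_funpow[OF l]]
        by (simp add: divided_power_def linear_scale[OF linear_funpow[OF l]])
    qed
    have "0 = (d ^^ m) (truncated_exp K d x)" by (simp add: x linear_0[OF linear_funpow[OF l]])
    also have "\<dots> = (\<Sum>j<K. (d ^^ m) (divided_power d j x))"
      by (simp add: truncated_exp_def linear_sum[OF linear_funpow[OF l]])
    also have "\<dots> = (\<Sum>j\<in>{0}. (d ^^ m) (divided_power d j x))"
      by (rule sum.mono_neutral_right) (use K z in auto)
    finally show False using dm by (simp add: divided_power_def)
  qed
  then have "inj (truncated_exp K d)" using linear_injective_0[OF lin] by blast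
  then have "bij (truncated_exp K d)"
    using linear_injective_imp_surjective[OF lin] by (simp add: bij_def)
  then show ?thesis using lin hom by (simp add: lie_automorphism_def)
qed

section \<open>Positivity on the kernel and conjugation of the normal\<close>

context codim_one_soliton
begin

lemma kernel_adj: "T x = 0 \<Longrightarrow> adj T x = 0"
proof -
  assume "T x = 0"
  then have "g (adj T x) (adj T x) = 0"
    using T_normal[of x] linear_0[OF linear_T'] by (simp add: adj_left[OF linear_T] gbil)
  then show ?thesis by (simp add: metric_eq_0_iff[OF metric])
qed

lemma kernel_adj': "adj T x = 0 \<Longrightarrow> T x = 0"
proof -
  assume "adj T x = 0"
  then have "g (T x) (T x) = 0"
    using T_normal[of x] linear_0[OF linear_T] by (simp add: adj_right[OF linear_T, symmetric] gbil)
  then show ?thesis by (simp add: metric_eq_0_iff[OF metric])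
qed

text \<open>A normal operator and its square have the same kernel, so a normal operator that is
  nilpotent vanishes. Nilpotency is used through the lower central series of \<open>N\<close>,
  climbed from its zero term.\<close>

lemma normal_ad_eq_0:
  assumes x: "x \<in> N" and n: "\<And>y. adj (br x) (br x y) = br x (adj (br x) y)"
  shows "br x y = 0"
proof -
  let ?B = "br x"
  note lB = linear_ad[OF lie, of x]
  have k: "?B y = 0" if "?B (?B y) = 0" for y
  proof -
    have "g (adj ?B (?B y)) (adj ?B (?B y)) = g (?B y) (?B (adj ?B (?B y)))"
      by (rule adj_left[OF lB])
    also have "\<dots> = 0" using n[of "?B y"] that linear_0[OF linear_adj] by (simp add: gbil)
    finally have "adj ?B (?B y) = 0" by (simp add: metric_eq_0_iff[OF metric])
    then have "g (?B y) (?B y) = 0" by (simp add: adj_right[OF lB, symmetric] gbil)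
    then show ?thesis by (simp add: metric_eq_0_iff[OF metric])
  qed
  obtain K where K: "C K = {0}" using nilpotent by (auto simp: nilpotent_ideal_def)
  have "?B y = 0" if "y \<in> C (K - j)" for j y
    using that
  proof (induction j arbitrary: y)
    case 0 then show ?case using K by (simp add: bbil)
  next
    case (Suc j)
    show ?case
    proof (cases "j < K")
      case True
      then have "?B y \<in> C (K - j)"
        using bracket_lower_central_series[OF x Suc.prems] by (simp add: Suc_diff_Suc del: lower_central_series.simps)
      then show ?thesis using Suc.IH k by blast
    qed (use Suc in simp)
  qed
  from this[of "?B y" K] have "?B (?B y) = 0" using ideal_N'[OF x] by simp
  then show ?thesis by (rule k)
qed

text \<open>Unless \<open>x\<close> is central, pair the moment map with the commutator of \<open>ad x\<close> and its adjoint.\<close>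

lemma kernel_eigenvalue_pos:
  assumes c: "c < 0" and x: "x \<in> N" "T x = 0" "D x = l *\<^sub>R x" "x \<noteq> 0"
  shows "l > 0"
proof (cases "\<forall>y. br x y = 0")
  case True
  \<comment> \<open>For central \<open>x\<close> the negative part of the moment map is absent,
    which gives even \<open>l \<ge> - c\<close>.\<close>
  have "(c + l) * g x x = moment x x"
    using ricci_tensor_codim[of x x] x A_perp[OF x(1)]
    by (simp add: ricci_tensor_D gbil algebra_simps)
  also have "\<dots> \<ge> 0" using True by (simp add: moment_def gbil sum_nonneg)
  finally have "(c + l) * g x x \<ge> 0" .
  then have "c + l \<ge> 0" using metric_pos[OF metric x(4)] by (simp add: zero_le_mult_iff)
  then show ?thesis using c by simp
next
  case False
  let ?B = "br x" and ?B' = "adj (br x)"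
  let ?M = "\<lambda>y. ?B (?B' y) - ?B' (?B y)"
  note lB = linear_ad[OF lie, of x] and lB' = linear_adj[of ?B]
  have BA: "?B A = 0" using lie_skew[OF lie, of x A] x(2) by simp
  have B'A: "?B' A = 0"
    by (rule metric_nondegenerate[OF metric]) (simp add: adj_left[OF lB] gsym[of A] bracket_perp gbil)
  have MA: "?M A = 0" by (simp add: BA B'A linear_0[OF lB] linear_0[OF lB'])
  have lM: "linear ?M" by (rule linear_compose_sub[OF lincomp[OF lB' lB] lincomp[OF lB lB']])
  have TB: "T (?B y) = ?B (T y)" for y
    using lie_ad_derivation[OF lie, of A x y] x(2) by (simp add: bbil)
  have T'B: "adj T (?B y) = ?B (adj T y)" for y
    using derivation_T' kernel_adj[OF x(2)] by (simp add: derivation_def bbil)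
  have DB: "D (?B y) = ?B (D y) + l *\<^sub>R ?B y" for y
    by (simp add: D_bracket x(3) bbil)
  have "tr (\<lambda>y. D (?B (?B' y))) = tr (\<lambda>y. D (?B' (?B y))) + l * tr (\<lambda>y. ?B (?B' y))"
    using tr_commute[OF lB lincomp[OF lB' linear_D]] by (simp add: DB tr_add tr_scale)
  then have 1: "tr (\<lambda>y. D (?M y)) = l * tr (\<lambda>y. ?B (?B' y))"
    by (simp add: linear_diff[OF linear_D] tr_diff)
  have 2: "tr (\<lambda>y. T (?M y)) = 0"
    using tr_commute[OF lB lincomp[OF lB' linear_T]] by (simp add: TB linear_diff[OF linear_T] tr_diff)
  have 3: "tr (\<lambda>y. adj T (?M y)) = 0"
    using tr_commute[OF lB lincomp[OF lB' linear_T']] by (simp add: T'B linear_diff[OF linear_T'] tr_diff)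
  let ?ip = "bracket_ip (bracket_action ?B' br) (bracket_action ?B' br)"
  have eq: "l * tr (\<lambda>y. ?B (?B' y)) = ?ip / 4"
    using sum_moment_commutator[OF derivation_ad[OF lie, of x]] sum_moment_eq_traces[OF lM MA]
      tr_commutator[OF lB lB'] 1 2 3 by simp
  have trB: "tr (\<lambda>y. ?B (?B' y)) = (\<Sum>i\<le>k. g (?B' (e i)) (?B' (e i)))"
    using tr_onb[OF lincomp[OF lB' lB]] by (simp add: adj_right[OF lB])
  have "tr (\<lambda>y. ?B (?B' y)) \<noteq> 0"
  proof
    assume "tr (\<lambda>y. ?B (?B' y)) = 0"
    then have "\<forall>i\<in>{..k}. g (?B' (e i)) (?B' (e i)) = 0"
      unfolding trB by (subst (asm) sum_nonneg_eq_0_iff) (auto simp: metric_nonneg[OF metric])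
    then have z: "\<And>i. i \<in> {..k} \<Longrightarrow> ?B' (e i) = 0" by (simp add: metric_eq_0_iff[OF metric])
    have "?B' y = 0" for y
      using linear_eq_onb[OF lB' linear_zero] z by simp
    then have "g (?B y) z = 0" for y z using adj_right[OF lB, of y z] by (simp add: gbil)
    then show False using False metric_eq_0_iff[OF metric] by blast
  qed
  then have pos: "tr (\<lambda>y. ?B (?B' y)) > 0"
    using trB sum_nonneg[of "{..k}" "\<lambda>i. g (?B' (e i)) (?B' (e i))"] metric_nonneg[OF metric] by force
  have "l * tr (\<lambda>y. ?B (?B' y)) \<ge> 0"
    using eq bracket_ip_self_nonneg[of "bracket_action ?B' br"] by linarith
  then have "l \<ge> 0" using pos by (simp add: zero_le_mult_iff)
  \<comment> \<open>If \<open>l = 0\<close>, the adjoint of \<open>ad x\<close> is a derivation, so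
    for \<open>z = ?B' x\<close> the operator \<open>ad z\<close> is a commutator of
    \<open>ad x\<close> with its adjoint and symmetric. As \<open>z\<close> is in \<open>N\<close>,
    the square of \<open>ad z\<close> has trace zero; hence \<open>ad z = 0\<close>, and
    \<open>ad x\<close> is normal.\<close>
  moreover have "l \<noteq> 0"
  proof
    assume "l = 0"
    then have "?ip = 0" using eq by simp
    then have dB': "derivation br ?B'"
      using bracket_ip_self_eq_0[OF bilinear_bracket_action[OF lB' lie_bilinear[OF lie]]]
      by (simp add: derivation_iff_bracket_action lB')
    define z where "z = ?B' x"
    have zN: "z \<in> N" by (simp add: z_def N_iff adj_left[OF lB] BA gbil)
    have bz: "br z y = ?B' (?B y) - ?B (?B' y)" for y
      using dB' by (simp add: derivation_def z_def)
    have zsym: "g (br z u) v = g u (br z v)" for u v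
      using adj_right[OF lB, of "?B' u" v] adj_left[OF lB, of u "?B' v"]
        adj_left[OF lB, of "?B u" v] adj_right[OF lB, of u "?B v"] by (simp add: bz gbil)
    have "(\<Sum>i\<le>k. g (br z (e i)) (br z (e i))) = 0"
      using tr_N(2)[OF zN, of z] tr_onb[OF lincomp[OF linear_ad[OF lie, of z] linear_ad[OF lie, of z]]]
      by (simp add: killing_def zsym)
    then have "\<And>i. i \<in> {..k} \<Longrightarrow> br z (e i) = 0"
      by (subst (asm) sum_nonneg_eq_0_iff) (auto simp: metric_nonneg[OF metric] metric_eq_0_iff[OF metric])
    then have "br z y = 0" for y
      using linear_eq_onb[OF linear_ad[OF lie, of z] linear_zero] by simp
    then have "?B' (?B y) = ?B (?B' y)" for y using bz[of y] by simp
    from normal_ad_eq_0[OF x(1) this] False show False by blast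
  qed
  ultimately show ?thesis by simp
qed

text \<open>The kernel of \<open>T\<close> in \<open>N\<close> is invariant under \<open>D\<close>
  and spanned by eigenvectors with positive eigenvalue, and these are orthogonal to
  \<open>v\<close>. In this form positivity restricts the coordinates of \<open>X\<close> in any
  eigenbasis of \<open>D\<close>.\<close>

lemma kernel_perp_nonpos_eigenvector:
  assumes c: "c < 0" and X: "X \<in> N" "T X = 0" and v: "D v = l *\<^sub>R v" "l \<le> 0"
  shows "g X v = 0"
proof -
  define U where "U = {x \<in> N. T x = 0}"
  have U: "subspace U"
    using subspace_N by (auto simp: U_def subspace_def bbil)
  have q: "g (D x) y = g (D y) x" for x y using D_sym[of x y] gsym[of x "D y"] by simp
  have DU: "D x \<in> U" if "x \<in> U" for x
    using that D_T[of x] linear_0[OF linear_D] by (simp add: U_def D_N)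
  obtain w :: "nat \<Rightarrow> 'a" where w: "\<forall>i<dim U. w i \<in> U"
    "\<forall>i<dim U. \<forall>j<dim U. g (w i) (w j) = (if i = j then 1 else 0)"
    "\<forall>i<dim U. \<forall>y\<in>U. g (D (w i)) y = g (D (w i)) (w i) * g (w i) y"
    "\<forall>x\<in>U. x = (\<Sum>i<dim U. g x (w i) *\<^sub>R w i)"
    using simultaneous_diagonalization[OF metric bilinear_D q U] by (elim exE conjE)
  have "g (w i) v = 0" if i: "i < dim U" for i
  proof -
    define m where "m = g (D (w i)) (w i)"
    have wU: "w i \<in> U" using w(1) i by blast
    define d where "d = D (w i) - m *\<^sub>R w i"
    have "d \<in> U" unfolding d_def using DU[OF wU] wU U by (simp add: subspace_diff subspace_scale)
    then have "g (D (w i) - m *\<^sub>R w i) d = 0"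
      using w(3)[rule_format, OF i, of d] by (simp add: m_def gbil)
    then have "g d d = 0" by (simp only: d_def[symmetric])
    then have Dw: "D (w i) = m *\<^sub>R w i" by (simp add: metric_eq_0_iff[OF metric] d_def)
    have "w i \<noteq> 0" using w(2) i by (metis gbil(9) zero_neq_one)
    then have "m > 0" using kernel_eigenvalue_pos[OF c] wU Dw by (auto simp: U_def)
    moreover have "m * g (w i) v = l * g (w i) v"
      using D_sym[of "w i" v] by (simp add: Dw v gbil)
    ultimately show ?thesis using v(2) by auto
  qed
  then have "g (\<Sum>i<dim U. g X (w i) *\<^sub>R w i) v = 0" by (simp add: gbil)
  moreover have "X = (\<Sum>i<dim U. g X (w i) *\<^sub>R w i)" using w(4) X by (simp add: U_def)
  ultimately show ?thesis by simp
qed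

text \<open>The component \<open>y0\<close> is taken orthogonal to \<open>T (C j)\<close> inside
  \<open>C j\<close>. Since \<open>adj T\<close> is a derivation it preserves \<open>C j\<close>, so
  \<open>T (adj T y0)\<close> is orthogonal to \<open>y0\<close>; thus \<open>adj T y0 = 0\<close>,
  and \<open>T y0 = 0\<close> by normality.\<close>

lemma C_split:
  assumes y: "y \<in> C j"
  obtains y0 z where "y0 \<in> C j" "T y0 = 0" "z \<in> C j" "y = y0 + T z"
proof -
  define U where "U = T ` C j"
  have U: "subspace U" unfolding U_def by (rule linear_subspace_image[OF linear_T subspace_C])
  obtain w :: "nat \<Rightarrow> 'a" where w: "\<forall>i<dim U. w i \<in> U"
    "\<forall>i<dim U. \<forall>j<dim U. g (w i) (w j) = (if i = j then 1 else 0)"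
    "\<forall>x\<in>U. x = (\<Sum>i<dim U. g x (w i) *\<^sub>R w i)"
    using exists_orthonormal_basis[OF metric U] by (elim exE conjE)
  define u where "u = (\<Sum>i<dim U. g y (w i) *\<^sub>R w i)"
  have uU: "u \<in> U" unfolding u_def using w(1) U by (intro subspace_sum[OF U] subspace_scale[OF U]) auto
  then obtain z where z: "z \<in> C j" "u = T z" unfolding U_def by blast
  define y0 where "y0 = y - u"
  have uC: "u \<in> C j" using z ad_C by simp
  then have y0C: "y0 \<in> C j" unfolding y0_def using y subspace_C by (intro subspace_diff) auto
  have wo: "g (w i) (w j) = (if i = j then 1 else 0)" if "i < dim U" "j < dim U" for i j
    using that w(2) by blast
  have yw: "g y0 (w i) = 0" if "i < dim U" for i
  proof -
    have "g u (w i) = (\<Sum>l<dim U. if l = i then g y (w i) else 0)"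
      unfolding u_def gbil using wo[OF _ that] by (intro sum.cong) auto
    then show ?thesis using that by (simp add: y0_def gbil)
  qed
  have y0U: "g y0 x = 0" if "x \<in> U" for x
    by (subst w(3)[rule_format, OF that]) (simp add: gbil yw)
  have "adj T x \<in> N" for x by (simp add: N_iff adj_left[OF linear_T] T_A gbil)
  then have "adj T y0 \<in> C j" using derivation_lower_central_series[OF derivation_T' _ y0C] by blast
  then have "g y0 (T (adj T y0)) = 0" by (intro y0U) (simp add: U_def)
  then have "adj T y0 = 0"
    using metric_eq_0_iff[OF metric, of "adj T y0"] by (simp add: adj_left[OF linear_T])
  then have "T y0 = 0" by (rule kernel_adj')
  moreover have "y = y0 + T z" by (simp add: y0_def z(2)[symmetric])
  ultimately show thesis by (intro that[OF y0C _ z(1)])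
qed

text \<open>Successive approximation along the lower central series. The exponential of
  \<open>ad z\<close> changes \<open>A\<close> by \<open>- T z\<close> to first order, cancelling
  the image part of \<open>y1\<close> modulo \<open>C (Suc j)\<close>; the kernel part is absorbed
  into \<open>y0\<close>.\<close>

lemma conjugate_into_kernel_aux:
  assumes "C (j + n) = {0}" "y0 \<in> N" "T y0 = 0" "y1 \<in> C j"
  shows "\<exists>\<phi> X. lie_automorphism br \<phi> \<and> (\<forall>x\<in>N. \<phi> x \<in> N) \<and> X \<in> N \<and> T X = 0 \<and>
    \<phi> (A + (y0 + y1)) = A + X"
  using assms
proof (induction n arbitrary: j y0 y1)
  case 0
  have "lie_automorphism br (\<lambda>x. x)"
    by (simp add: lie_automorphism_def linear_id[unfolded id_def] bij_id[unfolded id_def])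
  then show ?case using 0 by (intro exI[of _ "\<lambda>x. x"] exI[of _ y0]) auto
next
  case (Suc n)
  obtain y00 z where z: "y00 \<in> C j" "T y00 = 0" "z \<in> C j" "y1 = y00 + T z"
    using C_split[OF Suc.prems(4)] by blast
  have CN: "C i \<subseteq> N" for i by (induction i) (use C_Suc_subset in auto)
  have zN: "z \<in> N" and y1N: "y1 \<in> N" and y00N: "y00 \<in> N" using z CN Suc.prems by auto
  let ?d = "br z"
  have dC: "(?d ^^ Suc m) x \<in> C m" for m x
    by (induction m) (use zN bracket_lower_central_series in
        \<open>auto intro: ideal_N' simp del: lower_central_series.simps(2)\<close>)
  \<comment> \<open>Large enough for nilpotency, and chosen so that the truncated sum consists of
    the orders 0 and 1 and of \<open>j + Suc n\<close> higher terms, which are collected in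
    \<open>r\<close>.\<close>
  define K where "K = Suc (Suc (j + Suc n))"
  have nil: "(?d ^^ K) x = 0" for x
  proof -
    have "(?d ^^ Suc (j + Suc n)) x = 0" using dC[of "j + Suc n" x] Suc.prems(1) by simp
    then show ?thesis by (simp add: K_def bbil)
  qed
  define \<phi> where "\<phi> = truncated_exp K ?d"
  have aut: "lie_automorphism br \<phi>"
    unfolding \<phi>_def
    by (rule lie_automorphism_truncated_exp[OF derivation_ad[OF lie] lie_bilinear[OF lie] nil])
      (simp add: K_def)
  have pN: "divided_power ?d m x \<in> N" if "x \<in> N" for m x
  proof -
    have "(?d ^^ m) x \<in> N" by (induction m) (use that in \<open>auto intro: ideal_N\<close>)
    then show ?thesis unfolding divided_power_def by (rule subspace_scale[OF subspace_N])
  qed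
  have phiN: "\<phi> x \<in> N" if "x \<in> N" for x
    unfolding \<phi>_def truncated_exp_def using pN[OF that] by (intro subspace_sum[OF subspace_N])
  let ?Y = "y0 + y1"
  have YN: "?Y \<in> N" using y1N Suc.prems by (intro subspace_add[OF subspace_N])
  have d1: "?d x \<in> C j" for x
    using ad_C[OF z(3), of x] lie_skew[OF lie, of z x] subspace_neg[OF subspace_C] by simp
  \<comment> \<open>One application of \<open>ad z\<close> lands in \<open>C j\<close> because
    \<open>z\<close> does, and the next descends a level because \<open>z\<close> lies in
    \<open>N\<close>.\<close>
  have d2: "(?d ^^ Suc (Suc m)) x \<in> C (Suc j)" for m x
  proof (induction m)
    case 0 show ?case using bracket_lower_central_series[OF zN d1] by simp
  next
    case (Suc m) then show ?case using ad_C[of _ "Suc j" z] by (simp del: lower_central_series.simps)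
  qed
  define r where "r = (\<Sum>m<j + Suc n. divided_power ?d (Suc (Suc m)) (A + ?Y))"
  have r: "r \<in> C (Suc j)"
    unfolding r_def divided_power_def using d2
    by (intro subspace_sum[OF subspace_C] subspace_scale[OF subspace_C]) blast
  define y1' where "y1' = br z ?Y + r"
  have "br z ?Y \<in> C (Suc j)"
    using bracket_lower_central_series[OF YN z(3)] lie_skew[OF lie, of z ?Y]
      subspace_neg[OF subspace_C, of "br ?Y z" "Suc j"] by simp
  then have y1': "y1' \<in> C (Suc j)" unfolding y1'_def using r by (intro subspace_add[OF subspace_C])
  have "\<phi> (A + ?Y) = (A + ?Y) + br z (A + ?Y) + r"
    unfolding \<phi>_def truncated_exp_def K_def sum.lessThan_Suc_shift r_def
    by (simp add: divided_power_def add.assoc)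
  also have "\<dots> = A + ((y0 + y00) + y1')"
    using lie_skew[OF lie, of z A] by (simp add: y1'_def z(4) bbil algebra_simps)
  finally have phi: "\<phi> (A + ?Y) = A + ((y0 + y00) + y1')" .
  have "C (Suc j + n) = {0}" using Suc.prems(1) by (simp only: add_Suc_right add_Suc)
  moreover have "y0 + y00 \<in> N" using Suc.prems y00N by (intro subspace_add[OF subspace_N])
  moreover have "T (y0 + y00) = 0" using Suc.prems z by (simp add: bbil)
  ultimately obtain \<psi> X where "lie_automorphism br \<psi>" "\<forall>x\<in>N. \<psi> x \<in> N" "X \<in> N" "T X = 0"
    "\<psi> (A + ((y0 + y00) + y1')) = A + X"
    using Suc.IH[OF _ _ _ y1'] by blast
  then show ?case
    using lie_automorphism_compose[OF _ aut, of \<psi>] phiN phi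
    by (intro exI[of _ "\<lambda>x. \<psi> (\<phi> x)"] exI[of _ X]) auto
qed

lemma conjugate_into_kernel:
  assumes "Y \<in> N"
  shows "\<exists>\<phi> X. lie_automorphism br \<phi> \<and> (\<forall>x\<in>N. \<phi> x \<in> N) \<and> X \<in> N \<and> T X = 0 \<and> \<phi> (A + Y) = A + X"
proof -
  obtain K where "C K = {0}" using nilpotent by (auto simp: nilpotent_ideal_def)
  then show ?thesis
    using conjugate_into_kernel_aux[of 0 K 0 Y] assms subspace_0[OF subspace_N] by (simp add: bbil)
qed

end

section \<open>Comparison with an arbitrary metric\<close>

lemma sum_sum_nonneg_eq_0:
  fixes F :: "'i \<Rightarrow> 'i \<Rightarrow> real"
  assumes "finite S" "\<And>i j. i \<in> S \<Longrightarrow> j \<in> S \<Longrightarrow> 0 \<le> F i j" "(\<Sum>i\<in>S. \<Sum>j\<in>S. F i j) = 0"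
    "i \<in> S" "j \<in> S"
  shows "F i j = 0"
proof -
  have "(\<Sum>j\<in>S. F i j) = 0"
    using sum_nonneg_eq_0_iff[of S "\<lambda>i. \<Sum>j\<in>S. F i j"] assms by (simp add: sum_nonneg)
  then show ?thesis using sum_nonneg_eq_0_iff[of S "F i"] assms by simp
qed

lemma sum_sum_sum_nonneg_eq_0:
  fixes F :: "'i \<Rightarrow> 'i \<Rightarrow> 'i \<Rightarrow> real"
  assumes "finite S" "\<And>i j m. i \<in> S \<Longrightarrow> j \<in> S \<Longrightarrow> m \<in> S \<Longrightarrow> 0 \<le> F i j m"
    "(\<Sum>i\<in>S. \<Sum>j\<in>S. \<Sum>m\<in>S. F i j m) = 0" "i \<in> S" "j \<in> S" "m \<in> S"
  shows "F i j m = 0"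
proof -
  have "(\<Sum>m\<in>S. F i j m) = 0"
    using sum_sum_nonneg_eq_0[of S "\<lambda>i j. \<Sum>m\<in>S. F i j m"] assms by (simp add: sum_nonneg)
  then show ?thesis using sum_nonneg_eq_0_iff[of S "F i j"] assms by simp
qed

text \<open>The two flag conditions are the two halves of the statement that \<open>e\<close> and
  \<open>f\<close> span the same filtration. They compare eigenvalues and not indices, since the
  normal has the last index whatever the place of its eigenvalue 0 in the order.\<close>

locale soliton_comparison = codim_one_soliton g k e br N c D + other: codim_one_metric h k f br N
  for g :: "'a::euclidean_space \<Rightarrow> 'a \<Rightarrow> real" and k e br N c D h f +
  fixes l :: "nat \<Rightarrow> real" and a :: real and X :: 'a
  assumes c_neg: "c < 0"
    and eigen: "\<And>i. i \<le> k \<Longrightarrow> D (e i) = l i *\<^sub>R e i"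
    and X: "X \<in> N" "br (e k) X = 0" and a: "a > 0" and f_k: "f k = a *\<^sub>R (e k + X)"
    and f_flag: "\<And>i j. i \<le> k \<Longrightarrow> j \<le> k \<Longrightarrow> g (f j) (e i) \<noteq> 0 \<Longrightarrow> l j \<le> l i"
    and e_flag: "\<And>i j. i \<le> k \<Longrightarrow> j \<le> k \<Longrightarrow> h (e j) (f i) \<noteq> 0 \<Longrightarrow> l j \<le> l i"
begin

lemma l_k: "l k = 0"
proof -
  have "l k *\<^sub>R A = 0" using eigen[of k] D_A by simp
  moreover have "A \<noteq> 0" using A_notin subspace_0[OF subspace_N] by auto
  ultimately show ?thesis by simp
qed

text \<open>\<open>weights x P\<close> says that \<open>x\<close> is a sum of eigenvectors of \<open>D\<close> whose eigenvalues satisfy \<open>P\<close>.\<close>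

definition weights :: "'a \<Rightarrow> (real \<Rightarrow> bool) \<Rightarrow> bool" where
  "weights x P \<longleftrightarrow> (\<forall>i\<le>k. g x (e i) \<noteq> 0 \<longrightarrow> P (l i))"

lemma weights_mono: "weights x P \<Longrightarrow> (\<And>t. P t \<Longrightarrow> Q t) \<Longrightarrow> weights x Q"
  by (auto simp: weights_def)

lemma weights_add: "weights x P \<Longrightarrow> weights y P \<Longrightarrow> weights (x + y) P"
  by (auto simp: weights_def gbil)

lemma weights_diff: "weights x P \<Longrightarrow> weights y P \<Longrightarrow> weights (x - y) P"
  by (auto simp: weights_def gbil)

lemma weights_scale: "(r \<noteq> 0 \<Longrightarrow> weights x P) \<Longrightarrow> weights (r *\<^sub>R x) P"
  by (auto simp: weights_def gbil)

lemma weights_sum: "(\<And>i. i \<in> S \<Longrightarrow> weights (u i) P) \<Longrightarrow> weights (sum u S) P"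
proof (induction S rule: infinite_finite_induct)
  case (insert x S) then show ?case by (simp add: weights_add)
qed (simp_all add: weights_def gbil)

lemma weights_e: "i \<le> k \<Longrightarrow> weights (e i) (\<lambda>t. t = l i)"
  by (auto simp: weights_def orthonormal split: if_splits)

lemma weights_f: "i \<le> k \<Longrightarrow> weights (f i) (\<lambda>t. l i \<le> t)"
  using f_flag by (auto simp: weights_def)

lemma weights_X: "weights X (\<lambda>t. 0 < t)"
proof -
  have "g X (e i) = 0" if "i \<le> k" "l i \<le> 0" for i
    using kernel_perp_nonpos_eigenvector[OF c_neg X eigen] that by blast
  then show ?thesis unfolding weights_def by (meson not_less)
qed

lemma bracket_e_weight:
  assumes "i \<le> k" "j \<le> k" "m \<le> k" "g (br (e i) (e j)) (e m) \<noteq> 0"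
  shows "l m = l i + l j"
proof -
  have "D (br (e i) (e j)) = (l i + l j) *\<^sub>R br (e i) (e j)"
    by (simp add: D_bracket eigen assms bbil algebra_simps)
  then have "(l i + l j) * g (br (e i) (e j)) (e m) = l m * g (br (e i) (e j)) (e m)"
    using D_sym[of "br (e i) (e j)" "e m"] by (simp add: eigen assms gbil)
  then show ?thesis using assms(4) by simp
qed

lemma weights_bracket:
  assumes "weights x P" "weights y Q" and R: "\<And>p q. P p \<Longrightarrow> Q q \<Longrightarrow> R (p + q)"
  shows "weights (br x y) R"
proof -
  have 1: "br (\<Sum>i\<le>k. g x (e i) *\<^sub>R e i) z = (\<Sum>i\<le>k. g x (e i) *\<^sub>R br (e i) z)" for z
    by (simp add: bbil)
  have 2: "br z (\<Sum>j\<le>k. g y (e j) *\<^sub>R e j) = (\<Sum>j\<le>k. g y (e j) *\<^sub>R br z (e j))" for z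
    by (simp add: bbil)
  have "br x y = br (\<Sum>i\<le>k. g x (e i) *\<^sub>R e i) (\<Sum>j\<le>k. g y (e j) *\<^sub>R e j)"
    by (simp only: expansion[symmetric])
  also have "\<dots> = (\<Sum>i\<le>k. g x (e i) *\<^sub>R br (e i) (\<Sum>j\<le>k. g y (e j) *\<^sub>R e j))" by (rule 1)
  also have "\<dots> = (\<Sum>i\<le>k. \<Sum>j\<le>k. (g x (e i) * g y (e j)) *\<^sub>R br (e i) (e j))"
    by (simp only: 2 scaleR_sum_right scaleR_scaleR)
  finally have xy: "br x y = (\<Sum>i\<le>k. \<Sum>j\<le>k. (g x (e i) * g y (e j)) *\<^sub>R br (e i) (e j))" .
  have "weights (br (e i) (e j)) R" if "i \<le> k" "j \<le> k" "g x (e i) * g y (e j) \<noteq> 0" for i j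
  proof -
    have "R (l i + l j)" using that assms by (intro R) (auto simp: weights_def)
    then show ?thesis
      unfolding weights_def using bracket_e_weight[OF that(1,2)] by auto
  qed
  then show ?thesis
    unfolding xy by (intro weights_sum weights_scale) auto
qed

text \<open>The two bases share a filtration, not a grading, so a condition on the eigenvalues in
  \<open>x\<close> survives in the basis \<open>f\<close> only as a lower bound.\<close>

lemma weights_other:
  assumes "weights x P" "i \<le> k" "h x (f i) \<noteq> 0"
  shows "\<exists>p\<le>l i. P p"
proof -
  have "h (\<Sum>j\<le>k. g x (e j) *\<^sub>R e j) (f i) \<noteq> 0"
    using assms(3) unfolding expansion[symmetric] .
  then have "(\<Sum>j\<le>k. g x (e j) * h (e j) (f i)) \<noteq> 0" by (simp add: other.gbil)
  then obtain j where "j \<le> k" "g x (e j) * h (e j) (f i) \<noteq> 0"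
    by (metis (no_types, lifting) atMost_iff sum.neutral)
  then show ?thesis using assms(1) e_flag[OF assms(2), of j] by (auto simp: weights_def)
qed

lemma bracket_f_weight:
  assumes "i \<le> k" "j \<le> k" "m \<le> k" "h (br (f i) (f j)) (f m) \<noteq> 0"
  shows "l i + l j \<le> l m"
proof -
  have "weights (br (f i) (f j)) (\<lambda>t. l i + l j \<le> t)"
    using weights_bracket[OF weights_f[OF assms(1)] weights_f[OF assms(2)]] by (simp add: add_mono)
  then show ?thesis using weights_other[OF _ assms(3,4)] by fastforce
qed

text \<open>\<open>E\<close> differs from \<open>D\<close>, and \<open>ad (f k)\<close> from a
  multiple of \<open>T\<close>, only by parts that strictly raise eigenvalues, and these do not
  contribute to the trace. What remains is a multiple of the trace of
  \<open>T \<circ> D\<close>.\<close>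

lemma weighted_trace_zero: "(\<Sum>m\<le>k. l m * h (br (f k) (f m)) (f m)) = 0"
proof -
  define E where "E x = (\<Sum>m\<le>k. (l m * h x (f m)) *\<^sub>R f m)" for x
  have lE: "linear E"
    by (rule linearI) (simp_all add: E_def other.gbil algebra_simps sum.distrib scaleR_sum_right)
  have Ef: "E (f m) = l m *\<^sub>R f m" if "m \<le> k" for m
  proof -
    have "E (f m) = (\<Sum>i\<le>k. if i = m then l m *\<^sub>R f m else 0)"
      unfolding E_def using that by (intro sum.cong) (auto simp: other.orthonormal)
    then show ?thesis using that by simp
  qed
  have lT': "linear (br (f k))" by (rule linear_ad[OF lie])
  have Ee: "g (br (f k) (E (e j))) (e j) = l j * g (br (f k) (e j)) (e j)" if j: "j \<le> k" for j
  proof -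
    have "e j = (\<Sum>m\<le>k. h (e j) (f m) *\<^sub>R f m)" by (rule other.expansion)
    then have "l j *\<^sub>R e j = (\<Sum>m\<le>k. (l j * h (e j) (f m)) *\<^sub>R f m)"
      by (metis (no_types, lifting) scaleR_scaleR scaleR_sum_right sum.cong)
    then have "E (e j) - l j *\<^sub>R e j = (\<Sum>m\<le>k. ((l m - l j) * h (e j) (f m)) *\<^sub>R f m)"
      by (simp add: E_def sum_subtractf[symmetric] algebra_simps)
    moreover have "weights \<dots> (\<lambda>t. l j < t)"
    proof (intro weights_sum weights_scale)
      fix m assume m: "m \<in> {..k}" "(l m - l j) * h (e j) (f m) \<noteq> 0"
      then have "l j < l m" using e_flag[of m j] j by fastforce
      then show "weights (f m) (\<lambda>t. l j < t)" using m weights_mono[OF weights_f[of m]] by auto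
    qed
    ultimately have "weights (E (e j) - l j *\<^sub>R e j) (\<lambda>t. l j < t)" by simp
    from weights_bracket[OF weights_f[OF order_refl] this]
    have "weights (br (f k) (E (e j) - l j *\<^sub>R e j)) (\<lambda>t. l j < t)" by (simp add: l_k)
    then have "g (br (f k) (E (e j) - l j *\<^sub>R e j)) (e j) = 0" using j by (auto simp: weights_def)
    then show ?thesis by (simp add: bbil gbil)
  qed
  have "(\<Sum>m\<le>k. l m * h (br (f k) (f m)) (f m)) = tr (\<lambda>x. br (f k) (E x))"
    using other.tr_onb[OF lincomp[OF lE lT']] by (simp add: Ef bbil other.gbil)
  also have "\<dots> = (\<Sum>j\<le>k. l j * g (br (f k) (e j)) (e j))"
    using tr_onb[OF lincomp[OF lE lT']] by (simp add: Ee)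
  also have "\<dots> = (\<Sum>j\<le>k. a * g (T (D (e j))) (e j))"
  proof (intro sum.cong refl)
    fix j assume "j \<in> {..k}"
    then have j: "j \<le> k" by simp
    have "weights (br X (e j)) (\<lambda>t. l j < t)"
      by (rule weights_bracket[OF weights_X weights_e[OF j]]) simp
    then have "g (br X (e j)) (e j) = 0" using j by (auto simp: weights_def)
    then show "l j * g (br (f k) (e j)) (e j) = a * g (T (D (e j))) (e j)"
      by (simp add: f_k eigen[OF j] bbil gbil)
  qed
  also have "\<dots> = a * tr (\<lambda>x. T (D x))"
    using tr_onb[OF lincomp[OF linear_D linear_T]] by (simp add: sum_distrib_left)
  finally show ?thesis by (simp add: tr_T_D)
qed

text \<open>The moment pairing for \<open>h\<close> with the operator that multiplies
  \<open>f i\<close> by \<open>l i\<close>. It measures how far eigenvalues fail to add up under the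
  bracket, that is, how far this operator is from being a derivation.\<close>

definition weight_defect :: real where
  "weight_defect = (\<Sum>i\<le>k. \<Sum>j\<le>k. \<Sum>m\<le>k. (l m - l i - l j) * (h (br (f i) (f j)) (f m))\<^sup>2) / 4"

lemma weight_defect_terms:
  "i \<le> k \<Longrightarrow> j \<le> k \<Longrightarrow> m \<le> k \<Longrightarrow> 0 \<le> (l m - l i - l j) * (h (br (f i) (f j)) (f m))\<^sup>2"
  using bracket_f_weight[of i j m] by (cases "h (br (f i) (f j)) (f m) = 0") auto

lemma weight_defect_nonneg: "0 \<le> weight_defect"
  unfolding weight_defect_def by (intro divide_nonneg_pos sum_nonneg weight_defect_terms) auto

lemma weight_defect_eq_0:
  assumes "weight_defect = 0" "i \<le> k" "j \<le> k" "m \<le> k" "h (br (f i) (f j)) (f m) \<noteq> 0"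
  shows "l m = l i + l j"
proof -
  have "(\<Sum>i\<le>k. \<Sum>j\<le>k. \<Sum>m\<le>k. (l m - l i - l j) * (h (br (f i) (f j)) (f m))\<^sup>2) = 0"
    using assms(1) by (simp add: weight_defect_def)
  then have "(l m - l i - l j) * (h (br (f i) (f j)) (f m))\<^sup>2 = 0"
    by (rule sum_sum_sum_nonneg_eq_0[rotated 2]) (use assms(2-4) weight_defect_terms in auto)
  then show ?thesis using assms(5) by simp
qed

lemma weighted_ricci: "(\<Sum>m\<le>k. l m * ricci_tensor br h (f m) (f m)) = weight_defect"
proof -
  have "l m * ricci_tensor br h (f m) (f m) = l m * other.moment (f m) (f m)
      - tr (br (f k)) * (l m * h (br (f k) (f m)) (f m))" if "m \<le> k" for m
    using that other.g_e_A[of m] l_k unfolding other.ricci_tensor_codim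
    by (cases "m = k") (simp_all add: algebra_simps)
  then have "(\<Sum>m\<le>k. l m * ricci_tensor br h (f m) (f m)) = (\<Sum>m\<le>k. l m * other.moment (f m) (f m)
      - tr (br (f k)) * (l m * h (br (f k) (f m)) (f m)))"
    by (intro sum.cong) auto
  also have "\<dots> = weight_defect"
    using other.sum_moment_diagonal[of l] weighted_trace_zero
    by (simp add: weight_defect_def sum_subtractf sum_distrib_left[symmetric])
  finally show ?thesis .
qed

section \<open>The pinching inequality\<close>

lemma ricci_e: "i \<le> k \<Longrightarrow> j \<le> k \<Longrightarrow> ricci_tensor br g (e i) (e j) = (if i = j then c + l i else 0)"
  by (simp add: ricci_tensor_D eigen gbil orthonormal)

lemma ricci_norm_weights:
  "tr (ricci_operator br g \<circ> ricci_operator br g) = (\<Sum>i\<le>k. (c + l i)\<^sup>2)"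
proof -
  have "(\<Sum>j\<le>k. (ricci_tensor br g (e i) (e j))\<^sup>2) = (\<Sum>j\<le>k. if i = j then (c + l i)\<^sup>2 else 0)"
    if "i \<le> k" for i
    using that by (intro sum.cong) (auto simp: ricci_e)
  then show ?thesis unfolding tr_ricci_sq by (intro sum.cong) auto
qed

lemma ricci_norm_pos: "0 < (\<Sum>i\<le>k. (c + l i)\<^sup>2)"
proof -
  have "0 < (c + l k)\<^sup>2" using c_neg by (simp add: l_k)
  also have "\<dots> \<le> (\<Sum>i\<le>k. (c + l i)\<^sup>2)" by (rule member_le_sum) auto
  finally show ?thesis .
qed

text \<open>The coefficient of the orthogonal projection of the Ricci operator of \<open>h\<close>
  to the line spanned by \<open>c + E\<close>; in the case of equality it is the factor of
  proportionality.\<close>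

definition ricci_ratio :: real where
  "ricci_ratio = (c * scalar_curvature br h + weight_defect) / (\<Sum>i\<le>k. (c + l i)\<^sup>2)"

text \<open>Cauchy--Schwarz for the Ricci operator of \<open>h\<close> and the operator with eigenvectors \<open>f i\<close> and
  the eigenvalues of the Ricci operator of \<open>g\<close>, with its defect made explicit.\<close>

lemma ricci_cauchy_schwarz:
  "(\<Sum>i\<le>k. \<Sum>j\<le>k. (ricci_tensor br h (f i) (f j) - (if i = j then ricci_ratio * (c + l i) else 0))\<^sup>2)
    = tr (ricci_operator br h \<circ> ricci_operator br h)
      - (c * scalar_curvature br h + weight_defect)\<^sup>2 / (\<Sum>i\<le>k. (c + l i)\<^sup>2)"
proof -
  let ?r = "\<lambda>i j. ricci_tensor br h (f i) (f j)" and ?S = "\<Sum>i\<le>k. (c + l i)\<^sup>2"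
  let ?P = "c * scalar_curvature br h + weight_defect"
  have P: "(\<Sum>i\<le>k. (c + l i) * ?r i i) = ?P"
    by (simp add: other.scalar_curvature_onb weighted_ricci[symmetric] sum_distrib_left
        sum.distrib[symmetric] distrib_right)
  have "(\<Sum>j\<le>k. (?r i j - (if i = j then ricci_ratio * (c + l i) else 0))\<^sup>2)
      = (\<Sum>j\<le>k. (?r i j)\<^sup>2) - 2 * ricci_ratio * ((c + l i) * ?r i i) + ricci_ratio\<^sup>2 * (c + l i)\<^sup>2"
    if "i \<le> k" for i
  proof -
    have "(\<Sum>j\<le>k. (?r i j - (if i = j then ricci_ratio * (c + l i) else 0))\<^sup>2)
      = (\<Sum>j\<le>k. (?r i j)\<^sup>2 + (if i = j then
          ricci_ratio\<^sup>2 * (c + l i)\<^sup>2 - 2 * ricci_ratio * ((c + l i) * ?r i i) else 0))"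
      by (intro sum.cong refl) (auto simp: power2_eq_square algebra_simps)
    then show ?thesis using that by (simp add: sum.distrib)
  qed
  then have "(\<Sum>i\<le>k. \<Sum>j\<le>k. (?r i j - (if i = j then ricci_ratio * (c + l i) else 0))\<^sup>2)
    = (\<Sum>i\<le>k. (\<Sum>j\<le>k. (?r i j)\<^sup>2) - 2 * ricci_ratio * ((c + l i) * ?r i i) + ricci_ratio\<^sup>2 * (c + l i)\<^sup>2)"
    by (intro sum.cong) auto
  also have "\<dots> = tr (ricci_operator br h \<circ> ricci_operator br h) - 2 * ricci_ratio * ?P + ricci_ratio\<^sup>2 * ?S"
    by (simp add: sum.distrib sum_subtractf sum_distrib_left[symmetric] P other.tr_ricci_sq)
  also have "\<dots> = tr (ricci_operator br h \<circ> ricci_operator br h) - ?P\<^sup>2 / ?S"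
    using ricci_norm_pos by (simp add: ricci_ratio_def power2_eq_square field_simps)
  finally show ?thesis .
qed

lemma c_scal_nonneg: "0 \<le> c * scalar_curvature br h"
  using c_neg other.scalar_curvature_nonpos by (simp add: mult_nonpos_nonpos)

lemma pinching_value: "ricci_pinching br g = (\<Sum>i\<le>k. (c + l i)\<^sup>2) / c\<^sup>2"
proof -
  have "scalar_curvature br g = (\<Sum>i\<le>k. (c + l i)\<^sup>2) / c"
    using ricci_norm ricci_norm_weights c_neg by (simp add: field_simps)
  then show ?thesis
    using ricci_norm_pos c_neg
    by (simp add: ricci_pinching_def ricci_norm_weights power2_eq_square field_simps)
qed

lemma ricci_norm_lower:
  "(c * scalar_curvature br h)\<^sup>2 \<le> (\<Sum>i\<le>k. (c + l i)\<^sup>2) * tr (ricci_operator br h \<circ> ricci_operator br h)"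
proof -
  let ?S = "\<Sum>i\<le>k. (c + l i)\<^sup>2" and ?P = "c * scalar_curvature br h + weight_defect"
  have "0 \<le> tr (ricci_operator br h \<circ> ricci_operator br h) - ?P\<^sup>2 / ?S"
    unfolding ricci_cauchy_schwarz[symmetric] by (intro sum_nonneg) auto
  then have "?P\<^sup>2 \<le> ?S * tr (ricci_operator br h \<circ> ricci_operator br h)"
    using ricci_norm_pos by (simp add: field_simps)
  moreover have "(c * scalar_curvature br h)\<^sup>2 \<le> ?P\<^sup>2"
    using c_scal_nonneg weight_defect_nonneg by (intro power_mono) auto
  ultimately show ?thesis by linarith
qed

lemma pinching_le: "ricci_pinching br h \<le> ricci_pinching br g"
proof -
  let ?S = "\<Sum>i\<le>k. (c + l i)\<^sup>2" and ?Q = "tr (ricci_operator br h \<circ> ricci_operator br h)"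
  have Q: "?Q \<ge> 0" unfolding other.tr_ricci_sq by (intro sum_nonneg) auto
  show ?thesis
  proof (cases "?Q = 0")
    \<comment> \<open>Here the quotient defining the pinching of \<open>h\<close> has denominator
      zero and hence the value 0.\<close>
    case True
    then show ?thesis
      unfolding pinching_value unfolding ricci_pinching_def using ricci_norm_pos by simp
  next
    case False
    then have "?Q > 0" using Q by simp
    then show ?thesis
      unfolding pinching_value unfolding ricci_pinching_def
      using ricci_norm_lower c_neg by (simp add: divide_le_eq power_mult_distrib) (simp add: field_simps)
  qed
qed

section \<open>The case of equality and the regrading automorphism\<close>

context
  assumes max: "ricci_pinching br g \<le> ricci_pinching br h"
begin

text \<open>In \<open>le2\<close> the left side is nonnegative and the right side nonpositive, so
  both vanish. Strict positivity of \<open>c scal\<close> for \<open>h\<close>, forced by its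
  positive pinching, then makes the defect zero, and the vanishing Cauchy--Schwarz remainder
  diagonalises the Ricci operator in the basis \<open>f\<close>.\<close>

lemma pinching_equality: "weight_defect = 0" "ricci_ratio > 0"
    "\<And>i. i \<le> k \<Longrightarrow> ricci_operator br h (f i) = (ricci_ratio * (c + l i)) *\<^sub>R f i"
proof -
  let ?S = "\<Sum>i\<le>k. (c + l i)\<^sup>2" and ?Q = "tr (ricci_operator br h \<circ> ricci_operator br h)"
  let ?s = "c * scalar_curvature br h"
  note S = ricci_norm_pos
  have Q: "?Q \<ge> 0" unfolding other.tr_ricci_sq by (intro sum_nonneg) auto
  have F: "?S / c\<^sup>2 \<le> (scalar_curvature br h)\<^sup>2 / ?Q"
    using max unfolding pinching_value unfolding ricci_pinching_def .
  have "?S / c\<^sup>2 > 0" using S c_neg by simp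
  then have "?Q \<noteq> 0" and s0: "scalar_curvature br h \<noteq> 0" using F by auto
  then have Qp: "?Q > 0" using Q by simp
  then have le: "?S * ?Q \<le> ?s\<^sup>2" using F c_neg by (simp add: field_simps power_mult_distrib)
  have sp: "?s > 0" using c_scal_nonneg s0 c_neg by (simp add: less_le)
  let ?Z = "\<Sum>i\<le>k. \<Sum>j\<le>k. (ricci_tensor br h (f i) (f j) - (if i = j then ricci_ratio * (c + l i) else 0))\<^sup>2"
  have Z0: "?Z \<ge> 0" by (intro sum_nonneg) auto
  have "?S * ?Z = ?S * ?Q - (?s + weight_defect)\<^sup>2"
    unfolding ricci_cauchy_schwarz using S by (simp add: right_diff_distrib)
  also have "\<dots> \<le> ?s\<^sup>2 - (?s + weight_defect)\<^sup>2" using le by simp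
  also have "\<dots> = - weight_defect * (2 * ?s + weight_defect)"
    by (simp add: power2_eq_square algebra_simps)
  finally have le2: "?S * ?Z \<le> - weight_defect * (2 * ?s + weight_defect)" .
  moreover have "0 \<le> ?S * ?Z" using S Z0 by simp
  moreover have "0 \<le> weight_defect * (2 * ?s + weight_defect)"
    using weight_defect_nonneg sp by simp
  ultimately have "weight_defect * (2 * ?s + weight_defect) = 0" "?S * ?Z = 0" by linarith+
  then show w0: "weight_defect = 0" and "ricci_ratio > 0"
    using sp weight_defect_nonneg S by (auto simp: ricci_ratio_def)
  have "?Z = 0" using \<open>?S * ?Z = 0\<close> S by simp
  then have r: "ricci_tensor br h (f i) (f j) = (if i = j then ricci_ratio * (c + l i) else 0)"
    if "i \<le> k" "j \<le> k" for i j
    using sum_sum_nonneg_eq_0[OF _ _ \<open>?Z = 0\<close>, of i j] that by simp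
  fix i assume i: "i \<le> k"
  show "ricci_operator br h (f i) = (ricci_ratio * (c + l i)) *\<^sub>R f i"
    by (rule other.coordinates_eqI) (simp add: other.ricci r i other.gbil other.orthonormal)
qed

text \<open>The projection to the eigenspace of \<open>E\<close> for \<open>r\<close>, zero if
  \<open>r\<close> is not an eigenvalue.\<close>

definition weight_part :: "real \<Rightarrow> 'a \<Rightarrow> 'a" where
  "weight_part r x = (\<Sum>m\<le>k. (if l m = r then h x (f m) else 0) *\<^sub>R f m)"

text \<open>The isomorphism between two gradings of the same filtration that is the identity on the
  associated graded space.\<close>

definition regrade :: "'a \<Rightarrow> 'a" where
  "regrade x = (\<Sum>j\<le>k. g x (e j) *\<^sub>R weight_part (l j) (e j))"

lemma linear_weight_part: "linear (weight_part r)"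
  by (rule linearI)
    (auto simp: weight_part_def other.gbil sum.distrib[symmetric] scaleR_sum_right algebra_simps
      intro!: sum.cong)

lemma linear_regrade: "linear regrade"
  by (rule linearI) (simp_all add: regrade_def gbil sum.distrib scaleR_add_left scaleR_sum_right)

lemma h_weight_part: "m \<le> k \<Longrightarrow> h (weight_part r x) (f m) = (if l m = r then h x (f m) else 0)"
proof -
  assume m: "m \<le> k"
  have "h (weight_part r x) (f m) = (\<Sum>i\<le>k. if i = m then (if l m = r then h x (f m) else 0) else 0)"
    unfolding weight_part_def other.gbil using m by (intro sum.cong) (auto simp: other.orthonormal)
  then show ?thesis using m by simp
qed

lemma regrade_homogeneous:
  assumes "weights x (\<lambda>t. t = r)" shows "regrade x = weight_part r x"
proof -
  have "regrade x = (\<Sum>j\<le>k. g x (e j) *\<^sub>R weight_part r (e j))"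
    unfolding regrade_def using assms by (intro sum.cong refl) (auto simp: weights_def)
  also have "\<dots> = weight_part r (\<Sum>j\<le>k. g x (e j) *\<^sub>R e j)"
    by (rule linear_family_sum[OF linear_weight_part, symmetric])
  finally show ?thesis by (simp only: expansion[symmetric])
qed

lemma weight_part_higher: "weights x (\<lambda>t. r < t) \<Longrightarrow> weight_part r x = 0"
  by (rule other.coordinates_eqI) (use weights_other in \<open>force simp: h_weight_part other.gbil\<close>)

lemma weights_weight_part_diff:
  assumes "weights x (\<lambda>t. r \<le> t)" shows "weights (x - weight_part r x) (\<lambda>t. r < t)"
proof -
  let ?y = "x - weight_part r x"
  have "weights (\<Sum>m\<le>k. h ?y (f m) *\<^sub>R f m) (\<lambda>t. r < t)"
  proof (intro weights_sum weights_scale)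
    fix m assume m: "m \<in> {..k}" "h ?y (f m) \<noteq> 0"
    then have "l m \<noteq> r" "h x (f m) \<noteq> 0" by (auto simp: other.gbil h_weight_part split: if_splits)
    then have "r < l m" using weights_other[OF assms, of m] m by force
    then show "weights (f m) (\<lambda>t. r < t)" using m weights_mono[OF weights_f[of m]] by auto
  qed
  then show ?thesis by (simp only: other.expansion[symmetric])
qed

lemma weight_part_fixed:
  "(\<And>m. m \<le> k \<Longrightarrow> h y (f m) \<noteq> 0 \<Longrightarrow> l m = r) \<Longrightarrow> weight_part r y = y"
  by (rule other.coordinates_eqI) (auto simp: h_weight_part)

lemma h_bracket_weight_part:
  assumes m: "m \<le> k" and nz: "h (br (weight_part r x) (weight_part s y)) (f m) \<noteq> 0"
  shows "l m = r + s"
proof (rule ccontr)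
  assume ne: "l m \<noteq> r + s"
  have z: "(if l j = s then v else 0) * ((if l i = r then u else 0) * h (br (f i) (f j)) (f m)) = 0"
    if "i \<le> k" "j \<le> k" for i j u v
    using weight_defect_eq_0[OF pinching_equality(1) that m] ne by auto
  have "h (br (weight_part r x) (weight_part s y)) (f m) = 0"
    by (simp add: weight_part_def bbil other.gbil sum_distrib_left)
      (intro sum.neutral ballI z; simp)
  then show False using nz by simp
qed

lemma regrade_e: "j \<le> k \<Longrightarrow> regrade (e j) = weight_part (l j) (e j)"
  by (rule regrade_homogeneous[OF weights_e])

lemma regrade_e_diff: "j \<le> k \<Longrightarrow> weights (e j - regrade (e j)) (\<lambda>t. l j < t)"
  unfolding regrade_e by (rule weights_weight_part_diff[OF weights_mono[OF weights_e]]) auto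

text \<open>The bracket of \<open>e i\<close> and \<open>e j\<close> differs from that of their
  images by higher eigenvalues, so both have the same part of weight \<open>l i + l j\<close>. The
  first is homogeneous for \<open>D\<close> and is mapped to this part; the second equals it, since
  without defect the brackets respect the grading by \<open>E\<close>.\<close>

lemma regrade_bracket: "regrade (br x y) = br (regrade x) (regrade y)"
proof -
  have basis: "regrade (br (e i) (e j)) = br (regrade (e i)) (regrade (e j))" if i: "i \<le> k" and j: "j \<le> k" for i j
  proof -
    let ?r = "l i + l j"
    let ?u = "regrade (e i)" and ?v = "regrade (e j)"
    have we: "weights (br (e i) (e j)) (\<lambda>t. t = ?r)"
      by (rule weights_bracket[OF weights_e[OF i] weights_e[OF j]]) simp
    have "weights (e j - (e j - ?v)) (\<lambda>t. l j \<le> t)"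
      by (rule weights_diff[OF weights_mono[OF weights_e[OF j]] weights_mono[OF regrade_e_diff[OF j]]]) auto
    then have v: "weights ?v (\<lambda>t. l j \<le> t)" by simp
    have d: "br (e i) (e j) - br ?u ?v = br (e i - ?u) ?v + br (e i) (e j - ?v)"
      by (simp add: bbil)
    have "weights (br (e i) (e j) - br ?u ?v) (\<lambda>t. ?r < t)"
      unfolding d
      by (intro weights_add weights_bracket[OF regrade_e_diff[OF i] v]
          weights_bracket[OF weights_e[OF i] regrade_e_diff[OF j]]) auto
    then have "weight_part ?r (br (e i) (e j) - br ?u ?v) = 0" by (rule weight_part_higher)
    then have "weight_part ?r (br (e i) (e j)) = weight_part ?r (br ?u ?v)"
      by (simp add: linear_diff[OF linear_weight_part])
    also have "\<dots> = br ?u ?v"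
      unfolding regrade_e[OF i] regrade_e[OF j] by (rule weight_part_fixed[OF h_bracket_weight_part])
    finally show ?thesis by (simp add: regrade_homogeneous[OF we])
  qed
  show ?thesis
    by (rule bilinear_eq_onb[of "\<lambda>x y. regrade (br x y)" "\<lambda>x y. br (regrade x) (regrade y)"])
      (auto simp: basis bilinear_def bbil linear_add[OF linear_regrade] linear_scale[OF linear_regrade]
        intro!: linearI)
qed

lemma lie_automorphism_regrade: "lie_automorphism br regrade"
proof -
  have "x = 0" if x: "regrade x = 0" for x
  proof (rule ccontr)
    assume "x \<noteq> 0"
    define J where "J = {j. j \<le> k \<and> g x (e j) \<noteq> 0}"
    have fin: "finite J" unfolding J_def by simp
    have "J \<noteq> {}"
    proof
      assume "J = {}"
      then have "x = 0" by (intro coordinates_eqI) (auto simp: J_def gbil)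
      then show False using \<open>x \<noteq> 0\<close> by simp
    qed
    \<comment> \<open>A coordinate of least eigenvalue cannot be cancelled, because
      \<open>regrade\<close> differs from the identity by terms that raise the eigenvalue.\<close>
    from ex_min_if_finite[of "l ` J"] obtain j where j: "j \<in> J" "\<And>i. i \<in> J \<Longrightarrow> l j \<le> l i"
      using fin \<open>J \<noteq> {}\<close> by (metis (no_types, lifting) finite_imageI image_iff image_is_empty not_less)
    have jk: "j \<le> k" using j by (simp add: J_def)
    have "g (regrade (e i)) (e j) = g (e i) (e j)" if "i \<in> J" for i
    proof -
      have "i \<le> k" "l j \<le> l i" using that j by (auto simp: J_def)
      then have "g (e i - regrade (e i)) (e j) = 0"
        using regrade_e_diff[of i] jk by (auto simp: weights_def)
      then show ?thesis by (simp add: gbil)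
    qed
    then have t: "g x (e i) * g (regrade (e i)) (e j) = g x (e i) * g (e i) (e j)" if "i \<le> k" for i
      using that by (cases "i \<in> J") (auto simp: J_def)
    have "regrade x = (\<Sum>i\<le>k. g x (e i) *\<^sub>R regrade (e i))"
      unfolding regrade_def[of x] by (intro sum.cong) (auto simp: regrade_e)
    then have "g (regrade x) (e j) = (\<Sum>i\<le>k. g x (e i) * g (regrade (e i)) (e j))" by (simp add: gbil)
    also have "\<dots> = (\<Sum>i\<le>k. g x (e i) * g (e i) (e j))" by (intro sum.cong) (auto simp: t)
    also have "\<dots> = g x (e j)" by (simp add: parseval[of x "e j"] gsym[of "e j"])
    finally show False using x j by (simp add: J_def gbil)
  qed
  then have "inj regrade" using linear_injective_0[OF linear_regrade] by blast
  then have "bij regrade"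
    using linear_injective_imp_surjective[OF linear_regrade] by (simp add: bij_def)
  then show ?thesis using linear_regrade regrade_bracket by (simp add: lie_automorphism_def)
qed

text \<open>\<open>regrade\<close> takes eigenspaces of \<open>D\<close> into those of
  \<open>E\<close>, and on the latter the Ricci operator of \<open>h\<close> is
  \<open>ricci_ratio\<close> times \<open>c + E\<close>.\<close>

lemma ricci_regrade: "ricci_operator br h (regrade x) = ricci_ratio *\<^sub>R regrade (c *\<^sub>R x + D x)"
proof (rule linear_eq_onb[of "\<lambda>x. ricci_operator br h (regrade x)" "\<lambda>x. ricci_ratio *\<^sub>R regrade (c *\<^sub>R x + D x)"])
  fix j assume "j \<in> {..k}"
  then have j: "j \<le> k" by simp
  have "ricci_operator br h (regrade (e j)) = (ricci_ratio * (c + l j)) *\<^sub>R regrade (e j)"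
    unfolding regrade_e[OF j] weight_part_def linear_family_sum[OF other.linear_ricci] scaleR_sum_right
    by (intro sum.cong refl) (simp add: pinching_equality(3))
  then show "ricci_operator br h (regrade (e j)) = ricci_ratio *\<^sub>R regrade (c *\<^sub>R e j + D (e j))"
    by (simp add: eigen[OF j] linear_add[OF linear_regrade] linear_scale[OF linear_regrade] algebra_simps)
qed (auto intro!: linearI simp: linear_add[OF linear_regrade] linear_scale[OF linear_regrade]
    linear_add[OF other.linear_ricci] linear_scale[OF other.linear_ricci]
    linear_add[OF linear_D] linear_scale[OF linear_D] algebra_simps)

lemma regrade_A: "regrade A = (1 / a) *\<^sub>R f k"
proof -
  have A: "A = (1 / a) *\<^sub>R f k - X" using a by (simp add: f_k)
  have "weight_part 0 (f k) = f k"
    by (rule weight_part_fixed) (auto simp: other.orthonormal l_k split: if_splits)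
  then have "weight_part 0 A = (1 / a) *\<^sub>R f k"
    using weight_part_higher[OF weights_X]
    by (subst A) (simp add: linear_diff[OF linear_weight_part] linear_scale[OF linear_weight_part])
  then show ?thesis using regrade_e[of k] by (simp add: l_k)
qed

lemma regrade_N: "y \<in> N \<Longrightarrow> h (regrade y) (f k) = 0"
proof -
  assume y: "y \<in> N"
  have "g y (e j) * h (weight_part (l j) (e j)) (f k) = 0" if "j \<le> k" for j
    using that A_perp[OF y] other.A_perp[OF e_N, of j] by (cases "j = k") (simp_all add: h_weight_part)
  then have "(\<Sum>j\<le>k. g y (e j) * h (weight_part (l j) (e j)) (f k)) = 0"
    by (intro sum.neutral) simp
  then show ?thesis by (simp add: regrade_def other.gbil)
qed

text \<open>Multiplying a metric by \<open>t\<close> divides its Ricci operator by \<open>t\<close>,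
  so \<open>t = ricci_ratio\<close> gives the Ricci operator of \<open>g\<close> itself.
  Orthogonality of \<open>A\<close> to \<open>N\<close> is recorded because the uniqueness argument
  requires a common normal.\<close>

lemma exists_isometric_soliton:
  "\<exists>t u. t > 0 \<and> lie_automorphism br u \<and>
    (\<forall>x. ricci_operator br (\<lambda>x y. t * h (u x) (u y)) x = c *\<^sub>R x + D x) \<and>
    (\<forall>y\<in>N. t * h (u y) (u A) = 0)"
proof (intro exI conjI allI ballI)
  show t: "ricci_ratio > 0" by (rule pinching_equality)
  show aut: "lie_automorphism br regrade" by (rule lie_automorphism_regrade)
  interpret E: equivalent_metrics br h "\<lambda>x y. ricci_ratio * h (regrade x) (regrade y)" ricci_ratio regrade
    by unfold_locales (use lie other.metric t aut in auto)
  show "ricci_operator br (\<lambda>x y. ricci_ratio * h (regrade x) (regrade y)) x = c *\<^sub>R x + D x" for x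
    using t by (simp add: E.ricci_operator_conjugate ricci_regrade linear_scale[OF E.lin_inv] E.left_inv)
  show "ricci_ratio * h (regrade y) (regrade A) = 0" if "y \<in> N" for y
    using regrade_N[OF that] by (simp add: regrade_A other.gbil)
qed

end

end

section \<open>Uniqueness\<close>

lemma ln_mult_square_minus_1:
  fixes t :: real
  assumes "t > 0"
  shows "0 \<le> ln t * (t\<^sup>2 - 1)" and "ln t * (t\<^sup>2 - 1) = 0 \<Longrightarrow> t = 1"
proof -
  show "0 \<le> ln t * (t\<^sup>2 - 1)"
  proof (cases "t \<ge> 1")
    case True then show ?thesis by (simp add: one_le_power)
  next
    case False
    then have "ln t \<le> 0" "t\<^sup>2 \<le> 1" using assms by (auto simp: power_le_one)
    then show ?thesis by (simp add: mult_nonpos_nonpos)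
  qed
  show "t = 1" if "ln t * (t\<^sup>2 - 1) = 0"
    using that assms by (auto simp: power2_eq_1_iff)
qed

text \<open>The two sums are the values at 0 and 1 of the derivative of the convex function
  \<open>x \<mapsto> \<Sum>s\<in>S. (r s powr x * c s)\<^sup>2 / 2\<close>, which is therefore affine on \<open>[0, 1]\<close>.\<close>

lemma rigidity:
  fixes c r :: "'s \<Rightarrow> real"
  assumes "finite S" "\<And>s. s \<in> S \<Longrightarrow> r s > 0"
    and "(\<Sum>s\<in>S. ln (r s) * (c s)\<^sup>2) = (\<Sum>s\<in>S. ln (r s) * (r s * c s)\<^sup>2)"
    and "s \<in> S" "c s \<noteq> 0"
  shows "r s = 1"
proof -
  have "(\<Sum>s\<in>S. (c s)\<^sup>2 * (ln (r s) * ((r s)\<^sup>2 - 1))) = 0"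
    using assms(3) by (simp add: algebra_simps power_mult_distrib sum_subtractf)
  then have "(c s)\<^sup>2 * (ln (r s) * ((r s)\<^sup>2 - 1)) = 0"
    by (rule sum_nonneg_eq_0_iff[THEN iffD1, rule_format, rotated 2])
      (use assms in \<open>auto intro!: mult_nonneg_nonneg ln_mult_square_minus_1(1)\<close>)
  then show ?thesis using ln_mult_square_minus_1(2)[OF assms(2)[OF assms(4)]] assms(5) by simp
qed

context codim_one_soliton
begin

lemma T_row_column: "i \<le> k \<Longrightarrow> (\<Sum>j\<le>k. (g (T (e i)) (e j))\<^sup>2) = (\<Sum>j\<le>k. (g (T (e j)) (e i))\<^sup>2)"
proof -
  have "(\<Sum>j\<le>k. (g (T (e i)) (e j))\<^sup>2) = g (T (e i)) (T (e i))"
    by (subst parseval) (simp add: power2_eq_square)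
  also have "\<dots> = g (adj T (e i)) (adj T (e i))"
    using T_normal[of "e i"] adj_left[OF linear_T, of "T (e i)" "e i"] adj_left[OF linear_T, of "e i" "adj T (e i)"]
    by (simp add: gsym[of "e i"])
  also have "\<dots> = (\<Sum>j\<le>k. (g (T (e j)) (e i))\<^sup>2)"
    by (subst parseval) (simp add: power2_eq_square adj_left[OF linear_T] gsym[of "e i"])
  finally show ?thesis .
qed

text \<open>Up to a factor this is the derivative of the squared norm of \<open>T\<close> under
  conjugation by the exponential of a diagonal matrix. It vanishes because a normal matrix has rows
  and columns of equal norm.\<close>

lemma T_weight_balance: "(\<Sum>i\<le>k. \<Sum>j\<le>k. (p j - p i) * (g (T (e i)) (e j))\<^sup>2) = 0"
proof -
  have "(\<Sum>i\<le>k. \<Sum>j\<le>k. p j * (g (T (e i)) (e j))\<^sup>2) = (\<Sum>j\<le>k. p j * (\<Sum>i\<le>k. (g (T (e i)) (e j))\<^sup>2))"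
    by (subst sum.swap) (simp add: sum_distrib_left)
  also have "\<dots> = (\<Sum>i\<le>k. \<Sum>j\<le>k. p i * (g (T (e i)) (e j))\<^sup>2)"
    by (intro sum.cong refl) (simp add: T_row_column[symmetric] sum_distrib_left)
  finally show ?thesis by (simp add: left_diff_distrib sum_subtractf)
qed

lemma moment_soliton:
  "moment x x = c * g x x + g (D x) x + (g x A)\<^sup>2 * killing br A A / 2 + tr T * g (T x) x"
  using ricci_tensor_codim[of x x] by (simp add: ricci_tensor_D power2_eq_square)

text \<open>Rigidity is used twice: for the matrix of \<open>T\<close>, which is normal for both metrics, to see that
  \<open>\<theta> k = 1\<close>, and then for the structure constants.\<close>

lemma soliton_unique_diagonal:
  fixes \<theta> :: "nat \<Rightarrow> real"
  assumes c: "c < 0" and g2: "left_invariant_metric g2"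
    and Ric2: "\<And>x. ricci_operator br g2 x = c *\<^sub>R x + D x"
    and \<theta>: "\<And>i. i \<le> k \<Longrightarrow> \<theta> i > 0"
    and diag: "\<And>i y. i \<le> k \<Longrightarrow> g2 y (e i) = (\<theta> i)\<^sup>2 * g y (e i)"
  shows "\<exists>\<psi>. lie_automorphism br \<psi> \<and> (\<forall>x y. g2 x y = g (\<psi> x) (\<psi> y))"
proof -
  note bg2 = bilin[OF metric_bilinear[OF g2]]
  define w where "w i = (1 / \<theta> i) *\<^sub>R e i" for i
  have g2w: "g2 y (w i) = \<theta> i * g y (e i)" if "i \<le> k" for i y
    using \<theta>[OF that] by (simp add: w_def bg2 diag[OF that] power2_eq_square)
  have gw: "\<theta> i *\<^sub>R w i = e i" if "i \<le> k" for i using \<theta>[OF that] by (simp add: w_def)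
  interpret S2: codim_one_soliton g2 k w br N c D
  proof unfold_locales
    fix i j assume "i \<in> {..k}" "j \<in> {..k}"
    then show "g2 (w i) (w j) = (if i = j then 1 else 0)"
      using \<theta>[of j] g2w[of j "w i"] by (simp add: w_def gbil orthonormal)
  next
    fix x
    have "(\<Sum>i\<le>k. g2 x (w i) *\<^sub>R w i) = (\<Sum>i\<le>k. g x (e i) *\<^sub>R (\<theta> i *\<^sub>R w i))"
      by (intro sum.cong refl) (simp add: g2w mult.commute)
    also have "\<dots> = (\<Sum>i\<le>k. g x (e i) *\<^sub>R e i)" by (intro sum.cong refl) (simp add: gw)
    finally show "x = (\<Sum>i\<in>{..k}. g2 x (w i) *\<^sub>R w i)" by (simp only: expansion[symmetric])
  next
    show "w i \<in> N" if "i < k" for i unfolding w_def using e_N[OF that] by (rule subspace_scale[OF subspace_N])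
    show "g2 x (w k) = 0" if "x \<in> N" for x using A_perp[OF that] by (simp add: g2w)
  qed (use g2 lie nilpotent D Ric2 not_nilpotent in auto)
  define p where "p i = ln (\<theta> i)" for i
  have T2: "g2 (br (w i) (w j)) (w m) = \<theta> m / (\<theta> i * \<theta> j) * g (br (e i) (e j)) (e m)"
    if "m \<le> k" for i j m
    by (simp add: g2w[OF that]) (simp add: w_def bbil gbil)
  have ln1: "ln (\<theta> j / \<theta> i) = p j - p i" if "i \<le> k" "j \<le> k" for i j
    using \<theta>[OF that(1)] \<theta>[OF that(2)] by (simp add: p_def ln_div)
  have eq\<theta>: "\<theta> i = \<theta> j" if ij: "i \<le> k" "j \<le> k" "g (T (e i)) (e j) \<noteq> 0" for i j
  proof -
    let ?S = "{..k} \<times> {..k}"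
    let ?t = "\<lambda>(i, j). g (T (e i)) (e j)" and ?r = "\<lambda>(i, j). \<theta> j / \<theta> i"
    have "(\<Sum>s\<in>?S. ln (?r s) * (?t s)\<^sup>2) = (\<Sum>i\<le>k. \<Sum>j\<le>k. (p j - p i) * (g (T (e i)) (e j))\<^sup>2)"
      unfolding sum.cartesian_product by (intro sum.cong refl) (auto simp: ln1)
    then have 1: "(\<Sum>s\<in>?S. ln (?r s) * (?t s)\<^sup>2) = 0"
      by (simp only: T_weight_balance)
    \<comment> \<open>In the basis \<open>w\<close> the matrix of \<open>br (w k)\<close> is that of
      \<open>T\<close> multiplied entrywise by \<open>?r\<close> and divided by
      \<open>\<theta> k\<close>, which explains the factor.\<close>
    have "(\<Sum>s\<in>?S. ln (?r s) * (?r s * ?t s)\<^sup>2) =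
      (\<theta> k)\<^sup>2 * (\<Sum>i\<le>k. \<Sum>j\<le>k. (p j - p i) * (g2 (br (w k) (w i)) (w j))\<^sup>2)"
      unfolding sum.cartesian_product sum_distrib_left
      using \<theta>[of k] by (intro sum.cong refl) (auto simp: T2 ln1 power_mult_distrib power_divide)
    also have "\<dots> = 0" using S2.T_weight_balance[of p] by simp
    finally have "(\<Sum>s\<in>?S. ln (?r s) * (?t s)\<^sup>2) = (\<Sum>s\<in>?S. ln (?r s) * (?r s * ?t s)\<^sup>2)"
      using 1 by simp
    then have "?r (i, j) = 1"
      by (rule rigidity[rotated 2]) (use ij \<theta> in auto)
    then show ?thesis using \<theta>[OF ij(1)] by simp
  qed
  have tau2: "g2 (br (w k) (w i)) (w j) = g (T (e i)) (e j) / \<theta> k" if "i \<le> k" "j \<le> k" for i j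
    using eq\<theta>[OF that] \<theta>[OF that(1)] by (cases "g (T (e i)) (e j) = 0") (simp_all add: T2 that)
  \<comment> \<open>Rescaling the basis of \<open>N\<close> does not change the entries of
    \<open>T\<close>, as these vanish unless the two factors agree; only the length of the normal
    remains. Both norms equal \<open>- c\<close>, which is nonzero.\<close>
  have "S2.sym_norm = sym_norm / (\<theta> k)\<^sup>2"
    unfolding S2.sym_norm_def sym_norm_def
    by (simp add: tau2 add_divide_distrib[symmetric] power_divide sum_divide_distrib[symmetric])
  then have "(\<theta> k)\<^sup>2 = 1"
    using c c_eq S2.c_eq \<theta>[of k] by (simp add: field_simps)
  then have \<theta>k: "\<theta> k = 1" using \<theta>[of k] by (simp add: power2_eq_1_iff)
  then have wk: "w k = e k" by (simp add: w_def)
  \<comment> \<open>For solitons the diagonal of the moment map is expressed by \<open>c\<close>,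
    \<open>D\<close>, \<open>T\<close> and the Killing form, and these data agree now that the
    normals do. The sums over structure constants at the two ends are therefore equal.\<close>
  have "(\<Sum>m\<le>k. p m * moment (e m) (e m)) = (\<Sum>m\<le>k. p m * S2.moment (w m) (w m))"
  proof (intro sum.cong refl)
    fix m assume "m \<in> {..k}"
    then have m: "m \<le> k" by simp
    have gg: "g2 (f (w m)) (w m) = g (f (e m)) (e m)" if "linear f" for f
      unfolding g2w[OF m] using \<theta>[OF m] by (simp add: w_def linear_scale[OF that] gbil)
    have "g (e m) A = g2 (w m) (w k)" using m by (simp add: orthonormal S2.orthonormal)
    then show "p m * moment (e m) (e m) = p m * S2.moment (w m) (w m)"
      unfolding moment_soliton S2.moment_soliton
      using gg[OF linear_D] gg[OF linear_T] m by (simp add: wk orthonormal S2.orthonormal)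
  qed
  then have tot: "(\<Sum>i\<le>k. \<Sum>j\<le>k. \<Sum>m\<le>k. (p m - p i - p j) * (g (br (e i) (e j)) (e m))\<^sup>2)
      = (\<Sum>i\<le>k. \<Sum>j\<le>k. \<Sum>m\<le>k. (p m - p i - p j) * (g2 (br (w i) (w j)) (w m))\<^sup>2)"
    unfolding sum_moment_diagonal S2.sum_moment_diagonal by simp
  have mult: "\<theta> m = \<theta> i * \<theta> j" if ijm: "i \<le> k" "j \<le> k" "m \<le> k" "g (br (e i) (e j)) (e m) \<noteq> 0" for i j m
  proof -
    let ?S = "{..k} \<times> {..k} \<times> {..k}"
    let ?t = "\<lambda>(i, j, m). g (br (e i) (e j)) (e m)" and ?r = "\<lambda>(i, j, m). \<theta> m / (\<theta> i * \<theta> j)"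
    have ln2: "ln (\<theta> m / (\<theta> i * \<theta> j)) = p m - p i - p j" if "i \<le> k" "j \<le> k" "m \<le> k" for i j m
      using \<theta>[OF that(1)] \<theta>[OF that(2)] \<theta>[OF that(3)] by (simp add: p_def ln_div ln_mult)
    have "(\<Sum>s\<in>?S. ln (?r s) * (?t s)\<^sup>2)
      = (\<Sum>i\<le>k. \<Sum>j\<le>k. \<Sum>m\<le>k. (p m - p i - p j) * (g (br (e i) (e j)) (e m))\<^sup>2)"
      unfolding sum.cartesian_product by (intro sum.cong refl) (auto simp: ln2)
    also note tot
    also have "(\<Sum>i\<le>k. \<Sum>j\<le>k. \<Sum>m\<le>k. (p m - p i - p j) * (g2 (br (w i) (w j)) (w m))\<^sup>2)
      = (\<Sum>s\<in>?S. ln (?r s) * (?r s * ?t s)\<^sup>2)"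
      unfolding sum.cartesian_product by (intro sum.cong refl) (auto simp: ln2 T2)
    finally have "?r (i, j, m) = 1"
      by (rule rigidity[rotated 2]) (use ijm \<theta> in auto)
    then show ?thesis using \<theta>[OF ijm(1)] \<theta>[OF ijm(2)] by (simp add: field_simps)
  qed
  \<comment> \<open>The positive square root of \<open>g2\<close> relative to \<open>g\<close>; it
    respects brackets because \<open>\<theta>\<close> is multiplicative on nonzero structure
    constants.\<close>
  define \<psi> where "\<psi> x = (\<Sum>i\<le>k. (\<theta> i * g x (e i)) *\<^sub>R e i)" for x
  have lin: "linear \<psi>"
    by (rule linearI) (simp_all add: \<psi>_def gbil algebra_simps sum.distrib scaleR_sum_right)
  have g\<psi>: "g (\<psi> x) (e m) = \<theta> m * g x (e m)" if "m \<le> k" for x m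
  proof -
    have "g (\<psi> x) (e m) = (\<Sum>i\<le>k. if i = m then \<theta> m * g x (e m) else 0)"
      unfolding \<psi>_def gbil using that by (intro sum.cong) (auto simp: orthonormal)
    then show ?thesis using that by simp
  qed
  have \<psi>e: "\<psi> (e i) = \<theta> i *\<^sub>R e i" if "i \<le> k" for i
    by (rule coordinates_eqI) (use that in \<open>auto simp: g\<psi> gbil orthonormal\<close>)
  have "x = 0" if "\<psi> x = 0" for x
  proof (rule coordinates_eqI)
    fix i assume "i \<in> {..k}"
    then show "g x (e i) = g 0 (e i)"
      using g\<psi>[of i x] \<theta>[of i] that by (auto simp: gbil)
  qed
  then have "inj \<psi>" using linear_injective_0[OF lin] by blast
  then have "bij \<psi>" using linear_injective_imp_surjective[OF lin] by (simp add: bij_def)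
  moreover have "\<psi> (br x y) = br (\<psi> x) (\<psi> y)" for x y
  proof (rule bilinear_eq_onb[of "\<lambda>x y. \<psi> (br x y)" "\<lambda>x y. br (\<psi> x) (\<psi> y)"])
    fix i j assume "i \<in> {..k}" "j \<in> {..k}"
    then have ij: "i \<le> k" "j \<le> k" by auto
    show "\<psi> (br (e i) (e j)) = br (\<psi> (e i)) (\<psi> (e j))"
    proof (rule coordinates_eqI)
      fix m assume "m \<in> {..k}"
      then show "g (\<psi> (br (e i) (e j))) (e m) = g (br (\<psi> (e i)) (\<psi> (e j))) (e m)"
        using mult[OF ij, of m] by (cases "g (br (e i) (e j)) (e m) = 0") (auto simp: g\<psi> \<psi>e ij bbil gbil)
    qed
  qed (auto simp: bilinear_def bbil linear_add[OF lin] linear_scale[OF lin] intro!: linearI)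
  moreover have "g2 x y = g (\<psi> x) (\<psi> y)" for x y
  proof (rule bilinear_eq_onb[OF metric_bilinear[OF g2], of "\<lambda>x y. g (\<psi> x) (\<psi> y)"])
    show "g2 (e i) (e j) = g (\<psi> (e i)) (\<psi> (e j))" if "i \<in> {..k}" "j \<in> {..k}" for i j
      using that by (simp add: \<psi>e diag gbil orthonormal power2_eq_square)
  qed (auto simp: bilinear_def gbil linear_add[OF lin] linear_scale[OF lin] intro!: linearI)
  ultimately show ?thesis using lin by (auto simp: lie_automorphism_def)
qed

text \<open>The metric \<open>g2\<close> is diagonalised with respect to \<open>g\<close> on
  \<open>N\<close> alone; as both metrics have the same normal line, the resulting basis is
  orthogonal for both on the whole algebra.\<close>

lemma soliton_unique:
  assumes c: "c < 0" and g2: "left_invariant_metric g2"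
    and Ric2: "\<And>x. ricci_operator br g2 x = c *\<^sub>R x + D x"
    and perp: "\<And>y. y \<in> N \<Longrightarrow> g2 y A = 0" and d: "k = dim N" "dim N + 1 = DIM('a)"
  shows "\<exists>\<psi>. lie_automorphism br \<psi> \<and> (\<forall>x y. g2 x y = g (\<psi> x) (\<psi> y))"
proof -
  note bg2 = bilin[OF metric_bilinear[OF g2]]
  obtain v where v: "codim_one_metric g (dim N) v br N"
    "\<forall>i<dim N. \<forall>y\<in>N. g2 (v i) y = g2 (v i) (v i) * g (v i) y"
    using exists_codim_one_metric[OF lie nilpotent d(2) metric metric_bilinear[OF g2] metric_sym[OF g2]]
    by blast
  interpret V: codim_one_metric g k v br N using v(1) d by simp
  interpret V: codim_one_soliton g k v br N c D
    by unfold_locales (use D ricci_D not_nilpotent in auto)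
  have vk: "v k = g (v k) A *\<^sub>R A"
  proof (rule coordinates_eqI)
    fix i assume i: "i \<in> {..k}"
    show "g (v k) (e i) = g (g (v k) A *\<^sub>R A) (e i)"
      using i V.A_perp[OF e_N[of i]] by (cases "i = k") (auto simp: gbil orthonormal gsym[of "v k"])
  qed
  have "g2 y (v k) = g (v k) A * g2 y A" for y by (subst vk) (simp add: bg2)
  then have perp': "g2 y (v k) = 0" if "y \<in> N" for y using perp[OF that] by simp
  have nz: "v i \<noteq> 0" if "i \<le> k" for i
    using V.orthonormal[of i i] that gbil(9)[of "v i"] by auto
  have diag: "g2 y (v i) = g2 (v i) (v i) * g y (v i)" if i: "i \<le> k" for i y
  proof -
    obtain n b where n: "n \<in> N" "y = b *\<^sub>R v k + n" by (metis V.split_N)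
    have "g2 n (v i) = g2 (v i) (v i) * g n (v i)"
    proof (cases "i = k")
      case True then show ?thesis using perp'[OF n(1)] V.A_perp[OF n(1)] by simp
    next
      case False
      then show ?thesis
        using v(2)[rule_format, of i n] i n(1) d metric_sym[OF g2, of n "v i"] gsym[of n "v i"] by simp
    qed
    moreover have "g2 (v k) (v i) = g2 (v i) (v i) * g (v k) (v i)"
    proof (cases "i = k")
      case True then show ?thesis using V.orthonormal[of k k] by simp
    next
      case False
      then show ?thesis
        using i perp'[OF V.e_N, of i] V.orthonormal[of k i] metric_sym[OF g2, of "v k" "v i"] by simp
    qed
    ultimately show ?thesis by (simp add: n(2) bg2 gbil algebra_simps)
  qed
  show ?thesis
  proof (rule V.soliton_unique_diagonal[OF c g2 Ric2, of "\<lambda>i. sqrt (g2 (v i) (v i))"])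
    show "0 < sqrt (g2 (v i) (v i))" if "i \<le> k" for i using metric_pos[OF g2 nz[OF that]] by simp
    show "g2 y (v i) = (sqrt (g2 (v i) (v i)))\<^sup>2 * g y (v i)" if "i \<le> k" for i y
      using diag[OF that, of y] by (simp only: real_sqrt_pow2[OF metric_nonneg[OF g2]])
  qed
qed

end

section \<open>Maximality\<close>

lemma orthonormal_span_expansion:
  assumes g: "left_invariant_metric g" and I: "finite I"
    and on: "\<And>i j. i \<in> I \<Longrightarrow> j \<in> I \<Longrightarrow> g (f i) (f j) = (if i = j then 1 else 0)"
    and x: "x \<in> span (f ` I)"
  shows "x = (\<Sum>i\<in>I. g x (f i) *\<^sub>R f i)"
proof -
  note bg = bilin[OF metric_bilinear[OF g]]
  let ?S = "{x. x = (\<Sum>i\<in>I. g x (f i) *\<^sub>R f i)}"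
  have "subspace ?S"
    by (auto simp: subspace_def bg scaleR_add_left sum.distrib scaleR_sum_right[symmetric]
        scaleR_scaleR[symmetric] simp del: scaleR_scaleR)
  moreover have "f ` I \<subseteq> ?S"
  proof safe
    fix j assume j: "j \<in> I"
    have "(\<Sum>i\<in>I. g (f j) (f i) *\<^sub>R f i) = (\<Sum>i\<in>I. if i = j then f j else 0)"
      using j by (intro sum.cong) (auto simp: on)
    then show "f j = (\<Sum>i\<in>I. g (f j) (f i) *\<^sub>R f i)" using j I by simp
  qed
  ultimately have "span (f ` I) \<subseteq> ?S" by (rule span_minimal[rotated])
  then show ?thesis using x by blast
qed

context codim_one_soliton
begin

text \<open>Gram--Schmidt is run inside \<open>N\<close>, where the decreasing order turns
  triangularity into the flag conditions, and the \<open>h\<close>-normal is appended. For the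
  normal they hold because the components of \<open>X\<close> have positive eigenvalues.\<close>

lemma exists_comparison:
  assumes c: "c < 0" and h: "left_invariant_metric h"
    and eig: "\<And>i. i \<le> k \<Longrightarrow> D (e i) = l i *\<^sub>R e i"
    and sorted: "\<And>i j. j < k \<Longrightarrow> i \<le> j \<Longrightarrow> l j \<le> l i"
    and X: "X \<in> N" "T X = 0" and perp: "\<And>y. y \<in> N \<Longrightarrow> h y (A + X) = 0"
  shows "\<exists>f a. soliton_comparison g k e br N c D h f l a X"
proof -
  note bh = bilin[OF metric_bilinear[OF h]]
  have ind: "e i \<notin> span (e ` {..<i})" if i: "i < k" for i
  proof
    assume "e i \<in> span (e ` {..<i})"
    moreover have "span (e ` {..<i}) \<subseteq> {x. g x (e i) = 0}"
      using i by (intro span_minimal) (auto simp: orthonormal subspace_def gbil)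
    ultimately show False using i orthonormal[of i i] by auto
  qed
  obtain f0 where f0: "\<And>i. i < k \<Longrightarrow> f0 i \<in> span (e ` {..i})" "\<And>i. i < k \<Longrightarrow> e i \<in> span (f0 ` {..i})"
    "\<And>i j. i < k \<Longrightarrow> j < k \<Longrightarrow> h (f0 i) (f0 j) = (if i = j then 1 else 0)"
    using gram_schmidt_flag[OF h, of k e] ind by metis
  have "A + X \<noteq> 0"
  proof
    assume "A + X = 0"
    then have "g (A + X) A = 0" by (simp add: gbil)
    then show False using A_perp[OF X(1)] A_unit by (simp add: gbil)
  qed
  then have pos: "h (A + X) (A + X) > 0" by (rule metric_pos[OF h])
  define a where "a = 1 / sqrt (h (A + X) (A + X))"
  have a: "a > 0" using pos by (simp add: a_def)
  define f where "f = f0(k := a *\<^sub>R (A + X))"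
  have fk: "f k = a *\<^sub>R (A + X)" and fi: "\<And>i. i < k \<Longrightarrow> f i = f0 i" by (simp_all add: f_def)
  have him: "f ` {..i} = f0 ` {..i}" if "i < k" for i using that by (auto simp: f_def)
  have f0N: "f0 i \<in> N" if "i < k" for i
    using f0(1)[OF that] span_minimal[OF _ subspace_N, of "e ` {..i}"] e_N that by force
  have hfk: "h (f k) (f k) = 1" using pos by (simp add: fk bh(3,4) a_def)
  have perp': "h y (f k) = 0" "h (f k) y = 0" if "y \<in> N" for y
    using perp[OF that] metric_sym[OF h, of "f k" y] by (simp_all add: fk bh)
  have on: "h (f i) (f j) = (if i = j then 1 else 0)" if "i \<in> {..k}" "j \<in> {..k}" for i j
    using that hfk perp' f0N f0(3) fi by (cases "i = k"; cases "j = k") auto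
  have esp: "e i \<in> span (f ` {..k})" if "i < k" for i
    using f0(2)[OF that] span_mono[of "f0 ` {..i}" "f ` {..k}"] him[OF that] that by force
  have Xsp: "x \<in> span (f ` {..k})" if "x \<in> N" for x
  proof -
    have "x = (\<Sum>i<k. g x (e i) *\<^sub>R e i)"
      using A_perp[OF that] by (subst expansion) (simp add: lessThan_Suc_atMost[symmetric])
    also have "\<dots> \<in> span (f ` {..k})" using esp by (intro span_sum span_scale) auto
    finally show ?thesis .
  qed
  have Aeq: "A = (1 / a) *\<^sub>R f k - X" using a by (simp add: fk)
  have Asp: "A \<in> span (f ` {..k})"
    by (subst Aeq) (intro span_diff span_scale Xsp[OF X(1)] span_base; simp)
  have sp: "x \<in> span (f ` {..k})" for x
  proof -
    obtain n b where "n \<in> N" "x = b *\<^sub>R A + n" by (metis split_N)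
    then show ?thesis using Asp Xsp by (auto intro!: span_add span_scale)
  qed
  interpret H: codim_one_metric h k f br N
  proof unfold_locales
    show "x = (\<Sum>i\<in>{..k}. h x (f i) *\<^sub>R f i)" for x
      by (rule orthonormal_span_expansion[OF h _ on sp]) simp_all
    show "h (f i) (f j) = (if i = j then 1 else 0)" if "i \<in> {..k}" "j \<in> {..k}" for i j
      using that by (rule on)
  qed (use h lie nilpotent f0N perp' fi in auto)
  have Af: "A \<noteq> 0" using A_notin subspace_0[OF subspace_N] by auto
  have lk: "l k = 0" using eig[of k] D_A Af by simp
  have gX: "l i > 0" if "i \<le> k" "g X (e i) \<noteq> 0" for i
    using kernel_perp_nonpos_eigenvector[OF c X eig[OF that(1)]] that(2) by (meson not_less)
  have gf: "l j \<le> l i" if "i \<le> k" "j \<le> k" "g (f j) (e i) \<noteq> 0" for i j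
  proof (cases "j = k")
    case True
    then have "g A (e i) \<noteq> 0 \<or> g X (e i) \<noteq> 0" using that(3) by (auto simp: fk gbil)
    then show ?thesis using gX[OF that(1)] that(1) lk True by (cases "i = k") (auto simp: orthonormal)
  next
    case False
    then have j: "j < k" using that by simp
    have "i \<le> j"
    proof (rule ccontr)
      assume "\<not> i \<le> j"
      then have "span (e ` {..j}) \<subseteq> {x. g x (e i) = 0}"
        using j that by (intro span_minimal) (auto simp: orthonormal subspace_def gbil)
      then show False using f0(1)[OF j] that(3) fi[OF j] by auto
    qed
    then show ?thesis using sorted j by simp
  qed
  have hN: "l j \<le> l i" if "i \<le> k" "j < k" "h (e j) (f i) \<noteq> 0" for i j
  proof -
    have "i \<le> j"
    proof (rule ccontr)
      assume ij: "\<not> i \<le> j"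
      then have "span (f ` {..j}) \<subseteq> {x. h x (f i) = 0}"
        using that by (intro span_minimal) (auto simp: H.orthonormal subspace_def bh)
      then show False using f0(2)[OF that(2)] that(3) him[OF that(2)] by auto
    qed
    then show ?thesis using sorted[OF that(2)] by simp
  qed
  have he: "l j \<le> l i" if "i \<le> k" "j \<le> k" "h (e j) (f i) \<noteq> 0" for i j
  proof (cases "j = k")
    case False then show ?thesis using hN that by simp
  next
    case True
    show ?thesis
    proof (cases "i = k")
      case True then show ?thesis using \<open>j = k\<close> by simp
    next
      case False
      \<comment> \<open>As \<open>f i\<close> is orthogonal to \<open>f k\<close>, \<open>A\<close>
        may be replaced by \<open>- X\<close>, whose components lie in \<open>N\<close>, where
        \<open>hN\<close> applies, and have positive eigenvalues.\<close>
      then have "h A (f i) = - h X (f i)"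
        using that(1) perp'(2)[OF H.e_N, of i] by (subst Aeq) (simp add: bh)
      then have "h (\<Sum>m\<le>k. g X (e m) *\<^sub>R e m) (f i) \<noteq> 0"
        using that(3) True unfolding expansion[symmetric] by simp
      then have "(\<Sum>m\<le>k. g X (e m) * h (e m) (f i)) \<noteq> 0" by (simp add: bh)
      then obtain m where m: "m \<le> k" "g X (e m) * h (e m) (f i) \<noteq> 0"
        by (metis (no_types, lifting) atMost_iff sum.neutral)
      then have "l m > 0" "m < k" using gX[of m] lk by (auto simp: le_less)
      then have "0 < l i" using hN[OF that(1), of m] m by auto
      then show ?thesis using True lk by simp
    qed
  qed
  have "soliton_comparison g k e br N c D h f l a X"
    by unfold_locales (use c eig X a fk gf he in auto)
  then show ?thesis by blast
qed

end

theorem theorem1p1: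
  fixes br :: "'a::euclidean_space \<Rightarrow> 'a \<Rightarrow> 'a"
    and N :: "'a set"
    and g :: "'a \<Rightarrow> 'a \<Rightarrow> real"
  assumes "solvable_lie_algebra br"
    and "is_nilradical br N"
    and "dim N + 1 = DIM('a)"
    and "solvsoliton br g"
    and "ricci_operator br g \<noteq> (\<lambda>x. 0)"
  shows "is_arg_max (ricci_pinching br) left_invariant_metric g \<and>
    (\<forall>g'. is_arg_max (ricci_pinching br) left_invariant_metric g' \<longrightarrow>
      solvsoliton br g' \<and>
      (\<exists>c \<phi>. c > 0 \<and> lie_automorphism br \<phi> \<and> (\<forall>x y. g' x y = c * g (\<phi> x) (\<phi> y))))"
proof -
  have lie: "lie_algebra br" using assms(1) by (simp add: solvable_lie_algebra_def)
  have N: "nilpotent_ideal br N" using assms(2) by (simp add: is_nilradical_def)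
  have g: "left_invariant_metric g" using assms(4) by (simp add: solvsoliton_def)
  obtain c D where D: "derivation br D" "\<And>x. ricci_operator br g x = c *\<^sub>R x + D x"
    using assms(4) by (auto simp: solvsoliton_def)
  \<comment> \<open>Maximality of the nilradical enters here.\<close>
  have nn: "\<not> nilpotent_ideal br UNIV"
  proof
    assume "nilpotent_ideal br UNIV"
    then have "N = UNIV" using assms(2) by (auto simp: is_nilradical_def)
    then show False using assms(3) by (simp add: dim_UNIV)
  qed
  let ?k = "dim N" and ?q = "\<lambda>x y. g (D x) y"
  have soliton: "codim_one_soliton g ?k e br N c D" if "codim_one_metric g ?k e br N" for e
    using that D nn by (simp add: codim_one_soliton_def codim_one_soliton_axioms_def)
  \<comment> \<open>This first basis only serves to establish the symmetry of \<open>D\<close>,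
    after which its form can be diagonalised on \<open>N\<close>.\<close>
  obtain e0 where "codim_one_metric g ?k e0 br N"
    using exists_codim_one_metric[OF lie N assms(3) g metric_bilinear[OF g] metric_sym[OF g]] by blast
  then have S0: "codim_one_soliton g ?k e0 br N c D" by (rule soliton)
  have q: "?q x y = ?q y x" for x y
    using codim_one_soliton.D_sym[OF S0, of x y] metric_sym[OF g, of x "D y"] by simp
  obtain e where e: "codim_one_metric g ?k e br N"
    "\<And>i y. i < ?k \<Longrightarrow> y \<in> N \<Longrightarrow> ?q (e i) y = ?q (e i) (e i) * g (e i) y"
    "\<And>i j. j < ?k \<Longrightarrow> i \<le> j \<Longrightarrow> ?q (e j) (e j) \<le> ?q (e i) (e i)"
    using exists_codim_one_metric[OF lie N assms(3) g codim_one_soliton.bilinear_D[OF S0] q] by blast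
  interpret S: codim_one_soliton g ?k e br N c D by (rule soliton[OF e(1)])
  have c: "c < 0" by (rule S.c_neg[OF assms(5)])
  define l where "l i = ?q (e i) (e i)" for i
  have eig: "D (e i) = l i *\<^sub>R e i" if "i \<le> ?k" for i
  proof (cases "i = ?k")
    case True then show ?thesis by (simp add: l_def S.D_A S.gbil)
  next
    case False
    then have i: "i < ?k" using that by simp
    let ?d = "D (e i) - l i *\<^sub>R e i"
    have "?d \<in> N" using S.D_N S.e_N[OF i] S.subspace_N by (intro subspace_diff subspace_scale) auto
    then have "g ?d ?d = 0" using e(2)[OF i, of ?d] by (simp add: S.gbil(7) S.gbil(3) l_def)
    then show ?thesis by (simp add: metric_eq_0_iff[OF g])
  qed
  have sorted: "l j \<le> l i" if "j < ?k" "i \<le> j" for i j using e(3)[OF that] by (simp add: l_def)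
  have main: "ricci_pinching br g' \<le> ricci_pinching br g \<and>
      (ricci_pinching br g \<le> ricci_pinching br g' \<longrightarrow>
        (\<exists>s \<phi>. s > 0 \<and> lie_automorphism br \<phi> \<and> (\<forall>x y. g' x y = s * g (\<phi> x) (\<phi> y))))"
    if g': "left_invariant_metric g'" for g'
  proof -
    note bg' = bilin[OF metric_bilinear[OF g']]
    obtain f' where f': "codim_one_metric g' ?k f' br N"
      using exists_codim_one_metric[OF lie N assms(3) g' metric_bilinear[OF g'] metric_sym[OF g']] by blast
    interpret G: codim_one_metric g' ?k f' br N by (rule f')
    obtain b Y0 where b: "Y0 \<in> N" "f' ?k = b *\<^sub>R S.A + Y0" by (metis S.split_N)
    have b0: "b \<noteq> 0" using b G.A_notin by auto
    define Y where "Y = (1 / b) *\<^sub>R Y0"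
    have Y: "Y \<in> N" using b by (simp add: Y_def subspace_scale[OF S.subspace_N])
    have AY: "S.A + Y = (1 / b) *\<^sub>R f' ?k" using b0 by (simp add: b Y_def scaleR_add_right)
    obtain \<phi> X where \<phi>: "lie_automorphism br \<phi>" "\<forall>x\<in>N. \<phi> x \<in> N" and X: "X \<in> N" "S.T X = 0"
      "\<phi> (S.A + Y) = S.A + X"
      using S.conjugate_into_kernel[OF Y] by blast
    \<comment> \<open>Pull-back by \<open>inv \<phi>\<close> moves the normal direction
      \<open>A + Y\<close> of \<open>g'\<close> to \<open>A + X\<close> and keeps the pinching; the
      factor 1 fits the pattern of \<open>equivalent_metrics\<close>.\<close>
    define h where "h x y = 1 * g' (inv \<phi> x) (inv \<phi> y)" for x y
    interpret E: equivalent_metrics br g' h 1 "inv \<phi>"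
      by unfold_locales (use lie g' \<phi> lie_automorphism_inv h_def in auto)
    have left: "inv \<phi> (\<phi> x) = x" for x using \<phi>(1) by (simp add: lie_automorphism_def bij_def)
    have lphi: "linear \<phi>" using \<phi>(1) by (simp add: lie_automorphism_def)
    have injphi: "inj \<phi>" using \<phi>(1) by (simp add: lie_automorphism_def bij_def)
    \<comment> \<open>Equality, by dimension, is what makes \<open>inv \<phi>\<close> preserve
      \<open>N\<close>.\<close>
    have "\<phi> ` N = N"
    proof (rule subspace_dim_equal)
      show "subspace (\<phi> ` N)" by (rule linear_subspace_image[OF lphi S.subspace_N])
      show "dim N \<le> dim (\<phi> ` N)"
        using dim_image_eq[OF lphi, of N] inj_on_subset[OF injphi subset_UNIV] by simp
    qed (use \<phi>(2) S.subspace_N in auto)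
    then have invN: "inv \<phi> y \<in> N" if "y \<in> N" for y using that left by (metis imageE)
    have perp: "h y (S.A + X) = 0" if "y \<in> N" for y
      using G.A_perp[OF invN[OF that]] X(3)[symmetric] by (simp add: h_def left AY bg')
    obtain f a where "soliton_comparison g ?k e br N c D h f l a X"
      using S.exists_comparison[OF c E.metric2 eig sorted X(1,2) perp] by blast
    then interpret P: soliton_comparison g ?k e br N c D h f l a X .
    have F: "ricci_pinching br h = ricci_pinching br g'" by (rule E.ricci_pinching_equivariant)
    have "\<exists>s \<phi>. s > 0 \<and> lie_automorphism br \<phi> \<and> (\<forall>x y. g' x y = s * g (\<phi> x) (\<phi> y))"
      if ge: "ricci_pinching br g \<le> ricci_pinching br g'"
    proof -
      from ge have gh: "ricci_pinching br g \<le> ricci_pinching br h" by (simp only: F)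
      obtain t u where t: "t > 0" and u: "lie_automorphism br u"
        and Ru: "\<forall>x. ricci_operator br (\<lambda>x y. t * h (u x) (u y)) x = c *\<^sub>R x + D x"
        and pu: "\<forall>y\<in>N. t * h (u y) (u S.A) = 0"
        using P.exists_isometric_soliton[OF gh] by (elim exE conjE)
      interpret U: equivalent_metrics br h "\<lambda>x y. t * h (u x) (u y)" t u
        by unfold_locales (use lie E.metric2 t u in auto)
      obtain \<psi> where \<psi>: "lie_automorphism br \<psi>" "\<And>x y. t * h (u x) (u y) = g (\<psi> x) (\<psi> y)"
        using S.soliton_unique[OF c U.metric2 Ru[rule_format] pu[rule_format] refl assms(3)]
        by blast
      \<comment> \<open>\<open>g'\<close> is the pull-back of \<open>h\<close> by
        \<open>\<phi>\<close>, and \<open>t h\<close> is the pull-back of \<open>g\<close> by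
        \<open>\<psi> \<circ> inv u\<close>.\<close>
      have "g' x y = (1 / t) * g (\<psi> (inv u (\<phi> x))) (\<psi> (inv u (\<phi> y)))" for x y
        using t by (simp add: \<psi>(2)[symmetric] U.right_inv h_def left)
      moreover have "lie_automorphism br (\<lambda>x. \<psi> (inv u (\<phi> x)))"
        using lie_automorphism_compose[OF \<psi>(1) lie_automorphism_compose[OF lie_automorphism_inv[OF u] \<phi>(1)]] .
      ultimately show ?thesis using t
        by (intro exI[of _ "1 / t"] exI[of _ "\<lambda>x. \<psi> (inv u (\<phi> x))"]) simp
    qed
    then show ?thesis using P.pinching_le F by simp
  qed
  show ?thesis
  proof (intro conjI allI impI)
    show "is_arg_max (ricci_pinching br) left_invariant_metric g"
      using g main by (force simp: is_arg_max_def not_less)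
    fix g' assume max: "is_arg_max (ricci_pinching br) left_invariant_metric g'"
    then have g': "left_invariant_metric g'" and "ricci_pinching br g \<le> ricci_pinching br g'"
      using g by (auto simp: is_arg_max_def not_less)
    then obtain s \<phi> where s: "s > 0" "lie_automorphism br \<phi>" "\<And>x y. g' x y = s * g (\<phi> x) (\<phi> y)"
      using main by blast
    then show "\<exists>c \<phi>. c > 0 \<and> lie_automorphism br \<phi> \<and> (\<forall>x y. g' x y = c * g (\<phi> x) (\<phi> y))" by blast
    interpret E: equivalent_metrics br g g' s \<phi>
      by unfold_locales (use lie g s in auto)
    show "solvsoliton br g'" by (rule E.solvsoliton_equivariant[OF assms(4)])
  qed
qed

end
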